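(* Let $K\ge1$ be an integer. There is a nonzero polynomial $P$ in $K$ variables such that for all $\alpha_1,\dots,\alpha_K\in\mathbb{R}$ with $P(\alpha_1,\dots,\alpha_K)\neq0$ and every $E\in S_3\setminus S_2$ (formed with the phase set $\{0,\pm\alpha_1,\dots,\pm\alpha_K\}$) satisfying $$\min\Bigl\{\frac{\alpha_1^2}4,\dots,\frac{\alpha_K^2}4\Bigr\}<E<\max\Bigl\{\frac{\alpha_1^2}4,\dots,\frac{\alpha_K^2}4\Bigr\},$$ the following holds. Let $j_1,j_2\in\{1,\dots,K\}$ and $\epsilon_1,\epsilon_2\in\{1,-1\}$ be such that $2\sqrt E=\epsilon_1\alpha_{j_1}+\epsilon_2\alpha_{j_2}$. Then there is a constant $C>0$, depending only on $\alpha_1,\dots,\alpha_K$ and $E$, such that for all $\gamma\in(\frac13,\frac12]$ and all $\lambda_1,\dots,\lambda_K>0$ which obey $$\sum_{k=1}^K\frac{\lambda_k^2}{4E-\alpha_k^2}=0,$$ there exist functions $\xi_1,\dots,\xi_K\in C^1$ with $\xi_k'(x)=O(x^{-3\gamma})$ as $x\to\infty$ such that for the real-valued potential $V$ with $$V(x)=\sum_{k=1}^K\lambda_k\frac1{x^\gamma}\cos(\alpha_kx+\xi_k(x)),\qquad x\ge x_0,$$ the equation $-u''(x)+V(x)u(x)=Eu(x)$ has a real-valued solution $u$ with $$\frac1{\sqrt E}u'(x)+iu(x)=\mathcal{A}\,f(x)\,e^{i[\sqrt E\,x+\theta_\infty]}(1+o(1)),\qquad x\to\infty,$$ for some constants $\mathcal{A}>0$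 and $\theta_\infty\in\mathbb{R}$, where $$f(x)=\begin{cases}x^{-C\lambda_{j_1}\lambda_{j_2}}, & \gamma=\frac12,\\[4pt] \exp\Bigl(-\frac{C}{1-2\gamma}\lambda_{j_1}\lambda_{j_2}x^{1-2\gamma}\Bigr), & \gamma\in\bigl(\frac13,\frac12\bigr).\end{cases}$$ In particular, for $\gamma\in(\frac13,\frac12)$, or for $\gamma=\frac12$ and all large enough values of the product $\lambda_{j_1}\lambda_{j_2}$, there is a boundary condition $\theta\in[0,\pi)$ such that $E$ is an eigenvalue of $H_\theta$.
   Context: For a finite set $A\subset\mathbb{R}$ and a positive integer $p$, $$S_p=\Bigl\{\tfrac{\eta^2}4\ \Bigm|\ \eta\in\bigcup_{k=1}^{p-1}(\underbrace{A+\dots+A}_{k\text{ times}})\Bigr\};$$ here $A=\{0,\pm\alpha_1,\dots,\pm\alpha_K\}$. $V$ is a real-valued potential on $(0,\infty)$ given by the displayed formula for $x\ge x_0$ (some $x_0>0$) and real-valued and integrable on $(0,x_0)$. For such $V$, the endpoint $0$ is regular and $-\frac{d^2}{dx^2}+V$ is limit point at $+\infty$. $H_\theta$ ($\theta\in[0,\pi)$) is the self-adjoint operator on $L^2(0,\infty)$ with domain $\{u\in L^2(0,\infty)\mid u,u'\in\mathrm{AC}_{\mathrm{loc}},\ -u''+Vu\in L^2,\ u'(0)\sin\theta=u(0)\cos\theta\}$ acting as $H_\theta u=-u''+Vu$. *)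

theory Defs
  imports
    "HOL-Analysis.Analysis"
    "HOL-Library.Poly_Mapping"
    "HOL-Library.Set_Algebras"
    "HOL-Library.Landau_Symbols"
begin

text \<open>
  A polynomial in the variables \<open>X\<^sub>i\<close> (\<open>i :: nat\<close>) with real coefficients is a finitely supported
  map from monomials (exponent vectors, themselves finitely supported) to coefficients; the
  nonzero polynomials are the elements different from \<open>0\<close>.
\<close>

type_synonym mpolynomial = "(nat \<Rightarrow>\<^sub>0 nat) \<Rightarrow>\<^sub>0 real"

definition mpoly_vars :: "mpolynomial \<Rightarrow> nat set" where
  "mpoly_vars P = (\<Union>m\<in>Poly_Mapping.keys P. Poly_Mapping.keys m)"

definition mpoly_eval :: "mpolynomial \<Rightarrow> (nat \<Rightarrow> real) \<Rightarrow> real" where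
  "mpoly_eval P a =
     (\<Sum>m\<in>Poly_Mapping.keys P.
        Poly_Mapping.lookup P m * (\<Prod>i\<in>Poly_Mapping.keys m. a i ^ Poly_Mapping.lookup m i))"

definition phase_set :: "nat \<Rightarrow> (nat \<Rightarrow> real) \<Rightarrow> real set" where
  "phase_set K \<alpha> = {0} \<union> \<alpha> ` {1..K} \<union> (\<lambda>k. - \<alpha> k) ` {1..K}"

text \<open>The inner sum is the \<open>k\<close>-fold Minkowski sum \<open>A + \<dots> + A\<close>.\<close>

definition S_set :: "real set \<Rightarrow> nat \<Rightarrow> real set" where
  "S_set A p = (\<lambda>\<eta>. \<eta>\<^sup>2 / 4) ` (\<Union>k\<in>{1..p-1}. (\<Sum>i\<in>{1..k}. A))"

definition abs_cont_on_interval ::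
  "(real \<Rightarrow> 'a::real_normed_vector) \<Rightarrow> real \<Rightarrow> real \<Rightarrow> bool" where
  "abs_cont_on_interval f a b \<longleftrightarrow>
     (\<forall>e>0. \<exists>d>0. \<forall>(n::nat) s t.
        (\<forall>i<n. a \<le> s i \<and> s i \<le> t i \<and> t i \<le> b) \<longrightarrow>
        disjoint_family_on (\<lambda>i. {s i<..<t i}) {..<n} \<longrightarrow>
        (\<Sum>i<n. t i - s i) < d \<longrightarrow>
        (\<Sum>i<n. norm (f (t i) - f (s i))) < e)"

text \<open>
  The endpoint \<open>0\<close> is regular, so local absolute continuity is meant on the closed half-line
  \<open>[0,\<infinity>)\<close>; this is what gives \<open>u(0)\<close> and \<open>u'(0)\<close> a meaning.
\<close>

definition AC_loc :: "(real \<Rightarrow> 'a::real_normed_vector) \<Rightarrow> bool" where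
  "AC_loc f \<longleftrightarrow> (\<forall>b>0. abs_cont_on_interval f 0 b)"

definition D_half :: "(real \<Rightarrow> 'a::real_normed_vector) \<Rightarrow> real \<Rightarrow> 'a" where
  "D_half u x = vector_derivative u (at x within {0..})"

text \<open>
  \<open>u, u' \<in> AC\<^sub>l\<^sub>o\<^sub>c\<close>. Then \<open>u''\<close> exists almost everywhere; on the exceptional null set the value of
  \<open>D_half (D_half u)\<close> is arbitrary, and all conditions below on \<open>u''\<close> are insensitive to null sets.
\<close>

definition AC_loc2 :: "(real \<Rightarrow> 'a::real_normed_vector) \<Rightarrow> bool" where
  "AC_loc2 u \<longleftrightarrow>
     AC_loc u \<and> (\<forall>x\<ge>0. u differentiable (at x within {0..})) \<and> AC_loc (D_half u)"

definition schroedinger ::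
  "(real \<Rightarrow> real) \<Rightarrow> (real \<Rightarrow> 'a::real_normed_vector) \<Rightarrow> real \<Rightarrow> 'a" where
  "schroedinger V u x = - D_half (D_half u) x + V x *\<^sub>R u x"

definition schroedinger_solution ::
  "(real \<Rightarrow> real) \<Rightarrow> real \<Rightarrow> (real \<Rightarrow> 'a::real_normed_vector) \<Rightarrow> bool" where
  "schroedinger_solution V E u \<longleftrightarrow>
     AC_loc2 u \<and> (AE x in lebesgue_on {0<..}. schroedinger V u x = E *\<^sub>R u x)"

definition L2_half :: "(real \<Rightarrow> complex) set" where
  "L2_half = {u. u \<in> borel_measurable (lebesgue_on {0<..}) \<and>
                 integrable (lebesgue_on {0<..}) (\<lambda>x. (norm (u x))\<^sup>2)}"

text \<open>
  The domain of \<open>H\<^sub>\<theta>\<close>; \<open>H\<^sub>\<theta>\<close> acts on it as \<open>schroedinger V\<close>. Each class in \<open>L\<^sup>2(0,\<infinity>)\<close> belonging to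
  the domain is represented by its continuously differentiable member, extended to \<open>0\<close> by
  continuity; values on the negative axis play no role.
\<close>

definition H_dom :: "(real \<Rightarrow> real) \<Rightarrow> real \<Rightarrow> (real \<Rightarrow> complex) set" where
  "H_dom V \<theta> = {u. u \<in> L2_half \<and> AC_loc2 u \<and> schroedinger V u \<in> L2_half \<and>
                   D_half u 0 * of_real (sin \<theta>) = u 0 * of_real (cos \<theta>)}"

definition H_eigenvalue :: "(real \<Rightarrow> real) \<Rightarrow> real \<Rightarrow> real \<Rightarrow> bool" where
  "H_eigenvalue V \<theta> E \<longleftrightarrow>
     (\<exists>u\<in>H_dom V \<theta>. \<not> (AE x in lebesgue_on {0<..}. u x = 0) \<and>
        (AE x in lebesgue_on {0<..}. schroedinger V u x = of_real E * u x))"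

definition decaying_potential ::
  "nat \<Rightarrow> (nat \<Rightarrow> real) \<Rightarrow> (nat \<Rightarrow> real) \<Rightarrow> real \<Rightarrow> (nat \<Rightarrow> real \<Rightarrow> real) \<Rightarrow>
     real \<Rightarrow> (real \<Rightarrow> real) \<Rightarrow> bool" where
  "decaying_potential K \<alpha> lam \<gamma> \<xi> x\<^sub>0 V \<longleftrightarrow>
     set_integrable lebesgue {0<..<x\<^sub>0} V \<and>
     (\<forall>x\<ge>x\<^sub>0. V x = (\<Sum>k=1..K. lam k * (1 / x powr \<gamma>) * cos (\<alpha> k * x + \<xi> k x)))"

text \<open>The argument \<open>l\<close> stands for the product \<open>\<lambda>\<^bsub>j\<^sub>1\<^esub> \<lambda>\<^bsub>j\<^sub>2\<^esub>\<close>.\<close>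

definition decay_rate :: "real \<Rightarrow> real \<Rightarrow> real \<Rightarrow> real \<Rightarrow> real" where
  "decay_rate C \<gamma> l x =
     (if \<gamma> = 1/2 then x powr (- C * l)
      else exp (- (C / (1 - 2 * \<gamma>)) * l * x powr (1 - 2 * \<gamma>)))"

end

theory Submission
  imports Defs
begin

text \<open>
Write \<open>\<kappa> = sqrt E\<close>. The phases \<open>\<xi>\<^sub>k\<close> can all be taken to be \<open>0\<close>: for the potential
\<open>V = x\<^bsup>-\<gamma>\<^esup> \<Sum>\<lambda>\<^sub>k cos (\<alpha>\<^sub>k x)\<close> the decaying solution is obtained by asymptotic integration of a linear
system.

For a real solution \<open>u\<close>, the function \<open>w = u'/\<kappa> + \<i> u\<close> satisfies \<open>w' = \<i> \<kappa> w + (V/\<kappa>) Im w\<close>, and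
\<open>w = cis (\<kappa> x) a\<close> turns this into \<open>a' = q a + b cnj a\<close> with \<open>q = - \<i> V / (2 \<kappa>)\<close> and
\<open>b = \<i> V cis (- 2 \<kappa> x) / (2 \<kappa>)\<close>. Both coefficients are of size \<open>x\<^bsup>-\<gamma>\<^esup>\<close> and oscillate, with
frequencies \<open>\<omega>\<close> and \<open>\<omega> - 2 \<kappa>\<close> for \<open>\<omega>\<close> among \<open>\<plusminus>\<alpha>\<^sub>k\<close>; none of them vanishes, because the \<open>\<alpha>\<^sub>k\<close>
are generic and \<open>E\<close> is outside \<open>S\<^sub>2\<close>. The near-identity change of variables \<open>d = (1 - Q) a - B cnj a\<close>, where \<open>Q\<close> and \<open>B\<close> are
oscillating antiderivatives of \<open>q\<close> and \<open>b\<close>, therefore leaves coefficients of size \<open>x\<^bsup>-2\<gamma>\<^esup>\<close>, whose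
frequencies \<open>\<omega> + \<omega>'\<close> (at \<open>a\<close>) and \<open>\<omega> + \<omega>' - 2 \<kappa>\<close> (at \<open>cnj a\<close>) come from pairs. The nonzero ones
are removed by a second averaging step, with an error of size \<open>x\<^bsup>-3\<gamma>\<^esup>\<close>, which is integrable because
\<open>\<gamma> > 1/3\<close>. What remains are the resonances:
  \<^item> at \<open>a\<close>, the pairs \<open>\<omega>' = - \<omega>\<close>; their sum is a multiple of \<open>\<Sum> \<lambda>\<^sub>k\<^sup>2 / (4 E - \<alpha>\<^sub>k\<^sup>2)\<close>, which is
    zero by hypothesis;
  \<^item> at \<open>cnj a\<close>, the pair \<open>\<omega> = \<epsilon>\<^sub>1 \<alpha>\<^bsub>j\<^sub>1\<^esub>\<close>, \<open>\<omega>' = \<epsilon>\<^sub>2 \<alpha>\<^bsub>j\<^sub>2\<^esub>\<close> in its two orders; it contributes \<open>c x\<^bsup>-2\<gamma>\<^esup>\<close>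
    with \<open>|c| = C \<lambda>\<^bsub>j\<^sub>1\<^esub> \<lambda>\<^bsub>j\<^sub>2\<^esub>\<close> and \<open>C = 2 / (8 \<kappa> |\<alpha>\<^bsub>j\<^sub>1\<^esub> \<alpha>\<^bsub>j\<^sub>2\<^esub>|)\<close>, or half of that if \<open>j\<^sub>1 = j\<^sub>2\<close>.

The polynomial \<open>P\<close> is the product of all nonzero linear forms in the \<open>\<alpha>\<^sub>k\<close> with integer coefficients
of absolute value at most 4; where it does not vanish, there are no other resonant pairs
(\<open>signed_pair_sum_unique\<close>).

So \<open>d' = c x\<^bsup>-2\<gamma>\<^esup> cnj d\<close> up to an integrable perturbation (\<open>averaged_decaying_solution\<close>,
\<open>resonant_decaying_solution\<close>). After rotation by a constant phase \<open>c\<close> is negative: the real part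
decays like \<open>f = exp (- |c| \<integral> x\<^bsup>-2\<gamma>\<^esup>)\<close>, which is \<open>decay_rate\<close> up to a constant factor, and the
imaginary part grows like \<open>1 / f\<close>. As in Levinson's theorem, a contraction argument on a
neighbourhood of infinity then gives a solution asymptotic to \<open>f\<close> (\<open>levinson_decaying_solution\<close>).

This solution is continued down to \<open>0\<close> through the region where \<open>V\<close> is only integrable
(\<open>linear_terminal_value_problem\<close>). The continuation solves an integral equation; that it solves the
differential equation almost everywhere is the Lebesgue differentiation theorem
(\<open>indefinite_integral_has_derivative_ae\<close>). Finally \<open>u\<close> is an eigenfunction for some boundary condition
as soon as \<open>f\<close> is square integrable near infinity: always for \<open>\<gamma> < 1/2\<close>, and for \<open>\<gamma> = 1/2\<close> if
\<open>2 C \<lambda>\<^bsub>j\<^sub>1\<^esub> \<lambda>\<^bsub>j\<^sub>2\<^esub> > 1\<close>.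
\<close>


section \<open>Differentiation of indefinite integrals\<close>

text \<open>
The Henstock lemma bounds the total discrepancy between \<open>|I| f x\<close> and the integral over \<open>I\<close> along any
family of disjoint fine tagged intervals, and the Vitali covering theorem provides such a family which
covers the set below up to a null set. Each of its intervals contributes at least \<open>c\<close> times its
length, so the set has arbitrarily small outer measure.
\<close>

lemma negligible_large_averaging_error:
  fixes f :: "real \<Rightarrow> real"
  assumes f: "f integrable_on {a..b}" and c: "c > 0"
  shows "negligible {x\<in>{a<..<b}. \<forall>d>0. \<exists>y\<in>{a<..<b}. y \<noteq> x \<and> \<bar>y - x\<bar> < d \<and>
            \<bar>\<bar>y - x\<bar> * f x - integral {min x y..max x y} f\<bar> \<ge> c * \<bar>y - x\<bar>}" (is "negligible ?S")
  unfolding negligible_outer_le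
proof (intro allI impI)
  fix e :: real assume e: "e > 0"
  obtain \<gamma> where \<gamma>: "gauge \<gamma>"
    and hen: "\<And>p. \<lbrakk>p tagged_partial_division_of (cbox a b); \<gamma> fine p\<rbrakk> \<Longrightarrow>
             sum (\<lambda>(x,k). norm(measure lborel k *\<^sub>R f x - integral k f)) p < c * e"
    using Henstock_lemma[of f a b "c * e"] f c e by auto
  \<comment> \<open>An index \<open>(x, y)\<close> stands for the closed interval with end points \<open>x\<close> and \<open>y\<close>, tagged by \<open>x\<close>;
    as a ball it has centre \<open>ce\<close> and radius \<open>ra\<close>.\<close>
  define J where "J = (\<lambda>(x::real,y::real). {min x y..max x y})"
  define I where "I = {(x,y). x \<in> {a<..<b} \<and> y \<in> {a<..<b} \<and> y \<noteq> x \<and> J (x,y) \<subseteq> \<gamma> x \<and>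
            \<bar>\<bar>y - x\<bar> * f x - integral (J (x,y)) f\<bar> \<ge> c * \<bar>y - x\<bar>}"
  define ce where "ce = (\<lambda>(x::real,y::real). (x + y) / 2)"
  define ra where "ra = (\<lambda>(x::real,y::real). \<bar>y - x\<bar> / 2)"
  have J_eq: "cball (ce i) (ra i) = J i" for i
    by (cases i) (auto simp: J_def ce_def ra_def cball_eq_atLeastAtMost min_def max_def field_simps)
  have ra_pos: "0 < ra i" if "i \<in> I" for i
    using that by (auto simp: I_def ra_def)
  have cover: "\<exists>i. i \<in> I \<and> x \<in> cball (ce i) (ra i) \<and> ra i < d" if x: "x \<in> ?S" and d: "0 < d" for x d
  proof -
    have "open (\<gamma> x)" "x \<in> \<gamma> x" using \<gamma> by (auto simp: gauge_def)
    then obtain r where r: "r > 0" "ball x r \<subseteq> \<gamma> x" by (auto simp: open_contains_ball)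
    obtain y where y: "y \<in> {a<..<b}" "y \<noteq> x" "\<bar>y - x\<bar> < min d r"
      "\<bar>\<bar>y - x\<bar> * f x - integral {min x y..max x y} f\<bar> \<ge> c * \<bar>y - x\<bar>"
      using x d r(1) by (auto dest!: spec[of _ "min d r"])
    have "J (x,y) \<subseteq> ball x r" using y(3) by (auto simp: J_def dist_real_def)
    then have "(x,y) \<in> I" using x y r by (auto simp: I_def J_def)
    moreover have "x \<in> cball (ce (x,y)) (ra (x,y))" unfolding J_eq by (auto simp: J_def)
    moreover have "ra (x,y) < d" using y by (auto simp: ra_def)
    ultimately show ?thesis by blast
  qed
  obtain C where C: "countable C" "C \<subseteq> I"
     and pw: "pairwise (\<lambda>i j. disjnt (cball (ce i) (ra i)) (cball (ce j) (ra j))) C"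
     and neg: "negligible (?S - (\<Union>i \<in> C. cball (ce i) (ra i)))"
    using Vitali_covering_theorem_cballs[of I ra ?S ce, OF ra_pos cover] by blast
  have pw': "disjnt (J i) (J j)" if "i \<in> C" "j \<in> C" "i \<noteq> j" for i j
    using pw that by (auto simp: pairwise_def J_eq)
  have content_J: "measure lborel (J i) = \<bar>snd i - fst i\<bar>" for i
    by (cases i) (auto simp: J_def)
  have finite_bound: "measure lebesgue (\<Union> (J ` D)) \<le> e" if D: "finite D" "D \<subseteq> C" for D
  proof -
    define p where "p = (\<lambda>i. (fst i, J i)) ` D"
    have DI: "D \<subseteq> I" using D C by blast
    have inj: "inj_on (\<lambda>i. (fst i, J i)) D"
    proof (rule inj_onI)
      fix i j assume ij: "i \<in> D" "j \<in> D" "(fst i, J i) = (fst j, J j)"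
      have "fst i \<in> J i" by (cases i) (auto simp: J_def)
      then show "i = j" using pw'[of i j] ij D by (auto simp: disjnt_def)
    qed
    have "p tagged_partial_division_of (cbox a b)"
      unfolding tagged_partial_division_of_def
    proof (intro conjI allI impI)
      show "finite p" using D by (simp add: p_def)
      show "x \<in> K" if "(x,K) \<in> p" for x K using that by (auto simp: p_def J_def)
      show "K \<subseteq> cbox a b" if "(x,K) \<in> p" for x K
      proof -
        obtain u v where "(u, v) \<in> D" "K = J (u, v)" using \<open>(x,K) \<in> p\<close> by (auto simp: p_def)
        moreover from this DI have "u \<in> {a<..<b}" "v \<in> {a<..<b}" by (auto simp: I_def)
        ultimately show ?thesis by (auto simp: J_def)
      qed
      show "\<exists>u v. K = cbox u v" if "(x,K) \<in> p" for x K
      proof -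
        obtain u v where "K = J (u, v)" using \<open>(x,K) \<in> p\<close> by (fastforce simp: p_def)
        then show ?thesis unfolding J_def cbox_interval by blast
      qed
      show "interior K1 \<inter> interior K2 = {}"
        if "(x1,K1) \<in> p \<and> (x2,K2) \<in> p \<and> (x1,K1) \<noteq> (x2,K2)" for x1 K1 x2 K2
      proof -
        obtain i j where "i \<in> D" "j \<in> D" "i \<noteq> j" "K1 = J i" "K2 = J j"
          using \<open>(x1,K1) \<in> p \<and> _\<close> unfolding p_def by blast
        then have "disjnt K1 K2" using pw' D by blast
        then show ?thesis using interior_subset by (fastforce simp: disjnt_def)
      qed
    qed
    moreover have "J i \<subseteq> \<gamma> (fst i)" if "i \<in> I" for i using that by (auto simp: I_def)
    then have "\<gamma> fine p" using DI unfolding p_def fine_def by blast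
    ultimately have "sum (\<lambda>(x,k). norm(measure lborel k *\<^sub>R f x - integral k f)) p < c * e" by (rule hen)
    then have less: "(\<Sum>i\<in>D. \<bar>measure lborel (J i) * f (fst i) - integral (J i) f\<bar>) < c * e"
      unfolding p_def by (subst (asm) sum.reindex[OF inj]) (auto simp: o_def)
    have "c * (\<Sum>i\<in>D. measure lborel (J i)) \<le> (\<Sum>i\<in>D. \<bar>measure lborel (J i) * f (fst i) - integral (J i) f\<bar>)"
      unfolding sum_distrib_left
      by (rule sum_mono) (use DI in \<open>auto simp: I_def content_J\<close>)
    with less c have "(\<Sum>i\<in>D. measure lborel (J i)) \<le> e"
      by (meson less_eq_real_def mult_less_cancel_left_pos order_le_less_trans)
    moreover have "measure lebesgue (\<Union> (J ` D)) \<le> (\<Sum>i\<in>D. measure lebesgue (J i))"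
      by (rule measure_UNION_le) (use D in \<open>auto simp: J_def\<close>)
    moreover have "measure lebesgue (J i) = measure lborel (J i)" for i
      by (cases i) (auto simp: J_def)
    ultimately show ?thesis by auto
  qed
  have "\<Union> (J ` C) \<in> lmeasurable \<and> measure lebesgue (\<Union> (J ` C)) \<le> e"
  proof (rule conjI)
    have *: "countable (J ` C)" "\<And>s. s \<in> J ` C \<Longrightarrow> s \<in> lmeasurable" using C by (auto simp: J_def)
    have **: "measure lebesgue (\<Union> D') \<le> e" if "D' \<subseteq> J ` C" "finite D'" for D'
      using finite_bound finite_subset_image[OF that(2,1)] by auto
    show "\<Union> (J ` C) \<in> lmeasurable"
      by (rule fmeasurable_Union_bound[OF * **])
    show "measure lebesgue (\<Union> (J ` C)) \<le> e"
      by (rule measure_Union_bound[OF * **])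
  qed
  moreover have "?S \<subseteq> (?S - \<Union> (J ` C)) \<union> \<Union> (J ` C)" by auto
  moreover have "(?S - \<Union> (J ` C)) \<union> \<Union> (J ` C) \<in> lmeasurable
    \<and> measure lebesgue ((?S - \<Union> (J ` C)) \<union> \<Union> (J ` C)) \<le> e"
    using neg calculation(1) unfolding J_eq
    by (metis (no_types, lifting) Un_commute fmeasurable.Un measure_Un_null_set negligible_iff_null_sets 
       negligible_imp_measurable  fmeasurableD)
  ultimately show "\<exists>T. ?S \<subseteq> T \<and> T \<in> lmeasurable \<and> measure lebesgue T \<le> e"
    by blast
qed

text \<open>
Lebesgue's differentiation theorem on the line: a point where the difference quotients do not converge
to \<open>f x\<close> has averaging errors of relative size \<open>1/n\<close> at arbitrarily small scales, for some \<open>n\<close>.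
\<close>

lemma indefinite_integral_has_derivative_ae:
  fixes f :: "real \<Rightarrow> real"
  assumes f: "f integrable_on {a..b}"
  shows "negligible {x\<in>{a<..<b}. \<not> ((\<lambda>t. integral {a..t} f) has_real_derivative f x) (at x)}"
proof -
  define F where "F = (\<lambda>t. integral {a..t} f)"
  define S where "S = (\<lambda>c. {x\<in>{a<..<b}. \<forall>d>0. \<exists>y\<in>{a<..<b}. y \<noteq> x \<and> \<bar>y - x\<bar> < d \<and>
            \<bar>\<bar>y - x\<bar> * f x - integral {min x y..max x y} f\<bar> \<ge> c * \<bar>y - x\<bar>})"
  have F_diff: "integral {x..y} f = F y - F x" if "a \<le> x" "x \<le> y" "y \<le> b" for x y
    using Henstock_Kurzweil_Integration.integral_combine[of a x y f] that
      integrable_subinterval_real[OF f, of a y] by (auto simp: F_def)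
  have "{x\<in>{a<..<b}. \<not> (F has_real_derivative f x) (at x)} \<subseteq> (\<Union>n. S (1 / real (Suc n)))"
  proof (rule subsetI, rule ccontr)
    fix x assume x: "x \<in> {x\<in>{a<..<b}. \<not> (F has_real_derivative f x) (at x)}"
      and nS: "x \<notin> (\<Union>n. S (1 / real (Suc n)))"
    have "((\<lambda>y. (F y - F x) / (y - x)) \<longlongrightarrow> f x) (at x)"
    proof (rule tendstoI)
      fix \<epsilon> :: real assume "\<epsilon> > 0"
      then obtain n where n: "1 / real (Suc n) < \<epsilon>" using nat_approx_posE by blast
      have "x \<notin> S (1 / real (Suc n))" using nS by blast
      then obtain d where d: "d > 0"
        "\<And>y. y \<in> {a<..<b} \<Longrightarrow> y \<noteq> x \<Longrightarrow> \<bar>y - x\<bar> < d \<Longrightarrow>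
          \<bar>\<bar>y - x\<bar> * f x - integral {min x y..max x y} f\<bar> < 1 / real (Suc n) * \<bar>y - x\<bar>"
        using x unfolding S_def mem_Collect_eq by (metis (no_types, lifting) not_le)
      have "\<forall>\<^sub>F y in at x. y \<in> {a<..<b}"
        using x by (intro eventually_at_in_open') auto
      moreover have "\<forall>\<^sub>F y in at x. y \<noteq> x \<and> \<bar>y - x\<bar> < d"
        using d(1) by (auto simp: eventually_at dist_real_def)
      ultimately show "\<forall>\<^sub>F y in at x. dist ((F y - F x) / (y - x)) (f x) < \<epsilon>"
      proof eventually_elim
        case (elim y)
        have "\<bar>\<bar>y - x\<bar> * f x - integral {min x y..max x y} f\<bar> = \<bar>(y - x) * f x - (F y - F x)\<bar>"
          using F_diff[of x y] F_diff[of y x] x elim by (cases "x \<le> y") (auto simp: algebra_simps)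
        with d(2)[of y] elim have "\<bar>(y - x) * f x - (F y - F x)\<bar> < 1 / real (Suc n) * \<bar>y - x\<bar>" by auto
        moreover have "(y - x) * f x - (F y - F x) = - ((F y - F x) / (y - x) - f x) * (y - x)"
          using elim by (simp add: field_simps)
        ultimately have "\<bar>(F y - F x) / (y - x) - f x\<bar> * \<bar>y - x\<bar> < 1 / real (Suc n) * \<bar>y - x\<bar>"
          by (metis abs_minus_cancel abs_mult)
        then have "\<bar>(F y - F x) / (y - x) - f x\<bar> < 1 / real (Suc n)"
          by (simp only: mult_less_cancel_right)
        then show ?case using n by (simp add: dist_real_def)
      qed
    qed
    then show False using x by (simp add: has_field_derivative_iff)
  qed
  moreover have "negligible (\<Union>n. S (1 / real (Suc n)))"
  proof (rule negligible_countable_Union)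
    show "countable (range (\<lambda>n. S (1 / real (Suc n))))" by simp
    show "negligible T" if "T \<in> range (\<lambda>n. S (1 / real (Suc n)))" for T
    proof -
      obtain n where "T = S (1 / real (Suc n))" using \<open>T \<in> range _\<close> by blast
      then show ?thesis unfolding S_def using negligible_large_averaging_error[OF f, of "1 / real (Suc n)"] by simp
    qed
  qed
  ultimately show ?thesis unfolding F_def by (rule negligible_subset[rotated])
qed

section \<open>Linear equations with integrable coefficients\<close>

text \<open>
An integrable function is a bounded function plus a remainder of small integral, by dominated
convergence. This splitting replaces, in the contraction argument and in the proof of absolute
continuity below, the boundedness that a continuous coefficient would have.
\<close>

lemma absolutely_integrable_truncation:
  fixes f :: "real \<Rightarrow> real"
  assumes f: "f absolutely_integrable_on {a..b}" and e: "e > 0"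
  obtains N where "N \<ge> 0" "(\<lambda>x. max (\<bar>f x\<bar> - N) 0) absolutely_integrable_on {a..b}"
    "integral {a..b} (\<lambda>x. max (\<bar>f x\<bar> - N) 0) < e"
proof -
  have abs: "(\<lambda>x. \<bar>f x\<bar>) absolutely_integrable_on {a..b}"
    using absolutely_integrable_norm[OF f] by (simp add: o_def)
  have int: "(\<lambda>x. max (\<bar>f x\<bar> - real n) 0) absolutely_integrable_on {a..b}" for n :: nat
  proof (rule measurable_bounded_by_integrable_imp_absolutely_integrable)
    have "f \<in> borel_measurable (lebesgue_on {a..b})"
      using f by (intro absolutely_integrable_imp_borel_measurable) auto
    then show "(\<lambda>x. max (\<bar>f x\<bar> - real n) 0) \<in> borel_measurable (lebesgue_on {a..b})" "{a..b} \<in> sets lebesgue"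
      by simp_all
    show "(\<lambda>x. \<bar>f x\<bar>) integrable_on {a..b}" using abs set_lebesgue_integral_eq_integral by blast
  qed auto
  have "(\<lambda>n. integral {a..b} (\<lambda>x. max (\<bar>f x\<bar> - real n) 0)) \<longlonglongrightarrow> integral {a..b} (\<lambda>x. 0::real)"
  proof (rule dominated_convergence)
    show "(\<lambda>x. max (\<bar>f x\<bar> - real n) 0) integrable_on {a..b}" for n
      using int set_lebesgue_integral_eq_integral by blast
    show "(\<lambda>x. \<bar>f x\<bar>) integrable_on {a..b}" using abs set_lebesgue_integral_eq_integral by blast
    show "(\<lambda>n. max (\<bar>f x\<bar> - real n) 0) \<longlonglongrightarrow> 0" for x
    proof (rule tendsto_eventually)
      obtain n0 where "\<bar>f x\<bar> \<le> real n0" using real_arch_simple by blast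
      then show "\<forall>\<^sub>F n in sequentially. max (\<bar>f x\<bar> - real n) 0 = 0"
        by (intro eventually_sequentiallyI[of n0]) (auto simp: max_def)
    qed
  qed auto
  then have "\<forall>\<^sub>F n in sequentially. integral {a..b} (\<lambda>x. max (\<bar>f x\<bar> - real n) 0) < e"
    using e by (auto dest: order_tendstoD(2))
  then obtain n where "integral {a..b} (\<lambda>x. max (\<bar>f x\<bar> - real n) 0) < e"
    by (auto simp: eventually_sequentially)
  then show ?thesis using that[of "real n"] int by auto
qed

text \<open>
Banach's fixed point theorem in the space of bounded continuous functions, for operators on plain
functions: the integral operators below are then written without passing through the type of such functions.
\<close>

lemma bounded_continuous_fixed_point:
  fixes \<Psi> :: "(real \<Rightarrow> complex) \<Rightarrow> real \<Rightarrow> complex"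
  assumes self: "\<And>y. continuous_on UNIV y \<Longrightarrow> bounded (range y) \<Longrightarrow>
      continuous_on UNIV (\<Psi> y) \<and> bounded (range (\<Psi> y))"
    and contr: "\<And>y z D x. continuous_on UNIV y \<Longrightarrow> bounded (range y) \<Longrightarrow>
      continuous_on UNIV z \<Longrightarrow> bounded (range z) \<Longrightarrow> (\<And>t. norm (y t - z t) \<le> D) \<Longrightarrow>
      norm (\<Psi> y x - \<Psi> z x) \<le> D / 2"
  obtains y where "continuous_on UNIV y" "bounded (range y)" "\<Psi> y = y"
proof -
  define T where "T = (\<lambda>y. Bcontfun (\<Psi> (apply_bcontfun y)))"
  have T: "apply_bcontfun (T y) = \<Psi> (apply_bcontfun y)" for y
    unfolding T_def by (rule Bcontfun_inverse) (use self[of "apply_bcontfun y"] in \<open>auto simp: bcontfun_def\<close>)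
  have "dist (T y) (T z) \<le> 1/2 * dist y z" for y z
  proof (rule dist_bound)
    fix x
    have "norm (apply_bcontfun y t - apply_bcontfun z t) \<le> dist y z" for t
      using dist_bounded[of y t z] by (simp add: dist_norm)
    then show "dist (apply_bcontfun (T y) x) (apply_bcontfun (T z) x) \<le> 1/2 * dist y z"
      using contr[of y z "dist y z" x] by (simp add: T dist_norm)
  qed
  then obtain y where "T y = y"
    using banach_fix_type[of "1/2" T] by auto
  then show ?thesis
    using that[of "apply_bcontfun y"] T[of y] by simp
qed

lemma real_linear_absolutely_integrable:
  fixes p r w :: "real \<Rightarrow> complex"
  assumes "p absolutely_integrable_on {a..b}" "r absolutely_integrable_on {a..b}"
    and w: "continuous_on {a..b} w"
  shows "(\<lambda>t. p t * w t + r t * cnj (w t)) absolutely_integrable_on {a..b}"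
proof -
  have bd: "bounded (w ` {a..b})" using w compact_continuous_image compact_imp_bounded by blast
  have 1: "(\<lambda>t. w t * p t) absolutely_integrable_on {a..b}"
    by (rule absolutely_integrable_bounded_measurable_product[OF bilinear_times _ _ bd assms(1)])
       (auto intro!: continuous_imp_measurable_on_sets_lebesgue w)
  have bd2: "bounded ((\<lambda>t. cnj (w t)) ` {a..b})"
    using bd by (auto simp: bounded_iff)
  have 2: "(\<lambda>t. cnj (w t) * r t) absolutely_integrable_on {a..b}"
    by (rule absolutely_integrable_bounded_measurable_product[OF bilinear_times _ _ bd2 assms(2)])
       (auto intro!: continuous_imp_measurable_on_sets_lebesgue continuous_intros w)
  show ?thesis using set_integral_add(1)[OF 1 2] by (simp add: mult.commute)
qed

text \<open>
The equation \<open>w' = p w + r cnj w\<close> in integrated form, solved from the right end point. If the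
coefficients are bounded by \<open>N + g\<close> with \<open>\<integral> g < 1/4\<close>, the weight \<open>exp (\<kappa> (b - t))\<close> with
\<open>\<kappa> = 4 N + 1\<close> makes the bounded part contribute at most \<open>N / \<kappa> \<le> 1/4\<close> to the Lipschitz constant, so
that the integral operator is a contraction with factor \<open>1/2\<close> on the whole interval.
\<close>

lemma linear_terminal_value_problem:
  fixes p r :: "real \<Rightarrow> complex"
  assumes ab: "a \<le> b"
    and p: "p absolutely_integrable_on {a..b}" and r: "r absolutely_integrable_on {a..b}"
  obtains w where "continuous_on {a..b} w"
    "\<And>x. x \<in> {a..b} \<Longrightarrow> w x = w\<^sub>b - integral {x..b} (\<lambda>t. p t * w t + r t * cnj (w t))"
proof -
  define G where "G = (\<lambda>t. norm (p t) + norm (r t))"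
  have G: "G absolutely_integrable_on {a..b}"
    unfolding G_def using absolutely_integrable_norm[OF p] absolutely_integrable_norm[OF r]
    by (auto simp: o_def intro!: set_integral_add)
  have G0: "G t \<ge> 0" for t by (simp add: G_def)
  obtain N where N: "N \<ge> 0" "(\<lambda>x. max (\<bar>G x\<bar> - N) 0) absolutely_integrable_on {a..b}"
    "integral {a..b} (\<lambda>x. max (\<bar>G x\<bar> - N) 0) < 1/4"
    by (rule absolutely_integrable_truncation[OF G, of "1/4"]) (simp, blast)
  define g where "g = (\<lambda>x. max (\<bar>G x\<bar> - N) 0)"
  define \<kappa> where "\<kappa> = 4 * N + 1"
  have \<kappa>: "\<kappa> > 0" using N by (simp add: \<kappa>_def)
  define E where "E = (\<lambda>t::real. exp (\<kappa> * (b - t)))"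
  have E_pos: "E t > 0" for t by (simp add: E_def)
  have E_cont: "continuous_on S E" for S unfolding E_def by (intro continuous_intros)
  \<comment> \<open>The unknown is \<open>y = w / E\<close>; clamping the argument to \<open>{a..b}\<close> gives functions on the whole line.\<close>
  define R where "R = (\<lambda>(y::real \<Rightarrow> complex) t. p t * (E t * y t) + r t * cnj (E t * y t))"
  define I where "I = (\<lambda>y x. (w\<^sub>b - integral {x..b} (R y)) / E x)"
  define \<Psi> where "\<Psi> = (\<lambda>y x. I y (max a (min b x)))"
  have clamp: "max a (min b x) \<in> {a..b}" for x using ab by auto
  have R_int: "R y absolutely_integrable_on {a..b}" if "continuous_on UNIV y" for y
    unfolding R_def
    by (rule real_linear_absolutely_integrable[OF p r])
       (intro continuous_intros continuous_on_subset[OF that] E_cont; simp)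
  have R_int': "R y absolutely_integrable_on {x..b}" "R y integrable_on {x..b}"
    if "continuous_on UNIV y" "x \<in> {a..b}" for x y
    using set_integrable_subset[OF R_int[OF that(1)], of "{x..b}"] that(2)
       set_lebesgue_integral_eq_integral(1)[of "{x..b}" "R y"] by auto
  have I_cont: "continuous_on {a..b} (I y)" if "continuous_on UNIV y" for y
    unfolding I_def using R_int'(2)[OF that, of a] ab E_pos
    by (intro continuous_intros E_cont indefinite_integral_continuous_1')
       (auto simp: less_imp_neq[THEN not_sym])
  have self: "continuous_on UNIV (\<Psi> y) \<and> bounded (range (\<Psi> y))" if "continuous_on UNIV y" for y
  proof
    show "continuous_on UNIV (\<Psi> y)" unfolding \<Psi>_def
      by (rule continuous_on_compose2[OF I_cont[OF that]]) (intro continuous_intros, use clamp in blast)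
    have "range (\<Psi> y) \<subseteq> I y ` {a..b}" using clamp by (auto simp: \<Psi>_def)
    moreover have "bounded (I y ` {a..b})"
      using compact_continuous_image[OF I_cont[OF that]] compact_imp_bounded by blast
    ultimately show "bounded (range (\<Psi> y))" using bounded_subset by blast
  qed
  have contr: "norm (\<Psi> y x - \<Psi> z x) \<le> D / 2"
    if y: "continuous_on UNIV y" and z: "continuous_on UNIV z"
    and D: "\<And>t. norm (y t - z t) \<le> D" for y z D x
  proof -
    define c where "c = max a (min b x)"
    have c: "c \<in> {a..b}" using clamp by (simp add: c_def)
    have D0: "D \<ge> 0" using D[of 0] norm_ge_zero order_trans by blast
    have EI: "(E has_integral ((E c - 1) / \<kappa>)) {c..b}"
    proof -
      have "(E has_integral (- E b / \<kappa> - (- E c / \<kappa>))) {c..b}"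
        by (rule fundamental_theorem_of_calculus)
           (use c \<kappa> in \<open>auto simp: E_def has_real_derivative_iff_has_vector_derivative[symmetric]
              intro!: derivative_eq_intros\<close>)
      then show ?thesis by (simp add: E_def diff_divide_distrib)
    qed
    have g_abs: "g absolutely_integrable_on {c..b}"
      using set_integrable_subset[OF N(2), of "{c..b}"] c by (auto simp: g_def)
    then have g_int: "g integrable_on {c..b}"
      using set_lebesgue_integral_eq_integral(1) by blast
    have "integral {c..b} g \<le> integral {a..b} g"
      by (rule integral_subset_le)
         (use c g_int N(2) set_lebesgue_integral_eq_integral(1) in \<open>auto simp: g_def\<close>)
    then have g_small: "integral {c..b} g \<le> 1/4" using N(3) unfolding g_def by linarith
    have bound: "norm (R y t - R z t) \<le> D * (N * E t + E c * g t)" if t: "t \<in> {c..b}" for t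
    proof -
      have "R y t - R z t = p t * (E t * (y t - z t)) + r t * cnj (E t * (y t - z t))"
        by (simp add: R_def algebra_simps)
      also have "norm \<dots> \<le> norm (p t) * (E t * norm (y t - z t)) + norm (r t) * (E t * norm (y t - z t))"
        by (rule norm_triangle_le) (use E_pos[of t] in \<open>simp add: norm_mult flip: complex_cnj_diff\<close>)
      also have "\<dots> = G t * E t * norm (y t - z t)" by (simp add: G_def algebra_simps)
      also have "\<dots> \<le> (N + g t) * E t * D"
        using E_pos[of t] G0[of t] D0 N(1) by (intro mult_mono D) (auto simp: g_def)
      also have "\<dots> = D * (N * E t + g t * E t)" by (simp add: algebra_simps)
      also have "\<dots> \<le> D * (N * E t + E c * g t)"
        unfolding mult.commute[of "E c"] using t \<kappa>
        by (intro mult_left_mono add_left_mono D0) (auto simp: E_def g_def)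
      finally show ?thesis .
    qed
    have "norm (integral {c..b} (\<lambda>t. R y t - R z t)) \<le> integral {c..b} (\<lambda>t. D * (N * E t + E c * g t))"
      by (rule integral_norm_bound_integral)
         (use R_int'(2)[OF y c] R_int'(2)[OF z c] g_int has_integral_integrable[OF EI] bound in
          \<open>auto intro!: integrable_diff integrable_on_mult_right integrable_add\<close>)
    also have "\<dots> = D * (N * ((E c - 1) / \<kappa>) + E c * integral {c..b} g)"
      using g_int EI has_integral_integrable[OF EI]
      by (simp add: integral_add integrable_on_mult_right integral_unique)
    also have "\<dots> \<le> D * (E c / 4 + E c * (1/4))"
    proof (intro mult_left_mono add_mono D0)
      have "N * (E c - 1) \<le> N * E c" using N by (simp add: algebra_simps)
      also have "\<dots> \<le> E c * \<kappa> / 4" using E_pos[of c] by (simp add: \<kappa>_def algebra_simps)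
      finally show "N * ((E c - 1) / \<kappa>) \<le> E c / 4" using \<kappa> by (simp add: field_simps)
    qed (use g_small E_pos[of c] in auto)
    finally have est: "norm (integral {c..b} (\<lambda>t. R y t - R z t)) \<le> D * E c / 2" by simp
    have "\<Psi> y x - \<Psi> z x = - integral {c..b} (\<lambda>t. R y t - R z t) / E c"
      using R_int'(2)[OF y c] R_int'(2)[OF z c]
      by (simp add: \<Psi>_def I_def c_def[symmetric] integral_diff diff_divide_distrib)
    then have "norm (\<Psi> y x - \<Psi> z x) = norm (integral {c..b} (\<lambda>t. R y t - R z t)) / E c"
      using E_pos[of c] by (simp add: norm_divide)
    also have "\<dots> \<le> (D * E c / 2) / E c" by (rule divide_right_mono[OF est]) (use E_pos[of c] in simp)
    also have "\<dots> = D / 2" using E_pos[of c] by simp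
    finally show ?thesis .
  qed
  obtain y where y: "continuous_on UNIV y" "\<Psi> y = y"
    by (rule bounded_continuous_fixed_point[of \<Psi>, OF self contr])
  define w where "w = (\<lambda>t. E t * y t)"
  have "continuous_on {a..b} w"
    unfolding w_def by (intro continuous_intros E_cont continuous_on_subset[OF y(1)]) auto
  moreover have "w x = w\<^sub>b - integral {x..b} (\<lambda>t. p t * w t + r t * cnj (w t))" if "x \<in> {a..b}" for x
  proof -
    have "y x = I y x" using fun_cong[OF y(2), of x] that by (simp add: \<Psi>_def)
    then show ?thesis using E_pos[of x] by (simp add: w_def I_def R_def)
  qed
  ultimately show ?thesis using that by blast
qed

section \<open>Asymptotic integration near infinity\<close>

lemma tail_integral_has_derivative:
  fixes H :: "real \<Rightarrow> real"
  assumes H: "continuous_on {Y..} H" "\<And>s. s \<ge> Y \<Longrightarrow> H integrable_on {s..}" and s: "s \<ge> Y"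
  shows "((\<lambda>s. integral {s..} H) has_real_derivative - H s) (at s within {Y..})"
proof -
  have eq: "integral {t..} H = integral {Y..} H - integral {Y..t} H" if "t \<ge> Y" for t
  proof -
    have "H integrable_on {Y..t}"
      by (rule integrable_continuous_interval) (auto intro: continuous_on_subset[OF H(1)])
    moreover have "negligible ({Y..t} \<inter> {t..})"
      by (rule negligible_subset[of "{t}"]) auto
    ultimately have "integral ({Y..t} \<union> {t..}) H = integral {Y..t} H + integral {t..} H"
      using H(2)[OF that] by (intro integral_Un)
    moreover have "{Y..t} \<union> {t..} = {Y..}" using that by auto
    ultimately show ?thesis by simp
  qed
  have "((\<lambda>t. integral {Y..t} H) has_real_derivative H s) (at s within {Y..s+1})"
    using H(1) s by (intro integral_has_real_derivative) (auto elim: continuous_on_subset)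
  moreover have "at s within {Y..s+1} = at s within {Y..}"
    by (rule at_within_nhd[of s "{..<s+1}"]) auto
  ultimately have "((\<lambda>t. integral {Y..} H - integral {Y..t} H) has_real_derivative - H s) (at s within {Y..})"
    by (auto intro!: derivative_eq_intros)
  then show ?thesis
  proof (rule has_field_derivative_transform_within[OF _ zero_less_one])
    show "s \<in> {Y..}" using s by simp
    show "integral {Y..} H - integral {Y..t} H = integral {t..} H" if "t \<in> {Y..}" for t
      using eq[of t] that by simp
  qed
qed

text \<open>
The case of Levinson's theorem for \<open>d' = c \<rho> cnj d\<close> plus an integrable perturbation. A constant phase
\<open>e\<close> with \<open>c (cnj e)\<^sup>2 = - |c|\<close> diagonalises the principal part, and \<open>d = e f y\<close> gives
\<open>y' = 2 |c| \<rho> \<i> Im y + h y\<close> with a linear perturbation \<open>h\<close> dominated by \<open>g\<close>. Since \<open>f\<^sup>2\<close> is an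
integrating factor for \<open>Im y\<close>, a solution with \<open>y \<rightarrow> 1\<close> is a fixed point of
\<open>y \<mapsto> 1 - \<integral>\<^sub>s\<^sup>\<infinity> Re (h y) - \<i> \<integral>\<^sub>s\<^sup>\<infinity> (f t / f s)\<^sup>2 Im (h y)\<close>.
Both parts are integrated from infinity, and \<open>(f t / f s)\<^sup>2 \<le> 1\<close> as \<open>f\<close> decreases; hence the operator
is a contraction as soon as the tail \<open>\<Gamma>\<close> of \<open>\<integral> g\<close> is below \<open>1/4\<close>.
\<close>

lemma levinson_decaying_solution:
  fixes S\<^sub>1 S\<^sub>2 :: "real \<Rightarrow> complex" and f \<rho> g \<Gamma> :: "real \<Rightarrow> real" and c :: complex
  assumes f: "\<And>x. x \<ge> X \<Longrightarrow> f x > 0"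
    and f': "\<And>x. x \<ge> X \<Longrightarrow> (f has_real_derivative - norm c * \<rho> x * f x) (at x)"
    and \<rho>: "\<And>x. x \<ge> X \<Longrightarrow> \<rho> x \<ge> 0"
    and S: "continuous_on {X..} S\<^sub>1" "continuous_on {X..} S\<^sub>2"
    and g: "\<And>x. x \<ge> X \<Longrightarrow> norm (S\<^sub>1 x) + norm (S\<^sub>2 x) \<le> g x"
    and \<Gamma>: "\<And>x. x \<ge> X \<Longrightarrow> (g has_integral \<Gamma> x) {x..}" "(\<Gamma> \<longlongrightarrow> 0) at_top"
  obtains Y d \<phi> where "Y \<ge> X"
    "\<And>x. x > Y \<Longrightarrow> (d has_vector_derivative
        c * \<rho> x * cnj (d x) + S\<^sub>1 x * d x + S\<^sub>2 x * cnj (d x)) (at x)"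
    "((\<lambda>x. d x / (f x * cis \<phi>)) \<longlongrightarrow> 1) at_top"
proof -
  define \<phi> where "\<phi> = (Arg c + pi) / 2"
  define e where "e = cis \<phi>"
  have e_unit: "e * cnj e = 1" by (simp add: e_def cis_cnj cis_mult)
  have "cnj e * cnj e = cis (- (Arg c + pi))"
    unfolding e_def cis_cnj cis_mult \<phi>_def by (rule arg_cong[where f = cis]) (simp add: field_simps)
  moreover have "c = norm c * cis (Arg c)"
    by (metis rcis_cmod_Arg rcis_def)
  ultimately have "c * (cnj e * cnj e) = norm c * (cis (Arg c) * cis (- (Arg c + pi)))"
    by (metis mult.assoc)
  also have "cis (Arg c) * cis (- (Arg c + pi)) = -1"
    by (simp only: cis_mult) (simp add: complex_eq_iff)
  finally have c_e: "c * (cnj e * cnj e) = - norm c" by simp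
  define h where "h = (\<lambda>(y::real \<Rightarrow> complex) t. S\<^sub>1 t * y t + S\<^sub>2 t * (cnj e * cnj e) * cnj (y t))"
  have g0: "g x \<ge> 0" if "x \<ge> X" for x using g[OF that] norm_ge_zero[of "S\<^sub>1 x"] norm_ge_zero[of "S\<^sub>2 x"] by linarith
  have h_bound: "norm (h y t) \<le> D * g t" if "t \<ge> X" "norm (y t) \<le> D" for y t D
  proof -
    have e1: "norm e = 1" by (simp add: e_def)
    have "norm (h y t) \<le> norm (S\<^sub>1 t) * norm (y t) + norm (S\<^sub>2 t) * norm (y t)"
      unfolding h_def by (rule norm_triangle_le) (simp add: norm_mult e1)
    also have "\<dots> = norm (y t) * (norm (S\<^sub>1 t) + norm (S\<^sub>2 t))" by (simp add: algebra_simps)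
    also have "\<dots> \<le> D * g t" using that g[OF that(1)] by (intro mult_mono) (auto intro: order_trans[OF norm_ge_zero])
    finally show ?thesis .
  qed
  have h_cont: "continuous_on {X..} (h y)" if "continuous_on UNIV y" for y
    unfolding h_def by (intro continuous_intros S continuous_on_subset[OF that]) auto
  have f_mono: "f t \<le> f s" if "X \<le> s" "s \<le> t" for s t
  proof (rule DERIV_nonpos_imp_nonincreasing[OF that(2)])
    fix x assume "s \<le> x" "x \<le> t"
    then show "\<exists>y. DERIV f x :> y \<and> y \<le> 0"
      using f'[of x] f[of x] \<rho>[of x] that by (intro exI[of _ "- norm c * \<rho> x * f x"]) auto
  qed
  have f_cont: "continuous_on {X..} f"
    by (meson f' DERIV_isCont atLeast_iff continuous_at_imp_continuous_on)
  obtain Y where Y: "Y \<ge> X" "\<And>x. x \<ge> Y \<Longrightarrow> \<Gamma> x < 1/4"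
  proof -
    have "\<forall>\<^sub>F x in at_top. \<Gamma> x < 1/4" by (rule order_tendstoD(2)[OF \<Gamma>(2)]) simp
    then obtain Z where "\<And>x. x \<ge> Z \<Longrightarrow> \<Gamma> x < 1/4" by (auto simp: eventually_at_top_linorder)
    then show ?thesis using that[of "max X Z"] by auto
  qed
  have dominated: "H integrable_on {s..} \<and> \<bar>integral {s..} H\<bar> \<le> B * \<Gamma> s"
    if s: "s \<ge> X" and H: "continuous_on {s..} H" and b: "\<And>t. t \<ge> s \<Longrightarrow> \<bar>H t\<bar> \<le> B * g t"
    for H :: "real \<Rightarrow> real" and B s
  proof
    have gi: "(\<lambda>t. B * g t) integrable_on {s..}"
      using \<Gamma>(1)[OF s] by (auto intro: integrable_on_mult_right)
    show Hi: "H integrable_on {s..}"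
      using gi by (rule measurable_bounded_by_integrable_imp_integrable[rotated 1])
        (use H b in \<open>auto intro!: continuous_imp_measurable_on_sets_lebesgue\<close>)
    have "norm (integral {s..} H) \<le> integral {s..} (\<lambda>t. B * g t)"
      by (rule integral_norm_bound_integral[OF Hi gi]) (use b in auto)
    then show "\<bar>integral {s..} H\<bar> \<le> B * \<Gamma> s" using \<Gamma>(1)[OF s] by (simp add: integral_unique)
  qed
  define J\<^sub>1 where "J\<^sub>1 = (\<lambda>y s. integral {s..} (\<lambda>t. Re (h y t)))"
  define J\<^sub>2 where "J\<^sub>2 = (\<lambda>y s. integral {s..} (\<lambda>t. (f t)\<^sup>2 * Im (h y t)))"
  define I where "I = (\<lambda>y s. 1 - Complex (J\<^sub>1 y s) (J\<^sub>2 y s / (f s)\<^sup>2))"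
  define \<Psi> where "\<Psi> = (\<lambda>y x. I y (max Y x))"
  have J\<^sub>1: "(\<lambda>t. Re (h y t)) integrable_on {s..} \<and> \<bar>J\<^sub>1 y s\<bar> \<le> D * \<Gamma> s"
    if "continuous_on UNIV y" "\<And>t. norm (y t) \<le> D" "s \<ge> X" for y D s
    unfolding J\<^sub>1_def using that(3)
    by (intro dominated order_trans[OF abs_Re_le_cmod h_bound] continuous_intros
         continuous_on_subset[OF h_cont[OF that(1)]] that(2)) auto
  have J\<^sub>2: "(\<lambda>t. (f t)\<^sup>2 * Im (h y t)) integrable_on {s..} \<and> \<bar>J\<^sub>2 y s / (f s)\<^sup>2\<bar> \<le> D * \<Gamma> s"
    if "continuous_on UNIV y" "\<And>t. norm (y t) \<le> D" "s \<ge> X" for y D s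
  proof -
    have *: "\<bar>(f t)\<^sup>2 * Im (h y t)\<bar> \<le> (f s)\<^sup>2 * D * g t" if t: "t \<ge> s" for t
    proof -
      have "\<bar>(f t)\<^sup>2 * Im (h y t)\<bar> = (f t)\<^sup>2 * \<bar>Im (h y t)\<bar>" by (simp add: abs_mult)
      also have "\<dots> \<le> (f s)\<^sup>2 * (D * g t)"
        using f[of t] f_mono[of s t] t \<open>s \<ge> X\<close>
        by (intro mult_mono power_mono order_trans[OF abs_Im_le_cmod h_bound] \<open>\<And>t. norm (y t) \<le> D\<close>) auto
      finally show ?thesis by simp
    qed
    have "(\<lambda>t. (f t)\<^sup>2 * Im (h y t)) integrable_on {s..} \<and> \<bar>J\<^sub>2 y s\<bar> \<le> (f s)\<^sup>2 * D * \<Gamma> s"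
      unfolding J\<^sub>2_def using that(3)
      by (intro dominated * continuous_intros continuous_on_subset[OF h_cont[OF that(1)]]
          continuous_on_subset[OF f_cont]) auto
    then show ?thesis using f[OF that(3)] by (simp add: abs_div divide_le_eq mult.commute mult.left_commute)
  qed
  have J\<^sub>1': "(J\<^sub>1 y has_real_derivative - Re (h y s)) (at s within {Y..})"
    if "continuous_on UNIV y" "bounded (range y)" "s \<ge> Y" for y s
  proof -
    obtain D where D: "\<And>t. norm (y t) \<le> D" using \<open>bounded (range y)\<close> by (auto simp: bounded_iff)
    show ?thesis unfolding J\<^sub>1_def
      by (rule tail_integral_has_derivative)
         (use J\<^sub>1[OF that(1) D] Y that in \<open>auto intro!: continuous_intros continuous_on_subset[OF h_cont]\<close>)
  qed
  have J\<^sub>2': "(J\<^sub>2 y has_real_derivative - ((f s)\<^sup>2 * Im (h y s))) (at s within {Y..})"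
    if "continuous_on UNIV y" "bounded (range y)" "s \<ge> Y" for y s
  proof -
    obtain D where D: "\<And>t. norm (y t) \<le> D" using \<open>bounded (range y)\<close> by (auto simp: bounded_iff)
    show ?thesis unfolding J\<^sub>2_def
      by (rule tail_integral_has_derivative)
         (use J\<^sub>2[OF that(1) D] Y that in \<open>auto intro!: continuous_intros continuous_on_subset[OF h_cont]
            continuous_on_subset[OF f_cont]\<close>)
  qed
  have I_bound: "norm (I y s - 1) \<le> 2 * D * \<Gamma> s"
    if "continuous_on UNIV y" "\<And>t. norm (y t) \<le> D" "s \<ge> X" for y D s
  proof -
    have "norm (I y s - 1) \<le> \<bar>J\<^sub>1 y s\<bar> + \<bar>J\<^sub>2 y s / (f s)\<^sup>2\<bar>"
      using cmod_le[of "Complex (J\<^sub>1 y s) (J\<^sub>2 y s / (f s)\<^sup>2)"] by (simp add: I_def)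
    also have "\<dots> \<le> D * \<Gamma> s + D * \<Gamma> s"
      using J\<^sub>1[OF that] J\<^sub>2[OF that] by (intro add_mono) auto
    finally show ?thesis by simp
  qed
  have I_diff: "I y s - I z s = I (\<lambda>t. y t - z t) s - 1"
    if "continuous_on UNIV y" "bounded (range y)" "continuous_on UNIV z" "bounded (range z)" "s \<ge> X" for y z s
  proof -
    obtain B C where B: "\<And>t. norm (y t) \<le> B" and C: "\<And>t. norm (z t) \<le> C"
      using \<open>bounded (range y)\<close> \<open>bounded (range z)\<close> by (auto simp: bounded_iff)
    have h: "h (\<lambda>t. y t - z t) t = h y t - h z t" for t
      by (simp add: h_def algebra_simps)
    show ?thesis
      using J\<^sub>1[OF that(1) B that(5)] J\<^sub>1[OF that(3) C that(5)] J\<^sub>2[OF that(1) B that(5)] J\<^sub>2[OF that(3) C that(5)]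
      by (simp add: I_def J\<^sub>1_def J\<^sub>2_def h integral_diff right_diff_distrib complex_eq_iff diff_divide_distrib)
  qed
  have self: "continuous_on UNIV (\<Psi> y) \<and> bounded (range (\<Psi> y))"
    if y: "continuous_on UNIV y" "bounded (range y)" for y
  proof
    have "continuous_on {Y..} (J\<^sub>1 y)" "continuous_on {Y..} (J\<^sub>2 y)"
      using J\<^sub>1'[OF y] J\<^sub>2'[OF y] by (auto simp: continuous_on_eq_continuous_within intro: DERIV_continuous)
    moreover have "\<forall>x\<in>{Y..}. (f x)\<^sup>2 \<noteq> 0"
    proof
      fix x assume "x \<in> {Y..}"
      then show "(f x)\<^sup>2 \<noteq> 0" using f[of x] Y(1) by simp
    qed
    moreover have "continuous_on {Y..} f" by (rule continuous_on_subset[OF f_cont]) (use Y(1) in simp)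
    ultimately have "continuous_on {Y..} (I y)"
      unfolding I_def Complex_eq by (intro continuous_intros)
    then show "continuous_on UNIV (\<Psi> y)" unfolding \<Psi>_def
      by (rule continuous_on_compose2) (auto intro!: continuous_intros)
    obtain D where D: "\<And>t. norm (y t) \<le> D" using y(2) by (auto simp: bounded_iff)
    then have D0: "D \<ge> 0" using norm_ge_zero order_trans by blast
    have "norm (\<Psi> y x) \<le> 1 + 2 * D" for x
    proof -
      have "norm (\<Psi> y x) \<le> norm (I y (max Y x) - 1) + 1"
        unfolding \<Psi>_def by (metis norm_one norm_triangle_sub add.commute)
      also have "\<dots> \<le> 2 * D * \<Gamma> (max Y x) + 1"
        using I_bound[OF y(1) D, of "max Y x"] Y by auto
      also have "\<dots> \<le> 2 * D * 1 + 1" using Y(2)[of "max Y x"] D0 by (intro add_mono mult_left_mono) auto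
      finally show ?thesis by simp
    qed
    then show "bounded (range (\<Psi> y))" by (auto simp: bounded_iff)
  qed
  have contr: "norm (\<Psi> y x - \<Psi> z x) \<le> D / 2"
    if y: "continuous_on UNIV y" "bounded (range y)" and z: "continuous_on UNIV z" "bounded (range z)"
    and D: "\<And>t. norm (y t - z t) \<le> D" for y z D x
  proof -
    have D0: "D \<ge> 0" using D[of 0] norm_ge_zero order_trans by blast
    have m: "max Y x \<ge> X" using Y(1) by simp
    have "continuous_on UNIV (\<lambda>t. y t - z t)" using y(1) z(1) by (intro continuous_intros)
    then have "norm (\<Psi> y x - \<Psi> z x) \<le> 2 * D * \<Gamma> (max Y x)"
      unfolding \<Psi>_def I_diff[OF y z m] by (rule I_bound[OF _ D m])
    also have "\<dots> \<le> 2 * D * (1/4)" using Y(2)[of "max Y x"] D0 by (intro mult_left_mono) auto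
    finally show ?thesis by simp
  qed
  obtain y where y: "continuous_on UNIV y" "bounded (range y)" "\<Psi> y = y"
    by (rule bounded_continuous_fixed_point[of \<Psi>, OF self contr])
  obtain D where D: "\<And>t. norm (y t) \<le> D" using y(2) by (auto simp: bounded_iff)
  have y_eq: "y x = I y x" if "x \<ge> Y" for x
    using fun_cong[OF y(3), of x] that by (simp add: \<Psi>_def max_def split: if_splits)
  define d where "d = (\<lambda>x. e * f x * y x)"
  have deriv: "(d has_vector_derivative c * \<rho> x * cnj (d x) + S\<^sub>1 x * d x + S\<^sub>2 x * cnj (d x)) (at x)"
    if x: "x > Y" for x
  proof -
    have at: "at x within {Y..} = at x" using x by (intro at_within_interior) auto
    have fx: "f x > 0" "(f has_real_derivative - norm c * \<rho> x * f x) (at x)" using f f' x Y by auto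
    have R: "((\<lambda>s. 1 - J\<^sub>1 y s) has_real_derivative Re (h y x)) (at x)"
      using J\<^sub>1'[OF y(1,2), of x] x unfolding at by (auto intro!: derivative_eq_intros)
    have "((\<lambda>s. - (J\<^sub>2 y s / (f s)\<^sup>2)) has_real_derivative
         - ((- ((f x)\<^sup>2 * Im (h y x)) * (f x)\<^sup>2 - J\<^sub>2 y x * (2 * f x * (- norm c * \<rho> x * f x))) / ((f x)\<^sup>2 * (f x)\<^sup>2))) (at x)"
      using J\<^sub>2'[OF y(1,2), of x] x fx unfolding at by (auto intro!: derivative_eq_intros)
    also have "- ((- ((f x)\<^sup>2 * Im (h y x)) * (f x)\<^sup>2 - J\<^sub>2 y x * (2 * f x * (- norm c * \<rho> x * f x))) / ((f x)\<^sup>2 * (f x)\<^sup>2))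
        = Im (h y x) - 2 * norm c * \<rho> x * (J\<^sub>2 y x / (f x)\<^sup>2)"
      using fx by (simp add: field_simps power2_eq_square)
    also have "\<dots> = Im (h y x) + 2 * norm c * \<rho> x * Im (y x)"
      using y_eq[of x] x by (simp add: I_def)
    finally have Im': "((\<lambda>s. - (J\<^sub>2 y s / (f s)\<^sup>2)) has_real_derivative
        Im (h y x) + 2 * norm c * \<rho> x * Im (y x)) (at x)" .
    have "((\<lambda>s. Complex (1 - J\<^sub>1 y s) (- (J\<^sub>2 y s / (f s)\<^sup>2))) has_vector_derivative
        Complex (Re (h y x)) (Im (h y x) + 2 * norm c * \<rho> x * Im (y x))) (at x)"
      unfolding Complex_eq
      by (intro has_vector_derivative_add has_vector_derivative_of_real has_vector_derivative_mult_right R Im')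
    then have "(y has_vector_derivative
        Complex (Re (h y x)) (Im (h y x) + 2 * norm c * \<rho> x * Im (y x))) (at x)"
    proof (rule has_vector_derivative_transform_within_open)
      show "open {Y<..}" "x \<in> {Y<..}" using x by auto
      fix s assume "s \<in> {Y<..}"
      then show "Complex (1 - J\<^sub>1 y s) (- (J\<^sub>2 y s / (f s)\<^sup>2)) = y s"
        using y_eq[of s] by (simp add: I_def complex_eq_iff)
    qed
    then have y': "(y has_vector_derivative h y x + 2 * norm c * \<rho> x * (\<i> * Im (y x))) (at x)"
      by (rule back_subst) (simp add: complex_eq_iff)
    have ef: "((\<lambda>x. e * f x) has_vector_derivative e * (- norm c * \<rho> x * f x)) (at x)"
      using has_vector_derivative_mult_right[OF has_vector_derivative_of_real[OF fx(2)]]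
      by (metis of_real_minus of_real_mult)
    have "(d has_vector_derivative
       e * f x * (h y x + 2 * norm c * \<rho> x * (\<i> * Im (y x))) + e * (- norm c * \<rho> x * f x) * y x) (at x)"
      unfolding d_def
      by (rule has_vector_derivative_mult[OF ef y'])
    also have "e * f x * (h y x + 2 * norm c * \<rho> x * (\<i> * Im (y x))) + e * (- norm c * \<rho> x * f x) * y x
       = e * f x * h y x - e * norm c * \<rho> x * f x * (y x - 2 * (\<i> * Im (y x)))"
      by (simp add: algebra_simps)
    also have "y x - 2 * (\<i> * Im (y x)) = cnj (y x)" by (simp add: complex_eq_iff)
    also have "e * f x * h y x - e * norm c * \<rho> x * f x * cnj (y x)
       = e * f x * h y x + e * (c * (cnj e * cnj e)) * \<rho> x * f x * cnj (y x)"
      unfolding c_e by simp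
    also have "\<dots> = (e * cnj e) * (c * \<rho> x * cnj (e * f x * y x)) + S\<^sub>1 x * (e * f x * y x)
        + (e * cnj e) * (S\<^sub>2 x * cnj (e * f x * y x))"
      by (simp add: h_def algebra_simps)
    finally show ?thesis unfolding e_unit by (simp add: d_def)
  qed
  have "((\<lambda>x. 2 * D * \<Gamma> x) \<longlongrightarrow> 0) at_top"
    using tendsto_mult_right_zero[OF \<Gamma>(2)] by blast
  moreover have "\<forall>\<^sub>F x in at_top. norm (y x - 1) \<le> 2 * D * \<Gamma> x"
    using eventually_ge_at_top[of Y]
  proof eventually_elim
    case (elim x)
    then show ?case using I_bound[OF y(1) D, of x] y_eq[of x] Y(1) by simp
  qed
  ultimately have "((\<lambda>x. y x - 1) \<longlongrightarrow> 0) at_top"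
    by (rule Lim_null_comparison[rotated])
  then have "(y \<longlongrightarrow> 1) at_top" by (simp add: Lim_null[symmetric])
  moreover have "\<forall>\<^sub>F x in at_top. y x = d x / (f x * cis \<phi>)"
    using eventually_ge_at_top[of X]
  proof eventually_elim
    case (elim x)
    have "cis \<phi> \<noteq> 0" "complex_of_real (f x) \<noteq> 0" using f[OF elim] by auto
    then show ?case by (simp add: d_def e_def)
  qed
  ultimately have "((\<lambda>x. d x / (f x * cis \<phi>)) \<longlongrightarrow> 1) at_top"
    by (rule Lim_transform_eventually)
  with Y(1) deriv show ?thesis using that by blast
qed

text \<open>
The transformation \<open>d = m a + n cnj a\<close> with \<open>m = 1 - Q - M\<close>, \<open>n = - B - N\<close> is chosen such that the
terms of order \<open>x\<^bsup>-\<gamma>\<^esup>\<close> in \<open>d'\<close> cancel (by \<open>Q\<close> and \<open>B\<close>) and those of order \<open>x\<^bsup>-2\<gamma>\<^esup>\<close> reduce to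
\<open>c x\<^bsup>-2\<gamma>\<^esup> cnj a\<close> (by \<open>M\<close> and \<open>N\<close>). The functions \<open>r\<^sub>i\<close> are the errors of the four antiderivatives. For
large \<open>x\<close> the transformation is close to the identity and can be inverted, which gives the equation for
\<open>d\<close> treated by Levinson's theorem and carries its solution back to \<open>a\<close>.
\<close>

lemma averaged_decaying_solution:
  fixes q b Q B M N r\<^sub>1 r\<^sub>2 r\<^sub>3 r\<^sub>4 :: "real \<Rightarrow> complex" and f :: "real \<Rightarrow> real" and c :: complex
  assumes X: "X \<ge> 1" and \<gamma>: "1/3 < \<gamma>" and K: "K \<ge> 0"
    and f: "\<And>x. x \<ge> X \<Longrightarrow> f x > 0"
      "\<And>x. x \<ge> X \<Longrightarrow> (f has_real_derivative - norm c * x powr (- 2 * \<gamma>) * f x) (at x)"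
    and cont: "continuous_on {X..} q" "continuous_on {X..} b" "continuous_on {X..} r\<^sub>1"
      "continuous_on {X..} r\<^sub>2" "continuous_on {X..} r\<^sub>3" "continuous_on {X..} r\<^sub>4"
    and Q: "\<And>x. x \<ge> X \<Longrightarrow> (Q has_vector_derivative q x + r\<^sub>1 x) (at x)"
    and B: "\<And>x. x \<ge> X \<Longrightarrow> (B has_vector_derivative b x + r\<^sub>2 x) (at x)"
    and M: "\<And>x. x \<ge> X \<Longrightarrow> (M has_vector_derivative - (Q x * q x + B x * cnj (b x)) + r\<^sub>3 x) (at x)"
    and N: "\<And>x. x \<ge> X \<Longrightarrow> (N has_vector_derivative
               - (Q x * b x + B x * cnj (q x)) - c * complex_of_real (x powr (- 2 * \<gamma>)) + r\<^sub>4 x) (at x)"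
    and first: "\<And>x. x \<ge> X \<Longrightarrow> norm (q x) \<le> K * x powr - \<gamma> \<and> norm (b x) \<le> K * x powr - \<gamma> \<and>
               norm (Q x) \<le> K * x powr - \<gamma> \<and> norm (B x) \<le> K * x powr - \<gamma>"
    and second: "\<And>x. x \<ge> X \<Longrightarrow> norm (M x) \<le> K * x powr (- 2 * \<gamma>) \<and> norm (N x) \<le> K * x powr (- 2 * \<gamma>)"
    and third: "\<And>x. x \<ge> X \<Longrightarrow> norm (r\<^sub>1 x) \<le> K * x powr (- 3 * \<gamma>) \<and> norm (r\<^sub>2 x) \<le> K * x powr (- 3 * \<gamma>) \<and>
               norm (r\<^sub>3 x) \<le> K * x powr (- 3 * \<gamma>) \<and> norm (r\<^sub>4 x) \<le> K * x powr (- 3 * \<gamma>)"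
  obtains Y a \<phi> where "Y \<ge> X"
    "\<And>x. x > Y \<Longrightarrow> (a has_vector_derivative q x * a x + b x * cnj (a x)) (at x)"
    "((\<lambda>x. a x / (f x * cis \<phi>)) \<longlongrightarrow> 1) at_top"
proof -
  define m where "m = (\<lambda>x. 1 - Q x - M x)"
  define n where "n = (\<lambda>x. - B x - N x)"
  \<comment> \<open>The inverse transformation is \<open>a = u d + v cnj d\<close>.\<close>
  define \<Delta> where "\<Delta> = (\<lambda>x. m x * cnj (m x) - n x * cnj (n x))"
  define u where "u = (\<lambda>x. cnj (m x) / \<Delta> x)"
  define v where "v = (\<lambda>x. - n x / \<Delta> x)"
  define R\<^sub>1 where "R\<^sub>1 = (\<lambda>x. - r\<^sub>1 x - r\<^sub>3 x - M x * q x - N x * cnj (b x))"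
  define R\<^sub>2 where "R\<^sub>2 = (\<lambda>x. - r\<^sub>2 x - r\<^sub>4 x - M x * b x - N x * cnj (q x))"
  define w where "w = (\<lambda>x. c * complex_of_real (x powr (- 2 * \<gamma>)))"
  \<comment> \<open>One finds \<open>d' = R\<^sub>1 a + (w + R\<^sub>2) cnj a\<close>. Substituting the inverse and splitting off \<open>w cnj d\<close> leaves
    the coefficients \<open>S\<^sub>1\<close>, \<open>S\<^sub>2\<close>, which are of third order because \<open>u - 1\<close> and \<open>v\<close> are of first order.\<close>
  define S\<^sub>1 where "S\<^sub>1 = (\<lambda>x. R\<^sub>1 x * u x + (R\<^sub>2 x + w x) * cnj (v x))"
  define S\<^sub>2 where "S\<^sub>2 = (\<lambda>x. R\<^sub>1 x * v x + R\<^sub>2 x * cnj (u x) + w x * (cnj (u x) - 1))"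

  have decay: "((\<lambda>x::real. C * x powr - \<gamma>) \<longlongrightarrow> 0) at_top" for C
    using \<gamma> tendsto_mult_right_zero[OF tendsto_neg_powr[of "- \<gamma>" "\<lambda>x. x" at_top]] filterlim_ident by auto
  obtain X\<^sub>1 where X\<^sub>1: "X\<^sub>1 \<ge> X" "\<And>x. x \<ge> X\<^sub>1 \<Longrightarrow> 4 * K * x powr - \<gamma> < 1/2"
  proof -
    have "\<forall>\<^sub>F x in at_top. 4 * K * x powr - \<gamma> < 1/2" by (rule order_tendstoD(2)[OF decay]) simp
    then obtain Z where "\<And>x. x \<ge> Z \<Longrightarrow> 4 * K * x powr - \<gamma> < 1/2" by (auto simp: eventually_at_top_linorder)
    then show ?thesis using that[of "max X Z"] by auto
  qed
  define \<rho> where "\<rho> = (\<lambda>x::real. x powr - \<gamma>)"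
  have powers: "x powr - \<gamma> = \<rho> x" "x powr (- 2 * \<gamma>) = \<rho> x * \<rho> x" "x powr (- 3 * \<gamma>) = \<rho> x * \<rho> x * \<rho> x" for x
    by (simp_all add: \<rho>_def flip: powr_add)
  have \<rho>: "0 \<le> \<rho> x" "\<rho> x \<le> 1" "K * \<rho> x \<le> 1/8" if "x \<ge> X\<^sub>1" for x
    using X\<^sub>1(1) that X \<gamma> powr_mono[of "-\<gamma>" 0 x] X\<^sub>1(2)[OF that] by (auto simp: \<rho>_def)
  have w_norm: "norm (w x) = norm c * (\<rho> x * \<rho> x)" for x
    unfolding w_def powers norm_mult norm_of_real by (simp add: \<rho>_def)

  have size: "norm (m x - 1) \<le> 2 * K * \<rho> x" "norm (n x) \<le> 2 * K * \<rho> x" if x: "x \<ge> X\<^sub>1" for x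
  proof -
    have le: "K * (\<rho> x * \<rho> x) \<le> K * \<rho> x"
      using \<rho>[OF x] K by (intro mult_left_mono) (auto simp: mult_left_le)
    have "x \<ge> X" using x X\<^sub>1 by simp
    note b = first[OF this, unfolded powers] second[OF this, unfolded powers]
    have "norm (m x - 1) \<le> norm (Q x) + norm (M x)"
      using norm_triangle_ineq4[of "- Q x" "M x"] by (simp add: m_def)
    also have "\<dots> \<le> K * \<rho> x + K * \<rho> x" using b le by linarith
    finally show "norm (m x - 1) \<le> 2 * K * \<rho> x" by simp
    have "norm (n x) \<le> norm (B x) + norm (N x)"
      using norm_triangle_ineq4[of "- B x" "N x"] by (simp add: n_def)
    also have "\<dots> \<le> K * \<rho> x + K * \<rho> x" using b le by linarith
    finally show "norm (n x) \<le> 2 * K * \<rho> x" by simp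
  qed
  have m_n: "norm (m x) \<le> 5/4" "norm (m x) \<ge> 3/4" "norm (n x) \<le> 1/4" if x: "x \<ge> X\<^sub>1" for x
    using size[OF x] \<rho>[OF x] norm_triangle_ineq[of "m x - 1" 1] norm_triangle_ineq4[of "m x" "m x - 1"] by auto
  have \<Delta>_norm: "norm (\<Delta> x) \<ge> 1/2" if x: "x \<ge> X\<^sub>1" for x
  proof -
    have "(3/4)\<^sup>2 \<le> (norm (m x))\<^sup>2" "(norm (n x))\<^sup>2 \<le> (1/4)\<^sup>2"
      using m_n[OF x] by (intro power_mono; simp)+
    then have "(norm (m x))\<^sup>2 - (norm (n x))\<^sup>2 \<ge> 1/2" by (simp add: power2_eq_square)
    moreover have "norm (m x * cnj (m x)) - norm (n x * cnj (n x)) \<le> norm (\<Delta> x)"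
      unfolding \<Delta>_def by (rule norm_triangle_ineq2)
    ultimately show ?thesis by (simp add: norm_mult power2_eq_square)
  qed
  then have \<Delta>_nz: "\<Delta> x \<noteq> 0" if "x \<ge> X\<^sub>1" for x using that by force
  have quot: "norm (z / \<Delta> x) \<le> 2 * norm z" if "x \<ge> X\<^sub>1" for x z
  proof -
    have "norm z = norm (z / \<Delta> x) * norm (\<Delta> x)" using \<Delta>_nz[OF that] by (simp add: norm_divide)
    also have "\<dots> \<ge> norm (z / \<Delta> x) * (1/2)" by (rule mult_left_mono[OF \<Delta>_norm[OF that]]) simp
    finally show ?thesis by simp
  qed
  have v_norm: "norm (v x) \<le> 4 * K * \<rho> x" if x: "x \<ge> X\<^sub>1" for x
    using quot[OF x, of "- n x"] size(2)[OF x] by (simp add: v_def)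
  have u_norm: "norm (u x - 1) \<le> 6 * K * \<rho> x" if x: "x \<ge> X\<^sub>1" for x
  proof -
    have "norm (cnj (m x) * (1 - m x) + n x * cnj (n x)) \<le> norm (m x) * norm (m x - 1) + norm (n x) * norm (n x)"
      by (rule norm_triangle_le) (simp add: norm_mult norm_minus_commute)
    also have "\<dots> \<le> 5/4 * (2 * K * \<rho> x) + 1/4 * (2 * K * \<rho> x)"
      using m_n[OF x] size[OF x] by (intro add_mono mult_mono) auto
    finally have "norm (cnj (m x) * (1 - m x) + n x * cnj (n x)) \<le> 3 * K * \<rho> x" by simp
    moreover have "u x - 1 = (cnj (m x) * (1 - m x) + n x * cnj (n x)) / \<Delta> x"
      using \<Delta>_nz[OF x] by (simp add: u_def field_simps) (simp add: \<Delta>_def algebra_simps)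
    ultimately show ?thesis using quot[OF x, of "cnj (m x) * (1 - m x) + n x * cnj (n x)"] by simp
  qed
  define k where "k = 2 * K + 2 * K * K"
  have k0: "k \<ge> 0" using K by (simp add: k_def)
  have R_norm: "norm (R\<^sub>1 x) \<le> k * (\<rho> x * \<rho> x * \<rho> x)" "norm (R\<^sub>2 x) \<le> k * (\<rho> x * \<rho> x * \<rho> x)" if x: "x \<ge> X\<^sub>1" for x
  proof -
    have xX: "x \<ge> X" using x X\<^sub>1 by simp
    note fst = first[OF xX, unfolded powers] and snd = second[OF xX, unfolded powers]
      and trd = third[OF xX, unfolded powers]
    have prod: "norm (s * t) \<le> K * K * (\<rho> x * \<rho> x * \<rho> x)"
      if "norm s \<le> K * (\<rho> x * \<rho> x)" "norm t \<le> K * \<rho> x" for s t :: complex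
    proof -
      have "norm s * norm t \<le> (K * (\<rho> x * \<rho> x)) * (K * \<rho> x)"
        using that K \<rho>[OF x] by (intro mult_mono) auto
      then show ?thesis by (simp add: norm_mult algebra_simps)
    qed
    have tri: "norm (- s - t - y - z) \<le> norm s + norm t + norm y + norm z" for s t y z :: complex
      by (intro norm_triangle_le_diff) (smt (verit) norm_minus_cancel norm_triangle_ineq4)
    show "norm (R\<^sub>1 x) \<le> k * (\<rho> x * \<rho> x * \<rho> x)"
      using tri[of "r\<^sub>1 x" "r\<^sub>3 x" "M x * q x" "N x * cnj (b x)"] prod[of "M x" "q x"] prod[of "N x" "cnj (b x)"]
        fst snd trd by (simp add: R\<^sub>1_def k_def algebra_simps)
    show "norm (R\<^sub>2 x) \<le> k * (\<rho> x * \<rho> x * \<rho> x)"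
      using tri[of "r\<^sub>2 x" "r\<^sub>4 x" "M x * b x" "N x * cnj (q x)"] prod[of "M x" "b x"] prod[of "N x" "cnj (q x)"]
        fst snd trd by (simp add: R\<^sub>2_def k_def algebra_simps)
  qed
  define G where "G = 8 * k + 10 * norm c * K"
  have S_norm: "norm (S\<^sub>1 x) + norm (S\<^sub>2 x) \<le> G * x powr (- 3 * \<gamma>)" if x: "x \<ge> X\<^sub>1" for x
  proof -
    let ?p = "\<rho> x * \<rho> x * \<rho> x"
    have v1: "norm (v x) \<le> 1" using v_norm[OF x] \<rho>[OF x] by simp
    have u2: "norm (u x) \<le> 3"
      using u_norm[OF x] \<rho>[OF x] norm_triangle_ineq[of "u x - 1" 1] by simp
    have u3: "norm (cnj (u x) - 1) \<le> 6 * K * \<rho> x"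
      using u_norm[OF x] by (metis complex_cnj_diff complex_cnj_one complex_mod_cnj)
    have p0: "k * ?p \<ge> 0" "norm c * (\<rho> x * \<rho> x) \<ge> 0" using k0 \<rho>[OF x] by simp_all
    have tri: "norm (s + t + y) \<le> norm s + norm t + norm y" for s t y :: complex
      by (intro norm_triangle_le add_mono) (simp_all add: norm_triangle_ineq)
    note mult_le = mult_mono[OF _ _ _ norm_ge_zero]
    have "norm (S\<^sub>1 x) \<le> norm (R\<^sub>1 x) * norm (u x) + norm (R\<^sub>2 x) * norm (v x) + norm (w x) * norm (v x)"
      using tri[of "R\<^sub>1 x * u x" "R\<^sub>2 x * cnj (v x)" "w x * cnj (v x)"]
      by (simp add: S\<^sub>1_def algebra_simps norm_mult)
    also have "\<dots> \<le> (k * ?p) * 3 + (k * ?p) * 1 + (norm c * (\<rho> x * \<rho> x)) * (4 * K * \<rho> x)"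
      unfolding w_norm
      by (intro add_mono mult_le R_norm[OF x] u2 v1 mult_left_mono[OF v_norm[OF x]] p0)
    finally have 1: "norm (S\<^sub>1 x) \<le> 4 * (k * ?p) + 4 * norm c * K * ?p" by (simp add: algebra_simps)
    have "norm (S\<^sub>2 x) \<le> norm (R\<^sub>1 x) * norm (v x) + norm (R\<^sub>2 x) * norm (u x) + norm (w x) * norm (cnj (u x) - 1)"
      using tri[of "R\<^sub>1 x * v x" "R\<^sub>2 x * cnj (u x)" "w x * (cnj (u x) - 1)"]
      by (simp add: S\<^sub>2_def norm_mult)
    also have "\<dots> \<le> (k * ?p) * 1 + (k * ?p) * 3 + (norm c * (\<rho> x * \<rho> x)) * (6 * K * \<rho> x)"
      unfolding w_norm
      by (intro add_mono mult_le R_norm[OF x] u2 v1 mult_left_mono[OF u3] p0)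
    finally have 2: "norm (S\<^sub>2 x) \<le> 4 * (k * ?p) + 6 * norm c * K * ?p" by (simp add: algebra_simps)
    show ?thesis using 1 2 unfolding powers by (simp add: G_def algebra_simps)
  qed

  have derivs: "(m has_vector_derivative - (q x + r\<^sub>1 x) - (- (Q x * q x + B x * cnj (b x)) + r\<^sub>3 x)) (at x)"
    "(n has_vector_derivative - (b x + r\<^sub>2 x) - (- (Q x * b x + B x * cnj (q x)) - w x + r\<^sub>4 x)) (at x)" if "x \<ge> X" for x
    unfolding m_def n_def w_def using Q[OF that] B[OF that] M[OF that] N[OF that]
    by (intro has_vector_derivative_diff has_vector_derivative_minus; auto intro: has_vector_derivative_const
        intro!: derivative_eq_intros)+
  have QBMN_cont: "continuous_on {X..} Q" "continuous_on {X..} B" "continuous_on {X..} M" "continuous_on {X..} N"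
    by (rule continuous_at_imp_continuous_on;
        use has_vector_derivative_continuous[OF Q] has_vector_derivative_continuous[OF B]
          has_vector_derivative_continuous[OF M] has_vector_derivative_continuous[OF N] in simp)+
  have sub: "{X\<^sub>1..} \<subseteq> {X..}" using X\<^sub>1 by auto
  note conts = continuous_on_subset[OF QBMN_cont(1) sub] continuous_on_subset[OF QBMN_cont(2) sub]
    continuous_on_subset[OF QBMN_cont(3) sub] continuous_on_subset[OF QBMN_cont(4) sub]
    continuous_on_subset[OF cont(1) sub] continuous_on_subset[OF cont(2) sub]
    continuous_on_subset[OF cont(3) sub] continuous_on_subset[OF cont(4) sub]
    continuous_on_subset[OF cont(5) sub] continuous_on_subset[OF cont(6) sub]
  have mn_cont: "continuous_on {X\<^sub>1..} m" "continuous_on {X\<^sub>1..} n"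
    unfolding m_def n_def by (intro continuous_intros conts)+
  have uv_cont: "continuous_on {X\<^sub>1..} u" "continuous_on {X\<^sub>1..} v"
    unfolding u_def v_def using \<Delta>_nz unfolding \<Delta>_def
    by (intro continuous_intros mn_cont; auto)+
  have w_cont: "continuous_on {X\<^sub>1..} w"
    unfolding w_def using X X\<^sub>1 by (intro continuous_intros) auto
  have S_cont: "continuous_on {X\<^sub>1..} S\<^sub>1" "continuous_on {X\<^sub>1..} S\<^sub>2"
    unfolding S\<^sub>1_def S\<^sub>2_def R\<^sub>1_def R\<^sub>2_def by (intro continuous_intros conts uv_cont w_cont)+

  define \<Gamma> where "\<Gamma> = (\<lambda>x::real. G * (- (x powr (- 3 * \<gamma> + 1)) / (- 3 * \<gamma> + 1)))"
  have \<Gamma>: "((\<lambda>x. G * x powr (- 3 * \<gamma>)) has_integral \<Gamma> x) {x..}" if "x \<ge> X\<^sub>1" for x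
    unfolding \<Gamma>_def by (intro has_integral_mult_right has_integral_powr_to_inf) (use X X\<^sub>1 that \<gamma> in auto)
  have \<Gamma>_lim: "(\<Gamma> \<longlongrightarrow> 0) at_top"
  proof -
    have "((\<lambda>x::real. x powr (- 3 * \<gamma> + 1)) \<longlongrightarrow> 0) at_top"
      by (rule tendsto_neg_powr) (use \<gamma> filterlim_ident in auto)
    then have "(\<Gamma> \<longlongrightarrow> G * (- (0 / (- 3 * \<gamma> + 1)))) at_top"
      unfolding \<Gamma>_def minus_divide_left[symmetric]
      by (intro tendsto_mult tendsto_minus tendsto_divide tendsto_const) (use \<gamma> in auto)
    then show ?thesis by simp
  qed
  obtain Y d \<phi> where Y: "Y \<ge> X\<^sub>1"
    and d: "\<And>x. x > Y \<Longrightarrow> (d has_vector_derivative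
        c * complex_of_real (x powr (- 2 * \<gamma>)) * cnj (d x) + S\<^sub>1 x * d x + S\<^sub>2 x * cnj (d x)) (at x)"
    and d_lim: "((\<lambda>x. d x / (f x * cis \<phi>)) \<longlongrightarrow> 1) at_top"
    by (rule levinson_decaying_solution[of X\<^sub>1 f c "\<lambda>x. x powr (- 2 * \<gamma>)" S\<^sub>1 S\<^sub>2
         "\<lambda>x. G * x powr (- 3 * \<gamma>)" \<Gamma>])
       (use X\<^sub>1(1) f S_cont S_norm \<Gamma> \<Gamma>_lim in \<open>auto simp del: of_real_mult\<close>)
  define a where "a = (\<lambda>x. u x * d x + v x * cnj (d x))"
  have d_a: "m x * a x + n x * cnj (a x) = d x" if x: "x \<ge> X\<^sub>1" for x
  proof -
    have cnj_\<Delta>: "cnj (\<Delta> x) = \<Delta> x" by (simp add: \<Delta>_def)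
    have "m x * a x + n x * cnj (a x) = (m x * cnj (m x) - n x * cnj (n x)) / \<Delta> x * d x"
      by (simp add: a_def u_def v_def cnj_\<Delta> field_simps diff_divide_distrib)
    also have "\<dots> = d x" using \<Delta>_nz[OF x] by (simp add: \<Delta>_def)
    finally show ?thesis .
  qed
  have a': "(a has_vector_derivative q x * a x + b x * cnj (a x)) (at x)" if x: "x > Y" for x
  proof -
    have xs: "x \<ge> X\<^sub>1" "x \<ge> X" using x Y X\<^sub>1 by auto
    \<comment> \<open>The derivative \<open>D\<close> of \<open>a\<close> exists because \<open>u\<close>, \<open>v\<close>, \<open>d\<close> are differentiable; its value follows by
      comparing the two expressions for \<open>d'\<close>, since \<open>z \<mapsto> m z + n cnj z\<close> is injective for \<open>|n| < |m|\<close>.\<close>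
    have cnj_diff: "(\<lambda>x. cnj (g x)) differentiable (at x)" if "g differentiable (at x)" for g :: "real \<Rightarrow> complex"
      using that has_vector_derivative_cnj[of g _ x UNIV] 
      by (metis differentiableI_vector vector_derivative_works)
    have "m differentiable (at x)" "n differentiable (at x)" "d differentiable (at x)"
      using derivs[OF xs(2)] d[OF x] by (auto intro: differentiableI_vector)
    then have "a differentiable (at x)"
      unfolding a_def u_def v_def using \<Delta>_nz[OF xs(1)] unfolding \<Delta>_def
      by (intro derivative_intros cnj_diff) auto
    then obtain D where D: "(a has_vector_derivative D) (at x)"
      by (auto simp: vector_derivative_works)
    have "((\<lambda>x. m x * a x + n x * cnj (a x)) has_vector_derivative
        m x * D + (- (q x + r\<^sub>1 x) - (- (Q x * q x + B x * cnj (b x)) + r\<^sub>3 x)) * a x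
        + (n x * cnj D + (- (b x + r\<^sub>2 x) - (- (Q x * b x + B x * cnj (q x)) - w x + r\<^sub>4 x)) * cnj (a x))) (at x)"
      by (intro has_vector_derivative_add has_vector_derivative_mult has_vector_derivative_cnj D derivs xs)
    then have "(d has_vector_derivative
        m x * D + (- (q x + r\<^sub>1 x) - (- (Q x * q x + B x * cnj (b x)) + r\<^sub>3 x)) * a x
        + (n x * cnj D + (- (b x + r\<^sub>2 x) - (- (Q x * b x + B x * cnj (q x)) - w x + r\<^sub>4 x)) * cnj (a x))) (at x)"
      by (rule has_vector_derivative_transform_within_open[where S = "{Y<..}"]) (use x Y d_a in auto)
    from vector_derivative_unique_at[OF this d[OF x]]
    have "m x * D + (- (q x + r\<^sub>1 x) - (- (Q x * q x + B x * cnj (b x)) + r\<^sub>3 x)) * a x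
        + (n x * cnj D + (- (b x + r\<^sub>2 x) - (- (Q x * b x + B x * cnj (q x)) - w x + r\<^sub>4 x)) * cnj (a x))
       = w x * cnj (d x) + S\<^sub>1 x * d x + S\<^sub>2 x * cnj (d x)"
      by (simp add: w_def)
    also have "\<dots> = R\<^sub>1 x * a x + (w x + R\<^sub>2 x) * cnj (a x)"
      by (simp add: S\<^sub>1_def S\<^sub>2_def a_def algebra_simps)
    finally have "m x * (D - (q x * a x + b x * cnj (a x))) + n x * cnj (D - (q x * a x + b x * cnj (a x))) = 0"
      by (simp add: R\<^sub>1_def R\<^sub>2_def m_def n_def algebra_simps)
    then have "m x * (D - (q x * a x + b x * cnj (a x))) = - n x * cnj (D - (q x * a x + b x * cnj (a x)))"
      by (simp add: eq_neg_iff_add_eq_0)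
    then have "norm (m x) * norm (D - (q x * a x + b x * cnj (a x))) = norm (n x) * norm (D - (q x * a x + b x * cnj (a x)))"
      by (metis complex_mod_cnj norm_minus_cancel norm_mult)
    then have "D = q x * a x + b x * cnj (a x)" using m_n[OF xs(1)] by auto
    then show ?thesis using D by simp
  qed
  have \<rho>_lim: "((\<lambda>x. C * \<rho> x) \<longlongrightarrow> 0) at_top" for C unfolding \<rho>_def by (rule decay)
  have "((\<lambda>x. u x - 1) \<longlongrightarrow> 0) at_top"
    by (rule Lim_null_comparison[OF _ \<rho>_lim[of "6 * K"]])
       (use u_norm in \<open>auto simp: eventually_at_top_linorder\<close>)
  then have u_lim: "(u \<longlongrightarrow> 1) at_top" by (simp add: Lim_null[symmetric])
  have v_lim: "(v \<longlongrightarrow> 0) at_top"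
    by (rule Lim_null_comparison[OF _ \<rho>_lim[of "4 * K"]])
       (use v_norm in \<open>auto simp: eventually_at_top_linorder\<close>)
  have "((\<lambda>x. norm (v x) * norm (d x / (f x * cis \<phi>))) \<longlongrightarrow> 0 * 1) at_top"
    using tendsto_mult[OF tendsto_norm[OF v_lim] tendsto_norm[OF d_lim]] by simp
  then have "((\<lambda>x. norm (v x * cnj (d x) / (f x * cis \<phi>))) \<longlongrightarrow> 0) at_top"
    by (simp add: norm_mult norm_divide)
  then have "((\<lambda>x. v x * cnj (d x) / (f x * cis \<phi>)) \<longlongrightarrow> 0) at_top"
    by (rule tendsto_norm_zero_cancel)
  from tendsto_add[OF tendsto_mult[OF u_lim d_lim] this]
  have "((\<lambda>x. a x / (f x * cis \<phi>)) \<longlongrightarrow> 1) at_top"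
    by (simp add: a_def add_divide_distrib)
  with a' Y X\<^sub>1 show ?thesis using that[of Y a \<phi>] by auto
qed

section \<open>Averaging of oscillating coefficients\<close>

definition trig_sum :: "'i set \<Rightarrow> ('i \<Rightarrow> complex) \<Rightarrow> ('i \<Rightarrow> real) \<Rightarrow> real \<Rightarrow> complex" where
  "trig_sum J c \<nu> x = (\<Sum>j\<in>J. c j * cis (\<nu> j * x))"

lemma trig_sum_mult:
  "trig_sum I c \<nu> x * trig_sum J d \<mu> x =
     trig_sum (I \<times> J) (\<lambda>(i, j). c i * d j) (\<lambda>(i, j). \<nu> i + \<mu> j) x"
  unfolding trig_sum_def sum_product sum.cartesian_product
  by (intro sum.cong) (auto simp: algebra_simps simp flip: cis_mult)

lemma trig_sum_minus: "- trig_sum J c \<nu> x = trig_sum J (\<lambda>j. - c j) \<nu> x"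
  by (simp add: trig_sum_def sum_negf)

lemma trig_sum_cmult: "z * trig_sum J c \<nu> x = trig_sum J (\<lambda>j. z * c j) \<nu> x"
  by (simp add: trig_sum_def sum_distrib_left mult.assoc)

lemma trig_sum_shift: "cis (s * x) * trig_sum J c \<nu> x = trig_sum J c (\<lambda>j. \<nu> j + s) x"
  unfolding trig_sum_def sum_distrib_left
  by (intro sum.cong) (auto simp: algebra_simps simp flip: cis_mult)

lemma trig_sum_norm: "norm (trig_sum J c \<nu> x) \<le> (\<Sum>j\<in>J. norm (c j))"
  unfolding trig_sum_def by (rule order_trans[OF norm_sum]) (simp add: norm_mult)

lemma continuous_on_trig_sum: "continuous_on A (trig_sum J c \<nu>)"
  unfolding trig_sum_def by (intro continuous_intros)

lemma trig_sum_split_resonant: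
  assumes "finite J"
  shows "trig_sum J c \<nu> x = (\<Sum>j\<in>{j\<in>J. \<nu> j = 0}. c j) + trig_sum {j\<in>J. \<nu> j \<noteq> 0} c \<nu> x"
proof -
  have "trig_sum J c \<nu> x = trig_sum {j\<in>J. \<nu> j = 0} c \<nu> x + trig_sum {j\<in>J. \<nu> j \<noteq> 0} c \<nu> x"
    unfolding trig_sum_def using assms by (subst sum.union_disjoint[symmetric]) (auto intro!: sum.cong)
  then show ?thesis by (simp add: trig_sum_def)
qed

text \<open>
Integrating the exponentials and ignoring the amplitude costs only the derivative of \<open>x\<^bsup>-\<delta>\<^esup>\<close>, a factor
\<open>x\<close> better than the integrand. The zero frequencies are what this cannot treat.
\<close>

lemma oscillatory_antiderivative:
  fixes c :: "'i \<Rightarrow> complex" and \<nu> :: "'i \<Rightarrow> real"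
  assumes \<nu>: "\<And>j. j \<in> J \<Longrightarrow> \<nu> j \<noteq> 0" and \<delta>: "\<delta> > 0"
  defines "F \<equiv> \<lambda>x. of_real (x powr - \<delta>) * trig_sum J (\<lambda>j. c j / (\<i> * \<nu> j)) \<nu> x"
  obtains r K where "K \<ge> 0" "continuous_on {0<..} r"
    "\<And>x. x > 0 \<Longrightarrow> (F has_vector_derivative of_real (x powr - \<delta>) * trig_sum J c \<nu> x + r x) (at x)"
    "\<And>x. x > 0 \<Longrightarrow> norm (F x) \<le> K * x powr - \<delta>"
    "\<And>x. x > 0 \<Longrightarrow> norm (r x) \<le> K * x powr (- \<delta> - 1)"
proof -
  define S where "S = trig_sum J (\<lambda>j. c j / (\<i> * \<nu> j)) \<nu>"
  define K\<^sub>0 where "K\<^sub>0 = (\<Sum>j\<in>J. norm (c j / (\<i> * \<nu> j)))"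
  define r where "r = (\<lambda>x. of_real (- \<delta> * x powr (- \<delta> - 1)) * S x)"
  have K\<^sub>0: "K\<^sub>0 \<ge> 0" "norm (S x) \<le> K\<^sub>0" for x
    unfolding K\<^sub>0_def S_def by (auto intro: sum_nonneg trig_sum_norm)
  have S': "(S has_vector_derivative trig_sum J c \<nu> x) (at x)" for x
  proof -
    have "((\<lambda>x. c j / (\<i> * \<nu> j) * cis (\<nu> j * x)) has_vector_derivative c j * cis (\<nu> j * x)) (at x)" if j: "j \<in> J" for j
    proof -
      have "((\<lambda>z. exp (\<i> * \<nu> j * z)) has_field_derivative \<i> * \<nu> j * exp (\<i> * \<nu> j * of_real x)) (at (of_real x))"
        by (auto intro!: derivative_eq_intros)
      from has_vector_derivative_real_field[OF this]
      have "((\<lambda>x. cis (\<nu> j * x)) has_vector_derivative \<i> * \<nu> j * cis (\<nu> j * x)) (at x)"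
        by (simp add: cis_conv_exp mult_ac)
      from has_vector_derivative_mult_right[OF this, of "c j / (\<i> * \<nu> j)"]
      show ?thesis using \<nu>[OF j] by simp
    qed
    then show ?thesis unfolding S_def trig_sum_def by (rule has_vector_derivative_sum)
  qed
  show ?thesis
  proof (rule that[of "(1 + \<delta>) * K\<^sub>0" r])
    show "(1 + \<delta>) * K\<^sub>0 \<ge> 0" using \<delta> K\<^sub>0 by simp
    show "continuous_on {0<..} r"
      unfolding r_def S_def by (intro continuous_intros continuous_on_trig_sum) auto
    fix x :: real assume x: "x > 0"
    have "((\<lambda>x. x powr - \<delta>) has_real_derivative - \<delta> * x powr (- \<delta> - 1)) (at x)"
      using x by (auto intro!: derivative_eq_intros)
    from has_vector_derivative_mult[OF has_vector_derivative_of_real[OF this] S'[of x]]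
    show "(F has_vector_derivative of_real (x powr - \<delta>) * trig_sum J c \<nu> x + r x) (at x)"
      unfolding F_def S_def[symmetric] r_def .
    have "K\<^sub>0 \<le> (1 + \<delta>) * K\<^sub>0" "\<delta> * K\<^sub>0 \<le> (1 + \<delta>) * K\<^sub>0" using \<delta> K\<^sub>0(1) by (auto simp: algebra_simps)
    then have "norm (S x) \<le> (1 + \<delta>) * K\<^sub>0" "\<delta> * norm (S x) \<le> (1 + \<delta>) * K\<^sub>0"
      using K\<^sub>0(2)[of x] mult_left_mono[OF K\<^sub>0(2)[of x] less_imp_le[OF \<delta>]] by linarith+
    from mult_right_mono[OF this(1), of "x powr - \<delta>"] mult_right_mono[OF this(2), of "x powr (- \<delta> - 1)"]
    show "norm (F x) \<le> (1 + \<delta>) * K\<^sub>0 * x powr - \<delta>" "norm (r x) \<le> (1 + \<delta>) * K\<^sub>0 * x powr (- \<delta> - 1)"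
      unfolding F_def S_def[symmetric] r_def norm_mult norm_of_real
      using \<delta> by (simp_all add: abs_mult mult_ac)
  qed
qed

text \<open>
Here \<open>W\<close> is the potential for large \<open>x\<close>, written with signed frequencies \<open>\<omega>\<close>. The antiderivatives \<open>Q\<close>,
\<open>B\<close> are explicit, so the quadratic coefficients \<open>Q q + B cnj b\<close> and \<open>Q b + B cnj q\<close> are trigonometric
sums over pairs \<open>(i, j)\<close>. They have opposite coefficients, \<open>C (i, j)\<close> and \<open>- C (i, j)\<close>, at the
frequencies \<open>\<omega> i + \<omega> j\<close> and \<open>\<omega> i + \<omega> j - 2 \<kappa>\<close>. The resonant part of the first is the sum in
\<open>no_drift\<close>; a nonzero value would make the phase of \<open>w\<close> drift. In the second,
\<open>\<omega> i - 2 \<kappa> = - \<omega> j\<close> turns \<open>1 / \<omega> i - 1 / (\<omega> i - 2 \<kappa>)\<close> into \<open>2 \<kappa> / (\<omega> i * \<omega> j)\<close>, which yields the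
rate \<open>l\<close>.
\<close>

lemma resonant_decaying_solution:
  fixes \<omega> \<mu> :: "'i \<Rightarrow> real" and W f :: "real \<Rightarrow> real"
  assumes I: "finite I" and X: "X \<ge> 1" and \<gamma>: "1/3 < \<gamma>" "\<gamma> \<le> 1/2" and \<kappa>: "\<kappa> > 0"
    and \<omega>: "\<And>i. i \<in> I \<Longrightarrow> \<omega> i \<noteq> 0" "\<And>i. i \<in> I \<Longrightarrow> \<omega> i \<noteq> 2 * \<kappa>"
    and W: "\<And>x. x \<ge> X \<Longrightarrow> of_real (W x) = of_real (x powr - \<gamma>) * trig_sum I (\<lambda>i. of_real (\<mu> i / 2)) \<omega> x"
    and no_drift: "(\<Sum>(i, j)\<in>{(i, j). i \<in> I \<and> j \<in> I \<and> \<omega> i + \<omega> j = 0}.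
                      \<mu> i * \<mu> j * (1 / \<omega> i - 1 / (\<omega> i - 2 * \<kappa>))) = 0"
    and l: "l = \<bar>\<Sum>(i, j)\<in>{(i, j). i \<in> I \<and> j \<in> I \<and> \<omega> i + \<omega> j = 2 * \<kappa>}. \<mu> i * \<mu> j / (\<omega> i * \<omega> j)\<bar> / (8 * \<kappa>)"
    and f: "\<And>x. x \<ge> X \<Longrightarrow> f x > 0"
      "\<And>x. x \<ge> X \<Longrightarrow> (f has_real_derivative - l * x powr (- 2 * \<gamma>) * f x) (at x)"
  obtains Y w \<phi> where "Y \<ge> X"
    "\<And>x. x > Y \<Longrightarrow> (w has_vector_derivative \<i> * \<kappa> * w x + of_real (W x / \<kappa> * Im (w x))) (at x)"
    "((\<lambda>x. w x / (f x * cis (\<kappa> * x + \<phi>))) \<longlongrightarrow> 1) at_top"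
proof -
  define \<beta> where "\<beta> = 1 / (2 * \<kappa>)"
  define s where "s = (\<lambda>x. complex_of_real (x powr - \<gamma>))"
  define s2 where "s2 = (\<lambda>x. complex_of_real (x powr - (2 * \<gamma>)))"
  have s2: "s x * s x = s2 x" for x by (simp add: s_def s2_def flip: of_real_mult powr_add)
  define \<omega>' where "\<omega>' = (\<lambda>i. \<omega> i - 2 * \<kappa>)"
  define cq where "cq = (\<lambda>i. - \<i> * \<beta> * of_real (\<mu> i / 2))"
  define cb where "cb = (\<lambda>i. \<i> * \<beta> * of_real (\<mu> i / 2))"
  define q where "q = (\<lambda>x. s x * trig_sum I cq \<omega> x)"
  define b where "b = (\<lambda>x. s x * trig_sum I cb \<omega>' x)"
  define Q where "Q = (\<lambda>x. s x * trig_sum I (\<lambda>i. cq i / (\<i> * \<omega> i)) \<omega> x)"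
  define B where "B = (\<lambda>x. s x * trig_sum I (\<lambda>i. cb i / (\<i> * \<omega>' i)) \<omega>' x)"
  have q_W: "q x = - \<i> * \<beta> * W x" if "x \<ge> X" for x
    unfolding W[OF that] q_def cq_def s_def trig_sum_cmult[symmetric] by (simp add: mult_ac)
  have b_W: "b x = \<i> * \<beta> * W x * cis (- (2 * \<kappa>) * x)" if "x \<ge> X" for x
  proof -
    have "trig_sum I cb \<omega>' x = cis (- (2 * \<kappa>) * x) * trig_sum I cb \<omega> x"
      unfolding trig_sum_shift \<omega>'_def by simp
    moreover have "trig_sum I cb \<omega> x = \<i> * \<beta> * trig_sum I (\<lambda>i. of_real (\<mu> i / 2)) \<omega> x"
      unfolding trig_sum_cmult cb_def ..
    ultimately show ?thesis unfolding W[OF that] s_def b_def by (simp add: mult_ac)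
  qed
  have cnj_q: "cnj (q x) = s x * trig_sum I cb \<omega> x" if "x \<ge> X" for x
  proof -
    have "s x * trig_sum I cb \<omega> x = \<i> * \<beta> * W x"
      unfolding W[OF that] cb_def s_def trig_sum_cmult[symmetric] by (simp add: mult_ac)
    then show ?thesis by (simp add: q_W[OF that])
  qed
  have cnj_b: "cnj (b x) = s x * trig_sum I cq (\<lambda>i. \<omega> i + 2 * \<kappa>) x" if "x \<ge> X" for x
  proof -
    have "s x * trig_sum I cq (\<lambda>i. \<omega> i + 2 * \<kappa>) x = cis (2 * \<kappa> * x) * (- \<i> * \<beta> * W x)"
      unfolding q_W[OF that, symmetric] q_def by (simp add: trig_sum_shift mult.left_commute)
    then show ?thesis by (simp add: b_W[OF that] cis_cnj)
  qed

  define P where "P = I \<times> I"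
  have P: "finite P" using I by (simp add: P_def)
  define C where "C = (\<lambda>(i, j). \<i> * complex_of_real (\<beta> * \<beta> / 4 * (\<mu> i * \<mu> j * (1 / \<omega> i - 1 / \<omega>' i))))"
  define \<nu>\<^sub>1 where "\<nu>\<^sub>1 = (\<lambda>(i, j). \<omega> i + \<omega> j)"
  define \<nu>\<^sub>2 where "\<nu>\<^sub>2 = (\<lambda>(i, j). \<omega> i + \<omega> j - 2 * \<kappa>)"
  define P\<^sub>1 where "P\<^sub>1 = {p\<in>P. \<nu>\<^sub>1 p \<noteq> 0}"
  define P\<^sub>2 where "P\<^sub>2 = {p\<in>P. \<nu>\<^sub>2 p \<noteq> 0}"
  define c where "c = (\<Sum>p\<in>{p\<in>P. \<nu>\<^sub>2 p = 0}. C p)"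
  have \<omega>'_nz: "\<omega>' i \<noteq> 0" if "i \<in> I" for i using \<omega>(2)[OF that] by (simp add: \<omega>'_def)

  have "(\<Sum>p\<in>{p\<in>P. \<nu>\<^sub>1 p = 0}. C p) = 
     \<i> * complex_of_real (\<beta> * \<beta> / 4 * (\<Sum>(i, j)\<in>{(i, j). i \<in> I \<and> j \<in> I \<and> \<omega> i + \<omega> j = 0}. \<mu> i * \<mu> j * (1 / \<omega> i - 1 / (\<omega> i - 2 * \<kappa>))))"
    unfolding sum_distrib_left of_real_sum
    by (intro sum.cong) (auto simp: P_def \<nu>\<^sub>1_def C_def \<omega>'_def)
  then have drift: "(\<Sum>p\<in>{p\<in>P. \<nu>\<^sub>1 p = 0}. C p) = 0" unfolding no_drift by simp
  have "c = \<i> * complex_of_real ((\<Sum>(i, j)\<in>{(i, j). i \<in> I \<and> j \<in> I \<and> \<omega> i + \<omega> j = 2 * \<kappa>}. \<mu> i * \<mu> j / (\<omega> i * \<omega> j)) / (8 * \<kappa>))"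
    unfolding c_def sum_divide_distrib of_real_sum sum_distrib_left
  proof (intro sum.cong)
    show "{p\<in>P. \<nu>\<^sub>2 p = 0} = {(i, j). i \<in> I \<and> j \<in> I \<and> \<omega> i + \<omega> j = 2 * \<kappa>}"
      by (auto simp: P_def \<nu>\<^sub>2_def)
    fix p assume "p \<in> {(i, j). i \<in> I \<and> j \<in> I \<and> \<omega> i + \<omega> j = 2 * \<kappa>}"
    then obtain i j where p: "p = (i, j)" "i \<in> I" "j \<in> I" "\<omega> i + \<omega> j = 2 * \<kappa>" by auto
    have "1 / \<omega> i - 1 / \<omega>' i = 1 / \<omega> i + 1 / \<omega> j"
    proof -
      have "\<omega>' i = - \<omega> j" using p by (simp add: \<omega>'_def)
      then show ?thesis by simp
    qed
    also have "\<dots> = (\<omega> i + \<omega> j) / (\<omega> i * \<omega> j)" using \<omega>(1) p by (simp add: field_simps)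
    also have "\<dots> = 2 * \<kappa> / (\<omega> i * \<omega> j)" by (simp add: p)
    finally have "\<beta> * \<beta> / 4 * (\<mu> i * \<mu> j * (1 / \<omega> i - 1 / \<omega>' i)) = \<mu> i * \<mu> j / (\<omega> i * \<omega> j) / (8 * \<kappa>)"
      using \<kappa> by (simp add: \<beta>_def field_simps)
    then show "C p = \<i> * of_real ((case p of (i, j) \<Rightarrow> \<mu> i * \<mu> j / (\<omega> i * \<omega> j)) / (8 * \<kappa>))"
      unfolding p(1) C_def prod.case by (rule arg_cong)
  qed
  then have norm_c: "norm c = l" 
    using \<kappa> unfolding l by (simp only: norm_mult norm_of_real norm_ii abs_divide)

  have QqBb: "Q x * q x + B x * cnj (b x) = s2 x * trig_sum P\<^sub>1 C \<nu>\<^sub>1 x" if x: "x \<ge> X" for x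
  proof -
    have "Q x * q x + B x * cnj (b x)
      = s2 x * (trig_sum I (\<lambda>i. cq i / (\<i> * \<omega> i)) \<omega> x * trig_sum I cq \<omega> x
        + trig_sum I (\<lambda>i. cb i / (\<i> * \<omega>' i)) \<omega>' x * trig_sum I cq (\<lambda>i. \<omega> i + 2 * \<kappa>) x)"
      unfolding cnj_b[OF x] Q_def B_def q_def s2[symmetric] by (simp add: algebra_simps)
    also have "trig_sum I (\<lambda>i. cq i / (\<i> * \<omega> i)) \<omega> x * trig_sum I cq \<omega> x
        + trig_sum I (\<lambda>i. cb i / (\<i> * \<omega>' i)) \<omega>' x * trig_sum I cq (\<lambda>i. \<omega> i + 2 * \<kappa>) x = trig_sum P C \<nu>\<^sub>1 x"
      unfolding trig_sum_mult P_def[symmetric] unfolding trig_sum_def sum.distrib[symmetric]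
    proof (intro sum.cong refl)
      fix p assume "p \<in> P"
      then obtain i j where p: "p = (i, j)" "i \<in> I" "j \<in> I" by (auto simp: P_def)
      have eq: "cq i / (\<i> * \<omega> i) * cq j + cb i / (\<i> * \<omega>' i) * cq j = C (i, j)"
        using \<omega>(1)[OF p(2)] \<omega>'_nz[OF p(2)] by (simp add: cq_def cb_def C_def field_simps)
      have freq: "\<omega>' i + (\<omega> j + 2 * \<kappa>) = \<omega> i + \<omega> j" by (simp add: \<omega>'_def)
      show "(case p of (i, j) \<Rightarrow> cq i / (\<i> * \<omega> i) * cq j) * cis ((case p of (i, j) \<Rightarrow> \<omega> i + \<omega> j) * x) +
         (case p of (i, j) \<Rightarrow> cb i / (\<i> * \<omega>' i) * cq j) * cis ((case p of (i, j) \<Rightarrow> \<omega>' i + (\<omega> j + 2 * \<kappa>)) * x) =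
         C p * cis (\<nu>\<^sub>1 p * x)"
        unfolding p(1) prod.case \<nu>\<^sub>1_def freq distrib_right[symmetric] eq[unfolded distrib_right[symmetric]] ..
    qed
    also have "trig_sum P C \<nu>\<^sub>1 x = trig_sum P\<^sub>1 C \<nu>\<^sub>1 x"
      using trig_sum_split_resonant[OF P, of C \<nu>\<^sub>1 x] drift by (simp add: P\<^sub>1_def)
    finally show ?thesis .
  qed
  have QbBq: "Q x * b x + B x * cnj (q x) = - c * s2 x - s2 x * trig_sum P\<^sub>2 C \<nu>\<^sub>2 x" if x: "x \<ge> X" for x
  proof -
    have "Q x * b x + B x * cnj (q x)
      = s2 x * (trig_sum I (\<lambda>i. cq i / (\<i> * \<omega> i)) \<omega> x * trig_sum I cb \<omega>' x
        + trig_sum I (\<lambda>i. cb i / (\<i> * \<omega>' i)) \<omega>' x * trig_sum I cb \<omega> x)"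
      unfolding cnj_q[OF x] Q_def B_def b_def s2[symmetric] by (simp add: algebra_simps)
    also have "trig_sum I (\<lambda>i. cq i / (\<i> * \<omega> i)) \<omega> x * trig_sum I cb \<omega>' x
        + trig_sum I (\<lambda>i. cb i / (\<i> * \<omega>' i)) \<omega>' x * trig_sum I cb \<omega> x = - trig_sum P C \<nu>\<^sub>2 x"
      unfolding trig_sum_mult P_def[symmetric] trig_sum_minus unfolding trig_sum_def sum.distrib[symmetric]
    proof (intro sum.cong refl)
      fix p assume "p \<in> P"
      then obtain i j where p: "p = (i, j)" "i \<in> I" "j \<in> I" by (auto simp: P_def)
      have eq: "cq i / (\<i> * \<omega> i) * cb j + cb i / (\<i> * \<omega>' i) * cb j = - C (i, j)"
        using \<omega>(1)[OF p(2)] \<omega>'_nz[OF p(2)] by (simp add: cq_def cb_def C_def field_simps)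
      have freq: "\<omega> i + \<omega>' j = \<omega> i + \<omega> j - 2 * \<kappa>" "\<omega>' i + \<omega> j = \<omega> i + \<omega> j - 2 * \<kappa>"
        by (simp_all add: \<omega>'_def)
      show "(case p of (i, j) \<Rightarrow> cq i / (\<i> * \<omega> i) * cb j) * cis ((case p of (i, j) \<Rightarrow> \<omega> i + \<omega>' j) * x) +
         (case p of (i, j) \<Rightarrow> cb i / (\<i> * \<omega>' i) * cb j) * cis ((case p of (i, j) \<Rightarrow> \<omega>' i + \<omega> j) * x) =
         - C p * cis (\<nu>\<^sub>2 p * x)"
        unfolding p(1) prod.case \<nu>\<^sub>2_def freq distrib_right[symmetric] eq[unfolded distrib_right[symmetric]] ..
    qed
    also have "trig_sum P C \<nu>\<^sub>2 x = c + trig_sum P\<^sub>2 C \<nu>\<^sub>2 x"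
      using trig_sum_split_resonant[OF P, of C \<nu>\<^sub>2 x] by (simp add: P\<^sub>2_def c_def)
    finally show ?thesis by (simp add: algebra_simps)
  qed

  obtain r\<^sub>1 K\<^sub>1 where 1: "K\<^sub>1 \<ge> 0" "continuous_on {0<..} r\<^sub>1"
    "\<And>x. x > 0 \<Longrightarrow> (Q has_vector_derivative q x + r\<^sub>1 x) (at x)"
    "\<And>x. x > 0 \<Longrightarrow> norm (Q x) \<le> K\<^sub>1 * x powr - \<gamma>"
    "\<And>x. x > 0 \<Longrightarrow> norm (r\<^sub>1 x) \<le> K\<^sub>1 * x powr (- \<gamma> - 1)"
    by (rule oscillatory_antiderivative[of I \<omega> \<gamma> cq]) (use \<omega> \<gamma> in \<open>auto simp: Q_def q_def s_def\<close>)
  obtain r\<^sub>2 K\<^sub>2 where 2: "K\<^sub>2 \<ge> 0" "continuous_on {0<..} r\<^sub>2"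
    "\<And>x. x > 0 \<Longrightarrow> (B has_vector_derivative b x + r\<^sub>2 x) (at x)"
    "\<And>x. x > 0 \<Longrightarrow> norm (B x) \<le> K\<^sub>2 * x powr - \<gamma>"
    "\<And>x. x > 0 \<Longrightarrow> norm (r\<^sub>2 x) \<le> K\<^sub>2 * x powr (- \<gamma> - 1)"
    by (rule oscillatory_antiderivative[of I \<omega>' \<gamma> cb]) (use \<omega>'_nz \<gamma> in \<open>auto simp: B_def b_def s_def\<close>)
  define M where "M = (\<lambda>x. s2 x * trig_sum P\<^sub>1 (\<lambda>p. - C p / (\<i> * \<nu>\<^sub>1 p)) \<nu>\<^sub>1 x)"
  obtain r\<^sub>3 K\<^sub>3 where 3: "K\<^sub>3 \<ge> 0" "continuous_on {0<..} r\<^sub>3"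
    "\<And>x. x > 0 \<Longrightarrow> (M has_vector_derivative s2 x * trig_sum P\<^sub>1 (\<lambda>p. - C p) \<nu>\<^sub>1 x + r\<^sub>3 x) (at x)"
    "\<And>x. x > 0 \<Longrightarrow> norm (M x) \<le> K\<^sub>3 * x powr - (2 * \<gamma>)"
    "\<And>x. x > 0 \<Longrightarrow> norm (r\<^sub>3 x) \<le> K\<^sub>3 * x powr (- (2 * \<gamma>) - 1)"
    by (rule oscillatory_antiderivative[of P\<^sub>1 \<nu>\<^sub>1 "2 * \<gamma>" "\<lambda>p. - C p"]) (use \<gamma> in \<open>auto simp: M_def P\<^sub>1_def s2_def\<close>)
  define N where "N = (\<lambda>x. s2 x * trig_sum P\<^sub>2 (\<lambda>p. C p / (\<i> * \<nu>\<^sub>2 p)) \<nu>\<^sub>2 x)"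
  obtain r\<^sub>4 K\<^sub>4 where 4: "K\<^sub>4 \<ge> 0" "continuous_on {0<..} r\<^sub>4"
    "\<And>x. x > 0 \<Longrightarrow> (N has_vector_derivative s2 x * trig_sum P\<^sub>2 C \<nu>\<^sub>2 x + r\<^sub>4 x) (at x)"
    "\<And>x. x > 0 \<Longrightarrow> norm (N x) \<le> K\<^sub>4 * x powr - (2 * \<gamma>)"
    "\<And>x. x > 0 \<Longrightarrow> norm (r\<^sub>4 x) \<le> K\<^sub>4 * x powr (- (2 * \<gamma>) - 1)"
    by (rule oscillatory_antiderivative[of P\<^sub>2 \<nu>\<^sub>2 "2 * \<gamma>" C]) (use \<gamma> in \<open>auto simp: N_def P\<^sub>2_def s2_def\<close>)
  define K\<^sub>0 where "K\<^sub>0 = (\<Sum>i\<in>I. norm (cq i)) + (\<Sum>i\<in>I. norm (cb i))"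
  have K\<^sub>0: "norm (q x) \<le> K\<^sub>0 * x powr - \<gamma>" "norm (b x) \<le> K\<^sub>0 * x powr - \<gamma>" "K\<^sub>0 \<ge> 0" for x
  proof -
    have n: "(\<Sum>i\<in>I. norm (cq i)) \<ge> 0" "(\<Sum>i\<in>I. norm (cb i)) \<ge> 0" by (auto intro: sum_nonneg)
    then show "K\<^sub>0 \<ge> 0" by (simp add: K\<^sub>0_def)
    have "norm (trig_sum I cq \<omega> x) \<le> K\<^sub>0" "norm (trig_sum I cb \<omega>' x) \<le> K\<^sub>0"
      using trig_sum_norm[of I cq \<omega> x] trig_sum_norm[of I cb \<omega>' x] n by (auto simp: K\<^sub>0_def)
    from this[THEN mult_left_mono, of "x powr - \<gamma>"]
    show "norm (q x) \<le> K\<^sub>0 * x powr - \<gamma>" "norm (b x) \<le> K\<^sub>0 * x powr - \<gamma>"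
      by (simp_all add: q_def b_def s_def norm_mult mult.commute)
  qed
  define K where "K = K\<^sub>0 + K\<^sub>1 + K\<^sub>2 + K\<^sub>3 + K\<^sub>4"
  have K: "K \<ge> 0" "K\<^sub>0 \<le> K" "K\<^sub>1 \<le> K" "K\<^sub>2 \<le> K" "K\<^sub>3 \<le> K" "K\<^sub>4 \<le> K"
    using 1(1) 2(1) 3(1) 4(1) K\<^sub>0(3) by (auto simp: K_def)
  have weaken: "t \<le> K * x powr e'" if "t \<le> k * x powr e" "k \<le> K" "e \<le> e'" "x \<ge> X" for t k e e' x
  proof -
    have "k * x powr e \<le> K * x powr e'"
      using that X K(1) by (intro mult_mono powr_mono) auto
    then show ?thesis using that(1) by linarith
  qed
  have s_cont: "continuous_on {X..} s" unfolding s_def using X by (intro continuous_intros) auto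
  have sub: "{X..} \<subseteq> {0<..}" using X by auto
  obtain Y a \<phi> where Y: "Y \<ge> X"
    and a: "\<And>x. x > Y \<Longrightarrow> (a has_vector_derivative q x * a x + b x * cnj (a x)) (at x)"
    and a_lim: "((\<lambda>x. a x / (f x * cis \<phi>)) \<longlongrightarrow> 1) at_top"
  proof (rule averaged_decaying_solution[of X \<gamma> K f c q b r\<^sub>1 r\<^sub>2 r\<^sub>3 r\<^sub>4 Q B M N])
    show "X \<ge> 1" "1/3 < \<gamma>" "K \<ge> 0" by (fact X \<gamma>(1) K(1))+
    show "continuous_on {X..} q" "continuous_on {X..} b"
      unfolding q_def b_def by (intro continuous_intros continuous_on_trig_sum s_cont)+
    show "continuous_on {X..} r\<^sub>1" "continuous_on {X..} r\<^sub>2" "continuous_on {X..} r\<^sub>3" "continuous_on {X..} r\<^sub>4"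
      by (rule continuous_on_subset[OF _ sub]; fact)+
    fix x assume x: "x \<ge> X"
    then have x0: "x > 0" using X by simp
    show "f x > 0" "(f has_real_derivative - norm c * x powr (- 2 * \<gamma>) * f x) (at x)"
      using f x by (auto simp: norm_c)
    show "(Q has_vector_derivative q x + r\<^sub>1 x) (at x)" "(B has_vector_derivative b x + r\<^sub>2 x) (at x)"
      by (fact 1(3)[OF x0] 2(3)[OF x0])+
    show "(M has_vector_derivative - (Q x * q x + B x * cnj (b x)) + r\<^sub>3 x) (at x)"
      unfolding QqBb[OF x] using 3(3)[OF x0] by (simp add: trig_sum_minus[symmetric])
    show "(N has_vector_derivative - (Q x * b x + B x * cnj (q x)) -
       c * complex_of_real (x powr (- 2 * \<gamma>)) + r\<^sub>4 x) (at x)"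
      unfolding QbBq[OF x] using 4(3)[OF x0] by (simp add: s2_def)
    show "norm (q x) \<le> K * x powr - \<gamma> \<and> norm (b x) \<le> K * x powr - \<gamma> \<and>
               norm (Q x) \<le> K * x powr - \<gamma> \<and> norm (B x) \<le> K * x powr - \<gamma>"
      by (intro conjI weaken[OF K\<^sub>0(1) K(2) order_refl x] weaken[OF K\<^sub>0(2) K(2) order_refl x]
          weaken[OF 1(4)[OF x0] K(3) order_refl x] weaken[OF 2(4)[OF x0] K(4) order_refl x])
    show "norm (M x) \<le> K * x powr (- 2 * \<gamma>) \<and> norm (N x) \<le> K * x powr (- 2 * \<gamma>)"
      by (intro conjI weaken[OF 3(4)[OF x0] K(5) _ x] weaken[OF 4(4)[OF x0] K(6) _ x]) auto
    show "norm (r\<^sub>1 x) \<le> K * x powr (- 3 * \<gamma>) \<and> norm (r\<^sub>2 x) \<le> K * x powr (- 3 * \<gamma>) \<and>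
               norm (r\<^sub>3 x) \<le> K * x powr (- 3 * \<gamma>) \<and> norm (r\<^sub>4 x) \<le> K * x powr (- 3 * \<gamma>)"
      by (intro conjI weaken[OF 1(5)[OF x0] K(3) _ x] weaken[OF 2(5)[OF x0] K(4) _ x]
          weaken[OF 3(5)[OF x0] K(5) _ x] weaken[OF 4(5)[OF x0] K(6) _ x]) (use \<gamma> in auto)
  qed blast
  define w where "w = (\<lambda>x. cis (\<kappa> * x) * a x)"
  have w': "(w has_vector_derivative \<i> * \<kappa> * w x + of_real (W x / \<kappa> * Im (w x))) (at x)" if x: "x > Y" for x
  proof -
    have xX: "x \<ge> X" using x Y by simp
    have "((\<lambda>z. exp (\<i> * \<kappa> * z)) has_field_derivative \<i> * \<kappa> * exp (\<i> * \<kappa> * of_real x)) (at (of_real x))"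
      by (auto intro!: derivative_eq_intros)
    from has_vector_derivative_real_field[OF this]
    have "((\<lambda>x. cis (\<kappa> * x)) has_vector_derivative \<i> * \<kappa> * cis (\<kappa> * x)) (at x)"
      by (simp add: cis_conv_exp mult_ac)
    from has_vector_derivative_mult[OF this a[OF x]]
    have "(w has_vector_derivative cis (\<kappa> * x) * (q x * a x + b x * cnj (a x)) + \<i> * \<kappa> * cis (\<kappa> * x) * a x) (at x)"
      unfolding w_def .
    also have "cis (\<kappa> * x) * (q x * a x + b x * cnj (a x)) =
        - \<i> * \<beta> * W x * (w x - cis (\<kappa> * x) * cis (- (2 * \<kappa>) * x) * cnj (a x))"
      unfolding q_W[OF xX] b_W[OF xX] w_def by (simp add: algebra_simps)
    also have "cis (\<kappa> * x) * cis (- (2 * \<kappa>) * x) * cnj (a x) = cnj (w x)"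
      unfolding w_def by (simp add: cis_mult cis_cnj algebra_simps)
    also have "w x - cnj (w x) = 2 * \<i> * Im (w x)" by (simp add: complex_eq_iff)
    also have "- \<i> * \<beta> * W x * (2 * \<i> * Im (w x)) = of_real (W x / \<kappa> * Im (w x))"
      using \<kappa> by (simp add: \<beta>_def complex_eq_iff)
    also have "of_real (W x / \<kappa> * Im (w x)) + \<i> * \<kappa> * cis (\<kappa> * x) * a x
       = \<i> * \<kappa> * w x + of_real (W x / \<kappa> * Im (w x))" by (simp add: w_def)
    finally show ?thesis .
  qed
  have "(\<lambda>x. a x / (f x * cis \<phi>)) = (\<lambda>x. w x / (f x * cis (\<kappa> * x + \<phi>)))"
    unfolding w_def cis_mult[symmetric] by (auto simp: fun_eq_iff field_simps)
  with a_lim have "((\<lambda>x. w x / (f x * cis (\<kappa> * x + \<phi>))) \<longlongrightarrow> 1) at_top" by simp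
  with Y w' show ?thesis using that by blast
qed

section \<open>From integral equations to eigenfunctions\<close>

text \<open>
With the integrand split as in \<open>absolutely_integrable_truncation\<close>, the bounded part is controlled by
the total length of the intervals and the remainder by its integral over \<open>{a..b}\<close>.
\<close>

lemma indefinite_integral_abs_cont:
  fixes F g :: "real \<Rightarrow> real"
  assumes g: "g absolutely_integrable_on {a..b}"
    and F: "\<And>s t. a \<le> s \<Longrightarrow> s \<le> t \<Longrightarrow> t \<le> b \<Longrightarrow> F t - F s = integral {s..t} g"
  shows "abs_cont_on_interval F a b"
  unfolding abs_cont_on_interval_def
proof (intro allI impI)
  fix e :: real assume e: "e > 0"
  obtain N where N: "N \<ge> 0" "(\<lambda>x. max (\<bar>g x\<bar> - N) 0) absolutely_integrable_on {a..b}"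
    "integral {a..b} (\<lambda>x. max (\<bar>g x\<bar> - N) 0) < e / 2"
    by (rule absolutely_integrable_truncation[OF g, of "e / 2"]) (use e in \<open>simp, blast\<close>)
  define h where "h = (\<lambda>x. max (\<bar>g x\<bar> - N) 0)"
  define d where "d = e / (2 * (N + 1))"
  have d: "d > 0" "N * d \<le> e / 2" using e N by (simp_all add: d_def field_simps)
  have h: "h integrable_on {a..b}" "integral {a..b} h < e / 2"
    using N(2,3) set_lebesgue_integral_eq_integral(1) unfolding h_def by blast+
  show "\<exists>d>0. \<forall>(n::nat) s t. (\<forall>i<n. a \<le> s i \<and> s i \<le> t i \<and> t i \<le> b) \<longrightarrow>
        disjoint_family_on (\<lambda>i. {s i<..<t i}) {..<n} \<longrightarrow>
        (\<Sum>i<n. t i - s i) < d \<longrightarrow> (\<Sum>i<n. norm (F (t i) - F (s i))) < e"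
  proof (rule exI[of _ d], intro conjI allI impI d(1))
    fix n :: nat and s t :: "nat \<Rightarrow> real"
    assume st: "\<forall>i<n. a \<le> s i \<and> s i \<le> t i \<and> t i \<le> b"
      and disj: "disjoint_family_on (\<lambda>i. {s i<..<t i}) {..<n}" and small: "(\<Sum>i<n. t i - s i) < d"
    have hi: "h integrable_on {s i..t i}" if "i < n" for i
      using integrable_subinterval_real[OF h(1)] st that by auto
    have "norm (F (t i) - F (s i)) \<le> N * (t i - s i) + integral {s i..t i} h" if i: "i < n" for i
    proof -
      have sti: "a \<le> s i" "s i \<le> t i" "t i \<le> b" using st i by auto
      have gi: "g integrable_on {s i..t i}"
        using integrable_subinterval_real[of g a b] g sti set_lebesgue_integral_eq_integral(1) by auto
      have "norm (integral {s i..t i} g) \<le> integral {s i..t i} (\<lambda>x. N + h x)"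
        by (rule integral_norm_bound_integral[OF gi])
           (use hi[OF i] in \<open>auto intro!: integrable_add simp: h_def\<close>)
      also have "\<dots> = N * (t i - s i) + integral {s i..t i} h"
        using hi[OF i] sti by (subst Henstock_Kurzweil_Integration.integral_add) auto
      finally show ?thesis using F[OF sti] by simp
    qed
    then have "(\<Sum>i<n. norm (F (t i) - F (s i))) \<le> (\<Sum>i<n. N * (t i - s i) + integral {s i..t i} h)"
      by (intro sum_mono) auto
    also have "\<dots> = N * (\<Sum>i<n. t i - s i) + (\<Sum>i<n. integral {s i..t i} h)"
      by (simp add: sum.distrib sum_distrib_left)
    also have "(\<Sum>i<n. integral {s i..t i} h) \<le> integral {a..b} h"
    proof -
      have "(h has_integral (\<Sum>i<n. integral {s i..t i} h)) (\<Union>i<n. {s i<..<t i})"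
      proof (rule has_integral_UN)
        show "(h has_integral integral {s i..t i} h) {s i<..<t i}" if "i \<in> {..<n}" for i
          using hi[of i] that by (auto simp flip: has_integral_Icc_iff_Ioo)
        show "pairwise (\<lambda>i i'. negligible ({s i<..<t i} \<inter> {s i'<..<t i'})) {..<n}"
          using disj by (auto simp: pairwise_def disjoint_family_on_def)
      qed auto
      then show ?thesis
      proof (rule has_integral_subset_le[rotated 1])
        show "(\<Union>i<n. {s i<..<t i}) \<subseteq> {a..b}" using st by fastforce
        show "(h has_integral integral {a..b} h) {a..b}" using h by blast
      qed (auto simp: h_def)
    qed
    also have "N * (\<Sum>i<n. t i - s i) + integral {a..b} h < N * d + e / 2"
      using small N(1) h(2) by (intro add_le_less_mono mult_left_mono) auto
    also have "\<dots> \<le> e" using d by simp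
    finally show "(\<Sum>i<n. norm (F (t i) - F (s i))) < e" by simp
  qed
qed

lemma D_half_eqI: "(u has_vector_derivative d) (at x within {0..}) \<Longrightarrow> x \<ge> 0 \<Longrightarrow> D_half u x = d"
  unfolding D_half_def
proof (rule vector_derivative_within)
  have "x islimpt {x..x+1}" by (simp add: islimpt_Icc)
  moreover assume "x \<ge> 0"
  ultimately have "x islimpt {0..}" by (elim islimpt_subset) auto
  then show "at x within {0..} \<noteq> bot" by (simp add: trivial_limit_within)
qed

text \<open>
The pair \<open>(u, v)\<close> is \<open>(u, u')\<close>. The last conclusion is needed when \<open>u\<close> is regarded as a complex-valued
function: \<open>D_half\<close> commutes with the embedding of the reals only at points of differentiability.
\<close>

lemma schroedinger_solution_of_integral_equations:
  fixes u v V :: "real \<Rightarrow> real"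
  assumes V: "\<And>b. V absolutely_integrable_on {0..b}"
    and cont: "continuous_on {0..} u" "continuous_on {0..} v"
    and u: "\<And>x. x \<ge> 0 \<Longrightarrow> u x = u\<^sub>0 + integral {0..x} v"
    and v: "\<And>x. x \<ge> 0 \<Longrightarrow> v x = v\<^sub>0 + integral {0..x} (\<lambda>t. (V t - E) * u t)"
  shows "schroedinger_solution V E u" "\<And>x. x \<ge> 0 \<Longrightarrow> (u has_vector_derivative v x) (at x within {0..})"
    "\<And>x. x \<ge> 0 \<Longrightarrow> D_half u x = v x"
    "AE x in lebesgue_on {0<..}. D_half u differentiable (at x within {0..})"
proof -
  have cont': "continuous_on {0..b} u" "continuous_on {0..b} v" for b
    using cont by (auto elim: continuous_on_subset)
  have v_int: "v absolutely_integrable_on {0..b}" for b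
    using absolutely_integrable_continuous_real[OF cont'(2)] .
  have Vu: "(\<lambda>t. (V t - E) * u t) absolutely_integrable_on {0..b}" for b
  proof -
    have "bounded (u ` {0..b})" using compact_continuous_image[OF cont'(1)] compact_imp_bounded by blast
    moreover have "(\<lambda>t. V t - E) absolutely_integrable_on {0..b}"
      using V[of b] by (intro set_integral_diff) auto
    ultimately show ?thesis
      using absolutely_integrable_bounded_measurable_product_real[of u "{0..b}" "\<lambda>t. V t - E"]
        continuous_imp_measurable_on_sets_lebesgue[OF cont'(1)[of b]]
      by (auto simp: mult.commute)
  qed
  have diff: "F t - F s = integral {s..t} g"
    if "\<And>x. x \<ge> 0 \<Longrightarrow> F x = F\<^sub>0 + integral {0..x} g" "\<And>b. g absolutely_integrable_on {0..b}" "0 \<le> s" "s \<le> t"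
    for F g :: "real \<Rightarrow> real" and F\<^sub>0 s t
  proof -
    have "integral {0..s} g + integral {s..t} g = integral {0..t} g"
      by (rule Henstock_Kurzweil_Integration.integral_combine)
         (use that set_lebesgue_integral_eq_integral(1) in auto)
    then show ?thesis using that(1)[of t] that(1)[of s] that(3,4) by simp
  qed
  show u': "(u has_vector_derivative v x) (at x within {0..})" if x: "x \<ge> 0" for x
  proof -
    have "((\<lambda>t. integral {0..t} v) has_real_derivative v x) (at x within {0..x+1})"
      using cont'(2) x by (intro integral_has_real_derivative) auto
    moreover have "at x within {0..x+1} = at x within {0..}"
      by (rule at_within_nhd[of x "{..<x+1}"]) auto
    ultimately have "((\<lambda>t. u\<^sub>0 + integral {0..t} v) has_real_derivative v x) (at x within {0..})"
      by (auto intro!: derivative_eq_intros)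
    then have "((\<lambda>t. u\<^sub>0 + integral {0..t} v) has_vector_derivative v x) (at x within {0..})"
      by (simp add: has_real_derivative_iff_has_vector_derivative)
    then show ?thesis
      by (rule has_vector_derivative_transform[rotated 2]) (use x u in auto)
  qed
  show Du: "D_half u x = v x" if "x \<ge> 0" for x
    using D_half_eqI[OF u'[OF that] that] .
  have AC_u: "AC_loc u"
    unfolding AC_loc_def by (auto intro!: indefinite_integral_abs_cont[OF v_int] diff[OF u v_int])
  have "D_half u x = v\<^sub>0 + integral {0..x} (\<lambda>t. (V t - E) * u t)" if "x \<ge> 0" for x
    using Du[OF that] v[OF that] by simp
  then have "AC_loc (D_half u)"
    unfolding AC_loc_def by (auto intro!: indefinite_integral_abs_cont[OF Vu] diff[OF _ Vu])
  then have AC2: "AC_loc2 u"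
    unfolding AC_loc2_def using u' AC_u by (auto intro: differentiableI_vector)
  define N where "N = (\<lambda>b. {x\<in>{0<..<b}. \<not> ((\<lambda>t. integral {0..t} (\<lambda>t. (V t - E) * u t)) has_real_derivative (V x - E) * u x) (at x)})"
  have N: "negligible (\<Union>n::nat. N (real n))"
  proof (rule negligible_countable_Union)
    show "negligible S" if "S \<in> range (\<lambda>n::nat. N (real n))" for S
    proof -
      obtain n :: nat where "S = N (real n)" using \<open>S \<in> _\<close> by blast
      moreover have "(\<lambda>t. (V t - E) * u t) integrable_on {0..real n}"
        using Vu set_lebesgue_integral_eq_integral(1) by blast
      ultimately show ?thesis 
        using indefinite_integral_has_derivative_ae[of "\<lambda>t. (V t - E) * u t" 0 "real n"] by (simp only: N_def)
    qed
  qed auto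
  have eq: "schroedinger V u x = E *\<^sub>R u x" "D_half u differentiable (at x within {0..})" if x: "x > 0" "x \<notin> (\<Union>n::nat. N (real n))" for x
  proof -
    obtain n :: nat where "x < real n" using reals_Archimedean2 by blast
    then have "((\<lambda>t. integral {0..t} (\<lambda>t. (V t - E) * u t)) has_real_derivative (V x - E) * u x) (at x)"
      using x by (auto simp: N_def)
    then have "((\<lambda>t. v\<^sub>0 + integral {0..t} (\<lambda>t. (V t - E) * u t)) has_real_derivative (V x - E) * u x) (at x within {0..})"
      by (auto intro!: derivative_eq_intros intro: has_field_derivative_at_within)
    then have "((\<lambda>t. v\<^sub>0 + integral {0..t} (\<lambda>t. (V t - E) * u t)) has_vector_derivative (V x - E) * u x) (at x within {0..})"
      by (simp add: has_real_derivative_iff_has_vector_derivative)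
    then have D2: "(D_half u has_vector_derivative (V x - E) * u x) (at x within {0..})"
      by (rule has_vector_derivative_transform[rotated 2]) (use x v Du in auto)
    then show "D_half u differentiable (at x within {0..})" by (rule differentiableI_vector)
    from D_half_eqI[OF D2] x have "D_half (D_half u) x = (V x - E) * u x" by simp
    then show "schroedinger V u x = E *\<^sub>R u x" by (simp add: schroedinger_def algebra_simps)
  qed
  have ae: "AE x in lebesgue. x \<notin> (\<Union>n::nat. N (real n))"
    using N by (intro AE_not_in) (simp add: negligible_iff_null_sets)
  show "AE x in lebesgue_on {0<..}. D_half u differentiable (at x within {0..})"
    using ae by (subst AE_restrict_space_iff) (auto elim!: eventually_mono dest: eq)
  have "AE x in lebesgue_on {0<..}. schroedinger V u x = E *\<^sub>R u x"
    using ae by (subst AE_restrict_space_iff) (auto elim!: eventually_mono dest: eq)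
  with AC2 show "schroedinger_solution V E u" by (simp add: schroedinger_solution_def)
qed

text \<open>
The angle is the argument of \<open>v\<^sub>0 + \<i> u\<^sub>0\<close>, reduced modulo \<open>pi\<close>, which changes the sign of both sides.
\<close>

lemma boundary_angle_exists:
  fixes u\<^sub>0 v\<^sub>0 :: real
  obtains \<theta> where "\<theta> \<in> {0..<pi}" "v\<^sub>0 * sin \<theta> = u\<^sub>0 * cos \<theta>"
proof -
  define z where "z = Complex v\<^sub>0 u\<^sub>0"
  define t where "t = Arg z"
  have "z = rcis (norm z) t" unfolding t_def by (simp add: rcis_cmod_Arg)
  then have uv: "v\<^sub>0 = norm z * cos t" "u\<^sub>0 = norm z * sin t"
    by (metis Re_rcis z_def complex.sel(1), metis Im_rcis z_def complex.sel(2))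
  have t: "- pi < t" "t \<le> pi" unfolding t_def using Arg_bounded by auto
  define \<theta> where "\<theta> = (if t < 0 then t + pi else if t = pi then 0 else t)"
  have "\<theta> \<in> {0..<pi}" using t by (auto simp: \<theta>_def)
  moreover have "v\<^sub>0 * sin \<theta> = u\<^sub>0 * cos \<theta>" using uv by (auto simp: \<theta>_def)
  ultimately show ?thesis using that by blast
qed

lemma D_half_complex_of_real:
  assumes "u differentiable (at x within {0..})" "x \<ge> 0"
  shows "((\<lambda>x. complex_of_real (u x)) has_vector_derivative of_real (D_half u x)) (at x within {0..})"
    "D_half (\<lambda>x. complex_of_real (u x)) x = of_real (D_half u x)"
proof -
  have "(u has_vector_derivative D_half u x) (at x within {0..})"
    using assms(1) unfolding D_half_def by (simp add: vector_derivative_works)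
  then show *: "((\<lambda>x. complex_of_real (u x)) has_vector_derivative of_real (D_half u x)) (at x within {0..})"
    by (intro has_vector_derivative_of_real) (simp add: has_real_derivative_iff_has_vector_derivative)
  show "D_half (\<lambda>x. complex_of_real (u x)) x = of_real (D_half u x)"
    by (rule D_half_eqI[OF * assms(2)])
qed

text \<open>
The eigenfunction is \<open>u\<close> itself, viewed as a complex function. Since \<open>schroedinger V u\<close> equals \<open>E u\<close>
almost everywhere, it is measurable and square integrable.
\<close>

lemma eigenvalue_of_square_integrable_solution:
  fixes u :: "real \<Rightarrow> real"
  assumes sol: "schroedinger_solution V E u"
    and sq: "integrable (lebesgue_on {0<..}) (\<lambda>x. (u x)\<^sup>2)"
    and nz: "x\<^sub>1 > 0" "u x\<^sub>1 \<noteq> 0"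
    and D2: "AE x in lebesgue_on {0<..}. D_half u differentiable (at x within {0..})"
  shows "\<exists>\<theta>\<in>{0..<pi}. H_eigenvalue V \<theta> E"
proof -
  define U where "U = (\<lambda>x. complex_of_real (u x))"
  have AC: "AC_loc u" "AC_loc (D_half u)" and diff: "\<And>x. x \<ge> 0 \<Longrightarrow> u differentiable (at x within {0..})"
    and ae: "AE x in lebesgue_on {0<..}. schroedinger V u x = E * u x"
    using sol by (auto simp: schroedinger_solution_def AC_loc2_def)
  have DU: "D_half U x = of_real (D_half u x)" if "x \<ge> 0" for x
    unfolding U_def by (rule D_half_complex_of_real(2)[OF diff[OF that] that])
  have AC_real: "AC_loc (\<lambda>x. complex_of_real (g x))" if "AC_loc g" for g
    using that unfolding AC_loc_def abs_cont_on_interval_def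
    by (simp add: norm_of_real flip: of_real_diff)
  \<comment> \<open>Absolute continuity on \<open>[0,\<infinity>)\<close> only depends on the values there.\<close>
  have AC_cong: "AC_loc g" if "AC_loc h" "\<And>x. x \<ge> 0 \<Longrightarrow> g x = h x" for g h :: "real \<Rightarrow> complex"
    unfolding AC_loc_def
  proof (intro allI impI)
    fix b :: real assume "b > 0"
    then have h: "abs_cont_on_interval h 0 b" using that(1) by (simp add: AC_loc_def)
    show "abs_cont_on_interval g 0 b"
      unfolding abs_cont_on_interval_def
    proof (intro allI impI)
      fix e :: real assume "e > 0"
      with h obtain d where d: "d > 0" "\<And>(n::nat) s t. (\<forall>i<n. 0 \<le> s i \<and> s i \<le> t i \<and> t i \<le> b) \<Longrightarrow>
        disjoint_family_on (\<lambda>i. {s i<..<t i}) {..<n} \<Longrightarrow> (\<Sum>i<n. t i - s i) < d \<Longrightarrow>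
        (\<Sum>i<n. norm (h (t i) - h (s i))) < e"
        unfolding abs_cont_on_interval_def by meson
      have "(\<Sum>i<n. norm (g (t i) - g (s i))) < e"
        if "\<forall>i<n. 0 \<le> s i \<and> s i \<le> t i \<and> t i \<le> b" "disjoint_family_on (\<lambda>i. {s i<..<t i}) {..<n}"
          "(\<Sum>i<n. t i - s i) < d" for n :: nat and s t
      proof -
        have "(\<Sum>i<n. norm (g (t i) - g (s i))) = (\<Sum>i<n. norm (h (t i) - h (s i)))"
          using that(1) \<open>\<And>x. x \<ge> 0 \<Longrightarrow> g x = h x\<close> by (intro sum.cong) (auto dest: order_trans)
        then show ?thesis using d(2)[OF that] by simp
      qed
      then show "\<exists>d>0. \<forall>(n::nat) s t. (\<forall>i<n. 0 \<le> s i \<and> s i \<le> t i \<and> t i \<le> b) \<longrightarrow>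
        disjoint_family_on (\<lambda>i. {s i<..<t i}) {..<n} \<longrightarrow>
        (\<Sum>i<n. t i - s i) < d \<longrightarrow> (\<Sum>i<n. norm (g (t i) - g (s i))) < e"
        using d(1) by blast
    qed
  qed
  have "AC_loc (D_half U)" by (rule AC_cong[OF AC_real[OF AC(2)] DU])
  then have AC2: "AC_loc2 U"
    unfolding AC_loc2_def using AC_real[OF AC(1)] D_half_complex_of_real(1)[OF diff]
    by (auto simp: U_def intro: differentiableI_vector)
  have aeU: "AE x in lebesgue_on {0<..}. schroedinger V U x = of_real E * U x"
  proof -
    have "AE x in lebesgue_on {0<..}. x > 0" by (rule AE_I2) (auto simp: space_restrict_space)
    with ae D2 show ?thesis
    proof eventually_elim
      case (elim x)
      have "(D_half U has_vector_derivative of_real (D_half (D_half u) x)) (at x within {0..})"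
        by (rule has_vector_derivative_transform[OF _ _ D_half_complex_of_real(1)[OF elim(2)]])
           (use elim(3) DU in auto)
      from D_half_eqI[OF this] elim(3) have "D_half (D_half U) x = of_real (D_half (D_half u) x)" by simp
      then have "schroedinger V U x = of_real (schroedinger V u x)"
        by (simp add: schroedinger_def U_def scaleR_conv_of_real)
      then show ?case using elim(1) by (simp add: U_def)
    qed
  qed
  have u_cont: "continuous_on {0..} u"
    by (auto simp: continuous_on_eq_continuous_within intro: differentiable_imp_continuous_within diff)
  have U_meas: "U \<in> borel_measurable (lebesgue_on {0<..})"
    unfolding U_def
    by (intro continuous_imp_measurable_on_sets_lebesgue continuous_intros continuous_on_subset[OF u_cont]) auto
  have U_L2: "U \<in> L2_half"
    using U_meas sq by (simp add: L2_half_def U_def)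
  have EU: "(\<lambda>x. of_real E * U x) \<in> L2_half"
    using U_meas sq by (auto simp: L2_half_def U_def norm_mult power_mult_distrib)
  have SU_meas: "schroedinger V U \<in> borel_measurable (lebesgue_on {0<..})"
  proof -
    have "(\<lambda>x. if x \<in> {0<..} then of_real E * U x else 0) \<in> borel_measurable lebesgue"
      using EU by (subst borel_measurable_if) (auto simp: L2_half_def)
    moreover have "AE x in lebesgue. (if x \<in> {0<..} then of_real E * U x else 0) = (if x \<in> {0<..} then schroedinger V U x else 0)"
      using aeU by (subst (asm) AE_restrict_space_iff) (auto elim!: eventually_mono)
    ultimately have "(\<lambda>x. if x \<in> {0<..} then schroedinger V U x else 0) \<in> borel_measurable lebesgue"
      by (rule borel_measurable_AE)
    then show ?thesis by (subst (asm) borel_measurable_if) auto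
  qed
  have SU_L2: "schroedinger V U \<in> L2_half"
  proof -
    have "integrable (lebesgue_on {0<..}) (\<lambda>x. (norm (schroedinger V U x))\<^sup>2) \<longleftrightarrow>
          integrable (lebesgue_on {0<..}) (\<lambda>x. (norm (of_real E * U x))\<^sup>2)"
      using aeU SU_meas U_meas by (intro integrable_cong_AE) auto
    then show ?thesis using EU SU_meas by (simp add: L2_half_def)
  qed
  obtain \<theta> where \<theta>: "\<theta> \<in> {0..<pi}" "D_half u 0 * sin \<theta> = u 0 * cos \<theta>"
    by (rule boundary_angle_exists)
  then have "U \<in> H_dom V \<theta>"
    using U_L2 AC2 SU_L2 by (simp add: H_dom_def DU) (simp add: U_def flip: of_real_mult)
  moreover have "\<not> (AE x in lebesgue_on {0<..}. U x = 0)"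
  proof
    assume "AE x in lebesgue_on {0<..}. U x = 0"
    then have "AE x in lebesgue. x \<notin> {x\<in>{0<..}. u x \<noteq> 0}"
      by (subst (asm) AE_restrict_space_iff) (auto elim!: eventually_mono simp: U_def)
    then have "negligible {x\<in>{0<..}. u x \<noteq> 0}"
      by (simp add: negligible_iff_null_sets completion.AE_iff_null_sets AE_iff_null_sets)
    moreover have "open {x\<in>{0<..}. u x \<noteq> 0}"
    proof -
      have "continuous_on {0<..} u" by (rule continuous_on_subset[OF u_cont]) auto
      then have "open ({0<..} \<inter> u -` (- {0}))" by (rule continuous_open_preimage) auto
      moreover have "{0<..} \<inter> u -` (- {0}) = {x\<in>{0<..}. u x \<noteq> 0}" by auto
      ultimately show ?thesis by simp
    qed
    ultimately show False using open_not_negligible nz by blast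
  qed
  ultimately show ?thesis using \<theta>(1) aeU by (auto simp: H_eigenvalue_def)
qed

section \<open>A polynomial that excludes integer relations\<close>

definition monomial_eval :: "(nat \<Rightarrow>\<^sub>0 nat) \<Rightarrow> (nat \<Rightarrow> real) \<Rightarrow> real" where
  "monomial_eval m a = (\<Prod>i\<in>Poly_Mapping.keys m. a i ^ Poly_Mapping.lookup m i)"

lemma monomial_eval_superset:
  assumes "finite S" "Poly_Mapping.keys m \<subseteq> S"
  shows "monomial_eval m a = (\<Prod>i\<in>S. a i ^ Poly_Mapping.lookup m i)"
  unfolding monomial_eval_def using assms
  by (intro prod.mono_neutral_left) (auto simp: in_keys_iff)

lemma monomial_eval_add: "monomial_eval (m + n) a = monomial_eval m a * monomial_eval n a"
proof -
  let ?S = "Poly_Mapping.keys m \<union> Poly_Mapping.keys n"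
  have "monomial_eval (m + n) a = (\<Prod>i\<in>?S. a i ^ Poly_Mapping.lookup (m + n) i)"
    by (rule monomial_eval_superset) (auto dest: set_mp[OF Poly_Mapping.keys_add])
  also have "\<dots> = monomial_eval m a * monomial_eval n a"
    by (simp add: monomial_eval_superset[of ?S] lookup_add power_add prod.distrib)
  finally show ?thesis .
qed

lemma mpoly_eval_superset:
  assumes "finite S" "Poly_Mapping.keys P \<subseteq> S"
  shows "mpoly_eval P a = (\<Sum>m\<in>S. Poly_Mapping.lookup P m * monomial_eval m a)"
  unfolding mpoly_eval_def monomial_eval_def[symmetric] using assms
  by (intro sum.mono_neutral_left) (auto simp: in_keys_iff)

lemma mpoly_eval_add: "mpoly_eval (P + Q) a = mpoly_eval P a + mpoly_eval Q a"
proof -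
  let ?S = "Poly_Mapping.keys P \<union> Poly_Mapping.keys Q"
  have "mpoly_eval (P + Q) a = (\<Sum>m\<in>?S. Poly_Mapping.lookup (P + Q) m * monomial_eval m a)"
    by (rule mpoly_eval_superset) (auto dest: set_mp[OF Poly_Mapping.keys_add])
  also have "\<dots> = mpoly_eval P a + mpoly_eval Q a"
    by (simp add: mpoly_eval_superset[of ?S] lookup_add sum.distrib distrib_right)
  finally show ?thesis .
qed

lemma mpoly_eval_zero: "mpoly_eval 0 a = 0"
  by (simp add: mpoly_eval_def)

lemma mpoly_eval_sum: "mpoly_eval (\<Sum>x\<in>S. f x) a = (\<Sum>x\<in>S. mpoly_eval (f x) a)"
  by (induction S rule: infinite_finite_induct) (auto simp: mpoly_eval_zero mpoly_eval_add)

lemma mpoly_eval_single: "mpoly_eval (Poly_Mapping.single m c) a = c * monomial_eval m a"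
  by (subst mpoly_eval_superset[of "{m}"]) (auto simp: lookup_single)

lemma mpoly_as_sum:
  fixes P :: mpolynomial
  shows "P = (\<Sum>m\<in>Poly_Mapping.keys P. Poly_Mapping.single m (Poly_Mapping.lookup P m))"
  by (rule poly_mapping_eqI) (auto simp: lookup_sum lookup_single when_def in_keys_iff)

lemma mpoly_eval_mult: "mpoly_eval (P * Q) a = mpoly_eval P a * mpoly_eval Q a"
proof -
  have "P * Q = (\<Sum>m\<in>Poly_Mapping.keys P. \<Sum>n\<in>Poly_Mapping.keys Q.
      Poly_Mapping.single (m + n) (Poly_Mapping.lookup P m * Poly_Mapping.lookup Q n))"
    by (subst mpoly_as_sum[of P], subst mpoly_as_sum[of Q]) (simp add: sum_product mult_single)
  then have "mpoly_eval (P * Q) a = (\<Sum>m\<in>Poly_Mapping.keys P. \<Sum>n\<in>Poly_Mapping.keys Q.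
      (Poly_Mapping.lookup P m * monomial_eval m a) * (Poly_Mapping.lookup Q n * monomial_eval n a))"
    by (simp add: mpoly_eval_sum mpoly_eval_single monomial_eval_add mult_ac)
  also have "\<dots> = mpoly_eval P a * mpoly_eval Q a"
    by (simp add: mpoly_eval_superset[OF finite_keys order_refl] sum_product)
  finally show ?thesis .
qed

lemma mpoly_vars_mult: "mpoly_vars (P * Q) \<subseteq> mpoly_vars P \<union> mpoly_vars Q"
proof
  fix i assume "i \<in> mpoly_vars (P * Q)"
  then obtain m where m: "m \<in> Poly_Mapping.keys (P * Q)" "i \<in> Poly_Mapping.keys m"
    by (auto simp: mpoly_vars_def)
  then obtain k l where "m = k + l" "k \<in> Poly_Mapping.keys P" "l \<in> Poly_Mapping.keys Q"
    using keys_mult[of P Q] by blast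
  then show "i \<in> mpoly_vars P \<union> mpoly_vars Q"
    using m(2) Poly_Mapping.keys_add[of k l] by (auto simp: mpoly_vars_def)
qed

definition linear_form :: "nat \<Rightarrow> (nat \<Rightarrow> real) \<Rightarrow> mpolynomial" where
  "linear_form K c = (\<Sum>k\<in>{1..K}. Poly_Mapping.single (Poly_Mapping.single k 1) (c k))"

lemma mpoly_eval_linear_form: "mpoly_eval (linear_form K c) a = (\<Sum>k=1..K. c k * a k)"
  by (simp add: linear_form_def mpoly_eval_sum mpoly_eval_single monomial_eval_def)

lemma mpoly_vars_linear_form: "mpoly_vars (linear_form K c) \<subseteq> {1..K}"
proof
  fix i assume "i \<in> mpoly_vars (linear_form K c)"
  then obtain m where m: "m \<in> Poly_Mapping.keys (linear_form K c)" "i \<in> Poly_Mapping.keys m"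
    by (auto simp: mpoly_vars_def)
  from m(1) obtain k where "k \<in> {1..K}" "m = Poly_Mapping.single k 1"
    unfolding linear_form_def by (auto dest!: set_mp[OF keys_sum] split: if_splits)
  then show "i \<in> {1..K}" using m(2) by simp
qed

text \<open>
The product of all linear forms with coefficients in \<open>D\<close>, the zero form excepted, is nonzero because
the polynomials form an integral domain.
\<close>

lemma polynomial_excluding_linear_relations:
  fixes D :: "real set"
  assumes "finite D"
  obtains P :: mpolynomial where "P \<noteq> 0" "mpoly_vars P \<subseteq> {1..K}"
    "\<And>\<alpha> c. mpoly_eval P \<alpha> \<noteq> 0 \<Longrightarrow> (\<And>k. k \<in> {1..K} \<Longrightarrow> c k \<in> D) \<Longrightarrow>
        (\<Sum>k=1..K. c k * \<alpha> k) = 0 \<Longrightarrow> (\<And>k. k \<in> {1..K} \<Longrightarrow> c k = 0)"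
proof -
  define CS where "CS = {c \<in> {1..K} \<rightarrow>\<^sub>E D. \<exists>k\<in>{1..K}. c k \<noteq> 0}"
  have fin: "finite CS" unfolding CS_def
    by (rule finite_subset[of _ "{1..K} \<rightarrow>\<^sub>E D"]) (use assms in \<open>auto intro: finite_PiE\<close>)
  define P where "P = (\<Prod>c\<in>CS. linear_form K c)"
  have eval_prod: "mpoly_eval (\<Prod>c\<in>S. linear_form K c) a = (\<Prod>c\<in>S. mpoly_eval (linear_form K c) a)"
    if "finite S" for S a
    using that
  proof (induction S rule: finite_induct)
    case empty
    show ?case using mpoly_eval_single[of 0 1 a] by (simp add: monomial_eval_def)
  qed (simp add: mpoly_eval_mult)
  have vars_prod: "mpoly_vars (\<Prod>c\<in>S. linear_form K c) \<subseteq> {1..K}" if "finite S" for S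
    using that
  proof (induction S rule: finite_induct)
    case empty
    show ?case by (simp add: mpoly_vars_def)
  next
    case (insert c S)
    then show ?case using mpoly_vars_mult mpoly_vars_linear_form by fastforce
  qed
  have "linear_form K c \<noteq> 0" if "c \<in> CS" for c
  proof
    assume zero: "linear_form K c = 0"
    obtain k where k: "k \<in> {1..K}" "c k \<noteq> 0" using \<open>c \<in> CS\<close> by (auto simp: CS_def)
    have "mpoly_eval (linear_form K c) (\<lambda>i. if i = k then 1 else 0) = c k"
      using k(1) by (simp add: mpoly_eval_linear_form if_distrib cong: if_cong)
    then show False using k zero by (simp add: mpoly_eval_zero)
  qed
  then have "P \<noteq> 0" unfolding P_def using fin by simp
  moreover have "mpoly_vars P \<subseteq> {1..K}" unfolding P_def by (rule vars_prod[OF fin])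
  moreover have "c k = 0" if "mpoly_eval P \<alpha> \<noteq> 0" "\<And>k. k \<in> {1..K} \<Longrightarrow> c k \<in> D"
    "(\<Sum>k=1..K. c k * \<alpha> k) = 0" "k \<in> {1..K}" for \<alpha> c k
  proof (rule ccontr)
    assume "c k \<noteq> 0"
    then have CS: "restrict c {1..K} \<in> CS" using that by (auto simp: CS_def)
    have "mpoly_eval (linear_form K (restrict c {1..K})) \<alpha> = (\<Sum>k=1..K. c k * \<alpha> k)"
      unfolding mpoly_eval_linear_form by (rule sum.cong) auto
    then have "mpoly_eval P \<alpha> = 0"
      unfolding P_def eval_prod[OF fin] using CS fin that(3) by (auto intro!: prod_zero)
    then show False using that(1) by simp
  qed
  ultimately show ?thesis using that by blast
qed

text \<open>
The bound 4 is what a difference of two sums of two signed variables requires, when all of them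
may coincide.
\<close>

definition no_small_relation :: "nat \<Rightarrow> (nat \<Rightarrow> real) \<Rightarrow> bool" where
  "no_small_relation K \<alpha> \<longleftrightarrow>
     (\<forall>c. (\<forall>k\<in>{1..K}. c k \<in> {-4,-3,-2,-1,0,1,2,3,4}) \<longrightarrow> (\<Sum>k=1..K. c k * \<alpha> k) = 0 \<longrightarrow>
          (\<forall>k\<in>{1..K}. c k = 0))"

text \<open>
An identity between signed sums of the \<open>\<alpha> j\<close> is a linear relation whose coefficient vector is a signed
sum of unit vectors \<open>e\<close>; it must vanish, and so the signed indices cancel formally. In the second part
\<open>\<epsilon>\<^sub>1 = - \<epsilon>\<^sub>2\<close>, \<open>j\<^sub>1 = j\<^sub>2\<close> is the cancellation excluded by the last premise.
\<close>

lemma signed_pair_sum_unique: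
  fixes \<alpha> :: "nat \<Rightarrow> real"
  assumes rel: "no_small_relation K \<alpha>"
    and j: "j\<^sub>1 \<in> {1..K}" "j\<^sub>2 \<in> {1..K}" and \<epsilon>: "\<epsilon>\<^sub>1 \<in> {1, -1}" "\<epsilon>\<^sub>2 \<in> {1, -1}"
  shows "\<epsilon>\<^sub>1 * \<alpha> j\<^sub>1 + \<epsilon>\<^sub>2 * \<alpha> j\<^sub>2 = 0 \<Longrightarrow> j\<^sub>1 = j\<^sub>2 \<and> \<epsilon>\<^sub>2 = - \<epsilon>\<^sub>1"
    "\<lbrakk>j\<^sub>3 \<in> {1..K}; j\<^sub>4 \<in> {1..K}; \<epsilon>\<^sub>3 \<in> {1, -1}; \<epsilon>\<^sub>4 \<in> {1, -1};
       \<epsilon>\<^sub>1 * \<alpha> j\<^sub>1 + \<epsilon>\<^sub>2 * \<alpha> j\<^sub>2 = \<epsilon>\<^sub>3 * \<alpha> j\<^sub>3 + \<epsilon>\<^sub>4 * \<alpha> j\<^sub>4; \<epsilon>\<^sub>1 * \<alpha> j\<^sub>1 + \<epsilon>\<^sub>2 * \<alpha> j\<^sub>2 \<noteq> 0\<rbrakk> \<Longrightarrow>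
     (\<epsilon>\<^sub>3, j\<^sub>3) = (\<epsilon>\<^sub>1, j\<^sub>1) \<and> (\<epsilon>\<^sub>4, j\<^sub>4) = (\<epsilon>\<^sub>2, j\<^sub>2) \<or> (\<epsilon>\<^sub>3, j\<^sub>3) = (\<epsilon>\<^sub>2, j\<^sub>2) \<and> (\<epsilon>\<^sub>4, j\<^sub>4) = (\<epsilon>\<^sub>1, j\<^sub>1)"
proof -
  have generic: "c k = 0" if "\<And>k. c k \<in> {-4,-3,-2,-1,0,1,2,3,4}" "(\<Sum>k=1..K. c k * \<alpha> k) = 0" "k \<in> {1..K}" for c k
    using rel that unfolding no_small_relation_def by blast
  define e where "e = (\<lambda>(\<epsilon>::real) (j::nat) k. if k = j then \<epsilon> else 0)"
  have e_sum: "(\<Sum>k=1..K. e \<epsilon> j k * \<alpha> k) = \<epsilon> * \<alpha> j" if "j \<in> {1..K}" for \<epsilon> j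
    using that by (simp add: e_def if_distrib[of "\<lambda>x. x * _"] cong: if_cong)
  have e_val: "e \<epsilon> j k \<in> {-1, 0, 1}" if "\<epsilon> \<in> {1, -1}" for \<epsilon> j k using that by (auto simp: e_def)
  show "\<epsilon>\<^sub>1 * \<alpha> j\<^sub>1 + \<epsilon>\<^sub>2 * \<alpha> j\<^sub>2 = 0 \<Longrightarrow> j\<^sub>1 = j\<^sub>2 \<and> \<epsilon>\<^sub>2 = - \<epsilon>\<^sub>1"
  proof -
    assume 0: "\<epsilon>\<^sub>1 * \<alpha> j\<^sub>1 + \<epsilon>\<^sub>2 * \<alpha> j\<^sub>2 = 0"
    have "e \<epsilon>\<^sub>1 j\<^sub>1 k + e \<epsilon>\<^sub>2 j\<^sub>2 k = 0" if "k \<in> {1..K}" for k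
    proof (rule generic[OF _ _ that])
      show "e \<epsilon>\<^sub>1 j\<^sub>1 k + e \<epsilon>\<^sub>2 j\<^sub>2 k \<in> {-4,-3,-2,-1,0,1,2,3,4}" for k
        using e_val[OF \<epsilon>(1), of j\<^sub>1 k] e_val[OF \<epsilon>(2), of j\<^sub>2 k] by auto
      show "(\<Sum>k=1..K. (e \<epsilon>\<^sub>1 j\<^sub>1 k + e \<epsilon>\<^sub>2 j\<^sub>2 k) * \<alpha> k) = 0"
        unfolding distrib_right sum.distrib e_sum[OF j(1)] e_sum[OF j(2)] by (rule 0)
    qed
    from this[OF j(1)] this[OF j(2)] show ?thesis using \<epsilon> by (auto simp: e_def split: if_splits)
  qed
  assume j': "j\<^sub>3 \<in> {1..K}" "j\<^sub>4 \<in> {1..K}" and \<epsilon>': "\<epsilon>\<^sub>3 \<in> {1, -1}" "\<epsilon>\<^sub>4 \<in> {1, -1}"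
    and eq: "\<epsilon>\<^sub>1 * \<alpha> j\<^sub>1 + \<epsilon>\<^sub>2 * \<alpha> j\<^sub>2 = \<epsilon>\<^sub>3 * \<alpha> j\<^sub>3 + \<epsilon>\<^sub>4 * \<alpha> j\<^sub>4" and nz: "\<epsilon>\<^sub>1 * \<alpha> j\<^sub>1 + \<epsilon>\<^sub>2 * \<alpha> j\<^sub>2 \<noteq> 0"
  have *: "e \<epsilon>\<^sub>1 j\<^sub>1 k + e \<epsilon>\<^sub>2 j\<^sub>2 k - e \<epsilon>\<^sub>3 j\<^sub>3 k - e \<epsilon>\<^sub>4 j\<^sub>4 k = 0" if "k \<in> {1..K}" for k
  proof (rule generic[OF _ _ that])
    show "e \<epsilon>\<^sub>1 j\<^sub>1 k + e \<epsilon>\<^sub>2 j\<^sub>2 k - e \<epsilon>\<^sub>3 j\<^sub>3 k - e \<epsilon>\<^sub>4 j\<^sub>4 k \<in> {-4,-3,-2,-1,0,1,2,3,4}" for k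
      using e_val[OF \<epsilon>(1), of j\<^sub>1 k] e_val[OF \<epsilon>(2), of j\<^sub>2 k]
        e_val[OF \<epsilon>'(1), of j\<^sub>3 k] e_val[OF \<epsilon>'(2), of j\<^sub>4 k] by auto
    show "(\<Sum>k=1..K. (e \<epsilon>\<^sub>1 j\<^sub>1 k + e \<epsilon>\<^sub>2 j\<^sub>2 k - e \<epsilon>\<^sub>3 j\<^sub>3 k - e \<epsilon>\<^sub>4 j\<^sub>4 k) * \<alpha> k) = 0"
      unfolding distrib_right left_diff_distrib sum.distrib sum_subtractf
        e_sum[OF j(1)] e_sum[OF j(2)] e_sum[OF j'(1)] e_sum[OF j'(2)] using eq by simp
  qed
  have "\<not> (j\<^sub>1 = j\<^sub>2 \<and> \<epsilon>\<^sub>2 = - \<epsilon>\<^sub>1)" using nz by auto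
  then show "(\<epsilon>\<^sub>3, j\<^sub>3) = (\<epsilon>\<^sub>1, j\<^sub>1) \<and> (\<epsilon>\<^sub>4, j\<^sub>4) = (\<epsilon>\<^sub>2, j\<^sub>2) \<or> (\<epsilon>\<^sub>3, j\<^sub>3) = (\<epsilon>\<^sub>2, j\<^sub>2) \<and> (\<epsilon>\<^sub>4, j\<^sub>4) = (\<epsilon>\<^sub>1, j\<^sub>1)"
    using *[OF j(1)] *[OF j(2)] *[OF j'(1)] *[OF j'(2)] \<epsilon> \<epsilon>'
    by (auto simp: e_def split: if_splits)
qed

section \<open>The decaying solution on the half-line\<close>

lemma decay_rate_pos: "x > 0 \<Longrightarrow> decay_rate C \<gamma> l x > 0"
  by (simp add: decay_rate_def)

lemma decay_rate_has_derivative: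
  assumes x: "x > 0" and \<gamma>: "\<gamma> \<le> 1/2"
  shows "(decay_rate C \<gamma> l has_real_derivative - (C * l) * x powr (- 2 * \<gamma>) * decay_rate C \<gamma> l x) (at x)"
proof (cases "\<gamma> = 1/2")
  case True
  have "((\<lambda>x. x powr (- C * l)) has_real_derivative - C * l * x powr (- C * l - 1)) (at x)"
    using x by (auto intro!: derivative_eq_intros)
  moreover have "- C * l * x powr (- C * l - 1) = - (C * l) * x powr (- 1) * x powr (- C * l)"
  proof -
    have "x powr (- C * l - 1) = x powr (- C * l) * x powr (- 1)"
      unfolding powr_add[symmetric] by simp
    then show ?thesis by (simp only: mult_ac mult_minus_left mult_minus_right)
  qed
  moreover have "decay_rate C \<gamma> l = (\<lambda>x. x powr (- C * l))" "- 2 * \<gamma> = - 1"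
    using True by (auto simp: decay_rate_def)
  ultimately show ?thesis by (simp only:)
next
  case False
  then have g: "1 - 2 * \<gamma> \<noteq> 0" by simp
  define k where "k = - (C / (1 - 2 * \<gamma>)) * l"
  have "((\<lambda>x. exp (k * x powr (1 - 2 * \<gamma>))) has_real_derivative
      exp (k * x powr (1 - 2 * \<gamma>)) * (k * ((1 - 2 * \<gamma>) * x powr (1 - 2 * \<gamma> - 1)))) (at x)"
    using x by (auto intro!: derivative_eq_intros)
  moreover have "k * ((1 - 2 * \<gamma>) * x powr (1 - 2 * \<gamma> - 1)) = - (C * l) * x powr (- 2 * \<gamma>)"
    using g by (simp add: k_def)
  ultimately show ?thesis using False by (simp add: decay_rate_def[abs_def] k_def mult_ac)
qed

text \<open>
For \<open>\<gamma> < 1/2\<close> the square is a stretched exponential, which is below every negative power of \<open>x\<close> since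
\<open>exp t \<ge> (t / n)\<^sup>n\<close>.
\<close>

lemma decay_rate_square_integrable:
  assumes Cl: "C * l > 0" and \<gamma>: "\<gamma> < 1/2 \<or> \<gamma> = 1/2 \<and> 2 * (C * l) > 1" and Z: "Z > 0"
  shows "(\<lambda>x. (decay_rate C \<gamma> l x)\<^sup>2) integrable_on {Z..}"
proof (cases "\<gamma> = 1/2")
  case True
  have eq: "(decay_rate C \<gamma> l x)\<^sup>2 = x powr (- 2 * (C * l))" for x
    using True by (simp add: decay_rate_def power2_eq_square flip: powr_add)
  have "- 2 * (C * l) < -1" using \<gamma> True by simp
  from has_integral_powr_to_inf[OF this Z] show ?thesis unfolding eq by blast
next
  case False
  then have g: "1 - 2 * \<gamma> > 0" using \<gamma> by auto
  define k where "k = 2 * (C / (1 - 2 * \<gamma>) * l)"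
  have k: "k > 0" using Cl g by (simp add: k_def field_simps)
  have eq: "(decay_rate C \<gamma> l x)\<^sup>2 = exp (- (k * x powr (1 - 2 * \<gamma>)))" for x
    using False by (simp add: decay_rate_def k_def exp_double[symmetric])
  obtain n :: nat where n: "real n * (1 - 2 * \<gamma>) > 2"
    using reals_Archimedean3[OF g] by blast
  have n0: "n > 0" using n by (cases n) auto
  have bound: "exp (- (k * x powr (1 - 2 * \<gamma>))) \<le> (n / k) ^ n * x powr (- (real n * (1 - 2 * \<gamma>)))" if x: "x \<ge> Z" for x
  proof -
    define t where "t = k * x powr (1 - 2 * \<gamma>)"
    have t: "t > 0" using k x Z by (simp add: t_def)
    have "t / n \<le> exp (t / n)" using exp_ge_add_one_self[of "t / n"] by linarith
    then have "(t / n) ^ n \<le> exp (t / n) ^ n" using t by (intro power_mono) auto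
    also have "\<dots> = exp t" using n0 by (simp flip: exp_of_nat_mult)
    finally have "exp (- t) \<le> inverse ((t / n) ^ n)"
      unfolding exp_minus using t n0 by (intro le_imp_inverse_le) auto
    also have "\<dots> = (n / t) ^ n" by (simp flip: power_inverse)
    also have "\<dots> = (n / k) ^ n * x powr (- (real n * (1 - 2 * \<gamma>)))"
    proof -
      have "x powr (real n * (1 - 2 * \<gamma>)) = (x powr (1 - 2 * \<gamma>)) ^ n"
        using powr_realpow[of "x powr (1 - 2 * \<gamma>)" n] x Z by (simp add: powr_powr mult.commute)
      then show ?thesis
        by (simp add: t_def power_divide power_mult_distrib powr_minus divide_inverse power_inverse)
    qed
    finally show ?thesis by (simp add: t_def)
  qed
  have "(\<lambda>x. (n / k) ^ n * x powr (- (real n * (1 - 2 * \<gamma>)))) integrable_on {Z..}"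
  proof -
    have "- (real n * (1 - 2 * \<gamma>)) < -1" using n by simp
    from has_integral_powr_to_inf[OF this Z] show ?thesis by (intro integrable_on_mult_right) blast
  qed
  then show ?thesis unfolding eq
    by (rule measurable_bounded_by_integrable_imp_integrable[rotated 1])
       (use bound Z in \<open>auto intro!: continuous_imp_measurable_on_sets_lebesgue continuous_intros\<close>)
qed

text \<open>
A solution \<open>w\<close> of the first order equation near infinity is continued to \<open>0\<close> by the terminal value
problem on \<open>{0..Y + 1}\<close>, where \<open>(V / \<kappa>) Im w\<close> is written with \<open>w\<close> and \<open>cnj w\<close>. The glued function
satisfies one integral equation on the whole half-line; its imaginary part is \<open>u\<close> and its real part is
\<open>u' / \<kappa>\<close>.
\<close>

lemma half_line_solution_of_tail:
  fixes V :: "real \<Rightarrow> real" and w :: "real \<Rightarrow> complex"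
  assumes V: "\<And>b. V absolutely_integrable_on {0..b}" and \<kappa>: "\<kappa> > 0" and Y: "Y \<ge> 0"
    and w: "\<And>x. x > Y \<Longrightarrow> (w has_vector_derivative \<i> * \<kappa> * w x + of_real (V x / \<kappa> * Im (w x))) (at x)"
  obtains u where "schroedinger_solution V (\<kappa>\<^sup>2) u"
    "AE x in lebesgue_on {0<..}. D_half u differentiable (at x within {0..})"
    "\<And>x. x > Y + 1 \<Longrightarrow> of_real (1 / \<kappa> * D_half u x) + \<i> * of_real (u x) = w x"
proof -
  define Z where "Z = Y + 1"
  have Z: "Z \<ge> 0" using Y by (simp add: Z_def)
  define r where "r = (\<lambda>t. \<i> * of_real (V t / (2 * \<kappa>)))"
  define p where "p = (\<lambda>t. \<i> * of_real (\<kappa> - V t / (2 * \<kappa>)))"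
  have pr: "p t * z + r t * cnj z = \<i> * \<kappa> * z + of_real (V t / \<kappa> * Im z)" for t z
    using \<kappa> by (simp add: p_def r_def complex_eq_iff field_simps)
  have of_real_abs: "(\<lambda>t. \<i> * complex_of_real (g t)) absolutely_integrable_on {0..b}"
    if "g absolutely_integrable_on {0..b}" for g b
    using that unfolding set_integrable_def
    by (intro absolutely_integrable_linear[OF that, of "\<lambda>t. \<i> * complex_of_real t", unfolded o_def set_integrable_def])
       (auto intro: bounded_linear_compose[OF bounded_linear_mult_right bounded_linear_of_real])
  have p: "p absolutely_integrable_on {0..b}" and r: "r absolutely_integrable_on {0..b}" for b
  proof -
    have Vk: "(\<lambda>t. V t / (2 * \<kappa>)) absolutely_integrable_on {0..b}"
      using V[of b] by (rule set_integrable_divide)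
    then show "r absolutely_integrable_on {0..b}" unfolding r_def by (rule of_real_abs)
    have "(\<lambda>t. \<kappa>) absolutely_integrable_on {0..b}" by (simp add: absolutely_integrable_on_const)
    from set_integral_diff(1)[OF this Vk]
    show "p absolutely_integrable_on {0..b}" unfolding p_def by (rule of_real_abs)
  qed
  obtain w\<^sub>0 where w\<^sub>0: "continuous_on {0..Z} w\<^sub>0"
    "\<And>x. x \<in> {0..Z} \<Longrightarrow> w\<^sub>0 x = w Z - integral {x..Z} (\<lambda>t. p t * w\<^sub>0 t + r t * cnj (w\<^sub>0 t))"
    using linear_terminal_value_problem[OF Z p r] by blast
  define W where "W = (\<lambda>x. if x \<le> Z then w\<^sub>0 x else w x)"
  define g where "g = (\<lambda>t. p t * W t + r t * cnj (W t))"
  have w\<^sub>0_Z: "w\<^sub>0 Z = w Z" using w\<^sub>0(2)[of Z] Z by simp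
  have w_cont: "continuous_on {Z..} w"
    using has_vector_derivative_continuous[OF w]
    by (intro continuous_at_imp_continuous_on) (auto simp: Z_def)
  have "continuous_on ({0..Z} \<union> {Z..}) W"
    unfolding W_def using w\<^sub>0_Z by (intro continuous_on_If w\<^sub>0(1) w_cont) auto
  moreover have "{0..Z} \<union> {Z..} = {0..}" using Z by auto
  ultimately have W_cont: "continuous_on {0..} W" by simp
  have g_abs: "g absolutely_integrable_on {0..b}" for b
    unfolding g_def
    by (intro real_linear_absolutely_integrable p r continuous_on_subset[OF W_cont]) auto
  then have g_int: "g integrable_on {0..b}" for b
    using set_lebesgue_integral_eq_integral(1) by blast
  have combine: "integral {0..s} g + integral {s..t} g = integral {0..t} g" if "0 \<le> s" "s \<le> t" for s t
    by (rule Henstock_Kurzweil_Integration.integral_combine[OF that g_int])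
  have W_left: "W x = w Z - integral {x..Z} g" if x: "x \<in> {0..Z}" for x
  proof -
    have "integral {x..Z} (\<lambda>t. p t * w\<^sub>0 t + r t * cnj (w\<^sub>0 t)) = integral {x..Z} g"
      by (rule Henstock_Kurzweil_Integration.integral_cong) (auto simp: g_def W_def)
    then show ?thesis using w\<^sub>0(2)[OF x] x by (simp add: W_def)
  qed
  have W_eq: "W x = W 0 + integral {0..x} g" if x: "x \<ge> 0" for x
  proof (cases "x \<le> Z")
    case True
    then have "W 0 = w Z - (integral {0..x} g + integral {x..Z} g)"
      using W_left[of 0] combine[of x Z] x Z by simp
    then show ?thesis using W_left[of x] x True by simp
  next
    case False
    have "(g has_integral (w x - w Z)) {Z..x}"
    proof (rule fundamental_theorem_of_calculus)
      fix t assume t: "t \<in> {Z..x}"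
      then have "W t = w t" using w\<^sub>0_Z by (auto simp: W_def)
      then have "(w has_vector_derivative g t) (at t)"
        using w[of t] t by (simp add: g_def pr Z_def)
      then show "(w has_vector_derivative g t) (at t within {Z..x})"
        by (rule has_vector_derivative_at_within)
    qed (use False in auto)
    then have "integral {Z..x} g = w x - w Z" by (rule integral_unique)
    then have "w x = w Z + integral {Z..x} g" by simp
    moreover have "w Z = W 0 + integral {0..Z} g" using W_left[of 0] Z by simp
    ultimately show ?thesis using combine[of Z x] Z False by (simp add: W_def add.assoc)
  qed
  define u where "u = (\<lambda>x. Im (W x))"
  define v where "v = (\<lambda>x. \<kappa> * Re (W x))"
  have Im_g: "Im (g t) = v t" and Re_g: "\<kappa> * Re (g t) = (V t - \<kappa>\<^sup>2) * u t" for t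
  proof -
    have "g t = \<i> * \<kappa> * W t + of_real (V t / \<kappa> * Im (W t))" by (simp only: g_def pr)
    then have "Im (g t) = \<kappa> * Re (W t)" "Re (g t) = - \<kappa> * Im (W t) + V t / \<kappa> * Im (W t)" by simp_all
    then show "Im (g t) = v t" "\<kappa> * Re (g t) = (V t - \<kappa>\<^sup>2) * u t"
      using \<kappa> by (simp_all add: u_def v_def field_simps power2_eq_square)
  qed
  have u: "u x = u 0 + integral {0..x} v" if "x \<ge> 0" for x
    using has_integral_Im[OF integrable_integral[OF g_int[of x]]] W_eq[OF that]
    by (simp add: Im_g u_def integral_unique)
  have v: "v x = v 0 + integral {0..x} (\<lambda>t. (V t - \<kappa>\<^sup>2) * u t)" if "x \<ge> 0" for x
    using has_integral_mult_right[OF has_integral_Re[OF integrable_integral[OF g_int[of x]]], of \<kappa>] W_eq[OF that]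
    by (simp add: Re_g v_def integral_unique distrib_left)
  have "continuous_on {0..} u" "continuous_on {0..} v"
    unfolding u_def v_def by (intro continuous_intros W_cont)+
  note sol = schroedinger_solution_of_integral_equations[OF V this u v]
  show ?thesis
  proof (rule that[OF sol(1) sol(4)])
    fix x assume x: "x > Y + 1"
    then have "D_half u x = v x" using sol(3)[of x] Y by simp
    then show "of_real (1 / \<kappa> * D_half u x) + \<i> * of_real (u x) = w x"
      using x \<kappa> by (simp add: v_def u_def W_def Z_def complex_eq_iff)
  qed auto
qed

text \<open>
The asymptotics bounds \<open>|u|\<close> by \<open>2 |f|\<close> near infinity, whence square integrability, and shows that
\<open>u\<close> and \<open>u'\<close> have no common zeros there, so that \<open>u\<close> does not vanish identically.
\<close>

lemma eigenvalue_of_decaying_solution: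
  fixes u f :: "real \<Rightarrow> real" and \<kappa> :: real
  assumes sol: "schroedinger_solution V E u"
    and D2: "AE x in lebesgue_on {0<..}. D_half u differentiable (at x within {0..})"
    and lim: "((\<lambda>x. (of_real (1 / \<kappa> * D_half u x) + \<i> * of_real (u x)) / (f x * cis (\<kappa> * x + \<phi>))) \<longlongrightarrow> 1) at_top"
    and f: "\<And>Z. Z > 0 \<Longrightarrow> (\<lambda>x. (f x)\<^sup>2) integrable_on {Z..}"
  shows "\<exists>\<theta>\<in>{0..<pi}. H_eigenvalue V \<theta> E"
proof -
  define w where "w = (\<lambda>x. complex_of_real (1 / \<kappa> * D_half u x) + \<i> * of_real (u x))"
  have u_diff: "\<And>x. x \<ge> 0 \<Longrightarrow> u differentiable (at x within {0..})"
    using sol by (auto simp: schroedinger_solution_def AC_loc2_def)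
  then have u_cont: "continuous_on {0..} u"
    by (auto simp: continuous_on_eq_continuous_within intro: differentiable_imp_continuous_within)
  have "((\<lambda>x. norm (w x / (f x * cis (\<kappa> * x + \<phi>)))) \<longlongrightarrow> norm (1::complex)) at_top"
    unfolding w_def by (rule tendsto_norm[OF lim])
  then have lim': "((\<lambda>x. norm (w x) / \<bar>f x\<bar>) \<longlongrightarrow> 1) at_top"
    by (simp add: norm_divide norm_mult)
  have "\<forall>\<^sub>F x in at_top. 0 < norm (w x) / \<bar>f x\<bar>" "\<forall>\<^sub>F x in at_top. norm (w x) / \<bar>f x\<bar> < 2"
    by (rule order_tendstoD[OF lim']; simp)+
  with eventually_gt_at_top[of "0::real"]
  have "\<forall>\<^sub>F x in at_top. x > 0 \<and> w x \<noteq> 0 \<and> norm (w x) \<le> 2 * \<bar>f x\<bar>"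
    by eventually_elim (auto simp: field_simps zero_less_divide_iff divide_less_eq split: if_splits)
  then obtain Z where Z: "\<And>x. x \<ge> Z \<Longrightarrow> x > 0 \<and> w x \<noteq> 0 \<and> norm (w x) \<le> 2 * \<bar>f x\<bar>"
    by (auto simp: eventually_at_top_linorder)
  have Z0: "Z > 0" using Z[of Z] by simp
  have "(\<lambda>x. (u x)\<^sup>2) absolutely_integrable_on {0..Z}"
    by (intro absolutely_integrable_continuous_real continuous_intros continuous_on_subset[OF u_cont]) auto
  moreover have "(\<lambda>x. (u x)\<^sup>2) absolutely_integrable_on {Z..}"
  proof (rule measurable_bounded_by_integrable_imp_absolutely_integrable)
    show "(\<lambda>x. 4 * (f x)\<^sup>2) integrable_on {Z..}" using f[OF Z0] by (intro integrable_on_mult_right)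
    show "(\<lambda>x. (u x)\<^sup>2) \<in> borel_measurable (lebesgue_on {Z..})"
      using Z0 by (intro continuous_imp_measurable_on_sets_lebesgue continuous_intros continuous_on_subset[OF u_cont]) auto
    fix x assume "x \<in> {Z..}"
    have "\<bar>u x\<bar> \<le> norm (w x)" using abs_Im_le_cmod[of "w x"] by (simp add: w_def)
    also have "\<dots> \<le> 2 * \<bar>f x\<bar>" using Z[of x] \<open>x \<in> {Z..}\<close> by simp
    finally have "\<bar>u x\<bar>\<^sup>2 \<le> (2 * \<bar>f x\<bar>)\<^sup>2" by (intro power_mono) auto
    then show "norm ((u x)\<^sup>2) \<le> 4 * (f x)\<^sup>2" by (simp add: power_mult_distrib)
  qed auto
  ultimately have "(\<lambda>x. (u x)\<^sup>2) absolutely_integrable_on ({0..Z} \<union> {Z..})"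
    by (rule absolutely_integrable_Un)
  then have "(\<lambda>x. (u x)\<^sup>2) absolutely_integrable_on {0<..}"
    by (rule set_integrable_subset) auto
  then have sq: "integrable (lebesgue_on {0<..}) (\<lambda>x. (u x)\<^sup>2)"
    by (rule absolutely_integrable_imp_integrable) auto
  have "\<exists>x>0. u x \<noteq> 0"
  proof (rule ccontr)
    assume "\<not> (\<exists>x>0. u x \<noteq> 0)"
    then have zero: "u x = 0" if "x > 0" for x using that by blast
    have "((\<lambda>x. 0::real) has_vector_derivative 0) (at Z within {0..})" by simp
    then have "(u has_vector_derivative 0) (at Z within {0..})"
      by (rule has_vector_derivative_transform_within[where d = Z]) (use zero Z0 in \<open>auto simp: dist_real_def\<close>)
    from D_half_eqI[OF this] Z0 have "D_half u Z = 0" by simp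
    then have "w Z = 0" using zero[OF Z0] by (simp add: w_def)
    then show False using Z[of Z] by simp
  qed
  then show ?thesis using eigenvalue_of_square_integrable_solution[OF sol sq _ _ D2] by blast
qed

section \<open>Potentials with generic phases\<close>

lemma signed_frequency_sum:
  fixes F :: "real \<times> nat \<Rightarrow> 'a::comm_monoid_add"
  shows "(\<Sum>i\<in>{1, -1} \<times> {1..K}. F i) = (\<Sum>k=1..K. F (1, k) + F (-1, k))"
proof -
  have "(\<Sum>i\<in>{1, -1} \<times> {1..K}. F i) = (\<Sum>\<epsilon>\<in>{1, -1}. \<Sum>k=1..K. F (\<epsilon>, k))"
    unfolding sum.cartesian_product by (rule sum.cong) auto
  also have "\<dots> = (\<Sum>k=1..K. F (1, k)) + (\<Sum>k=1..K. F (-1, k))" by simp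
  finally show ?thesis by (simp add: sum.distrib)
qed

lemma decaying_potential_integrable:
  assumes V: "decaying_potential K \<alpha> lam \<gamma> (\<lambda>_ _. 0) x\<^sub>0 V" and x\<^sub>0: "x\<^sub>0 > 0"
  shows "V absolutely_integrable_on {0..b}"
proof -
  have near: "V absolutely_integrable_on {0..x\<^sub>0}"
    using V unfolding decaying_potential_def absolutely_integrable_on_def
    by (simp add: integrable_on_open_interval_real)
  have "continuous_on {x\<^sub>0..c} (\<lambda>x. \<Sum>k=1..K. lam k * (1 / x powr \<gamma>) * cos (\<alpha> k * x + 0))" for c
    using x\<^sub>0 by (intro continuous_intros) auto
  then have "continuous_on {x\<^sub>0..c} V" for c
    by (rule continuous_on_eq) (use V in \<open>auto simp: decaying_potential_def\<close>)
  then have far: "V absolutely_integrable_on {x\<^sub>0..c}" for c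
    by (rule absolutely_integrable_continuous_real)
  have "V absolutely_integrable_on {0..max b x\<^sub>0}"
    by (rule absolutely_integrable_on_combine[OF near far]) (use x\<^sub>0 in auto)
  then show ?thesis by (rule set_integrable_subset) auto
qed

text \<open>
Here the resonant pairs are identified. Writing each cosine as two exponentials indexes the frequencies
by \<open>(\<epsilon>, k)\<close> with \<open>\<epsilon> = \<plusminus>1\<close>. A pair with frequency sum \<open>0\<close> consists of \<open>(\<epsilon>, k)\<close> and \<open>(- \<epsilon>, k)\<close>; the two
orders together contribute \<open>4 \<kappa> \<lambda>\<^sub>k\<^sup>2 / (4 E - \<alpha>\<^sub>k\<^sup>2)\<close> to the drift. The pairs with sum \<open>2 \<kappa>\<close> are the
given one and its transpose, which coincide if \<open>j\<^sub>1 = j\<^sub>2\<close>; hence the two cases in \<open>C\<close>.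
\<close>

lemma oscillating_potential_decaying_solution:
  fixes \<alpha> lam :: "nat \<Rightarrow> real"
  assumes E: "E > 0" and \<gamma>: "1/3 < \<gamma>" "\<gamma> \<le> 1/2"
    and generic: "no_small_relation K \<alpha>"
    and nonres: "\<And>k. k \<in> {1..K} \<Longrightarrow> (\<alpha> k)\<^sup>2 \<noteq> 4 * E"
    and j: "j\<^sub>1 \<in> {1..K}" "j\<^sub>2 \<in> {1..K}" and \<epsilon>: "\<epsilon>\<^sub>1 \<in> {1, -1}" "\<epsilon>\<^sub>2 \<in> {1, -1}"
    and res: "2 * sqrt E = \<epsilon>\<^sub>1 * \<alpha> j\<^sub>1 + \<epsilon>\<^sub>2 * \<alpha> j\<^sub>2"
    and lam: "\<And>k. k \<in> {1..K} \<Longrightarrow> lam k > 0"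
    and no_drift: "(\<Sum>k=1..K. (lam k)\<^sup>2 / (4 * E - (\<alpha> k)\<^sup>2)) = 0"
    and C: "C = (if j\<^sub>1 = j\<^sub>2 then 1 else 2) / (8 * sqrt E * \<bar>\<alpha> j\<^sub>1 * \<alpha> j\<^sub>2\<bar>)"
    and x\<^sub>0: "x\<^sub>0 > 0" and V: "decaying_potential K \<alpha> lam \<gamma> (\<lambda>_ _. 0) x\<^sub>0 V"
  obtains u \<phi> where "schroedinger_solution V E u"
    "AE x in lebesgue_on {0<..}. D_half u differentiable (at x within {0..})"
    "((\<lambda>x. (of_real (1 / sqrt E * D_half u x) + \<i> * of_real (u x)) /
        (decay_rate C \<gamma> (lam j\<^sub>1 * lam j\<^sub>2) x * cis (sqrt E * x + \<phi>))) \<longlongrightarrow> 1) at_top"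
proof -
  define \<kappa> where "\<kappa> = sqrt E"
  have \<kappa>: "\<kappa> > 0" "E = \<kappa>\<^sup>2" using E by (simp_all add: \<kappa>_def)
  define I where "I = {1, -1::real} \<times> {1..K}"
  define \<omega> where "\<omega> = (\<lambda>(\<epsilon>, k). \<epsilon> * \<alpha> k)"
  define \<mu> where "\<mu> = (\<lambda>(\<epsilon>::real, k). lam k)"
  define X where "X = max x\<^sub>0 1"
  define f where "f = decay_rate C \<gamma> (lam j\<^sub>1 * lam j\<^sub>2)"
  have X: "X \<ge> 1" "X \<ge> x\<^sub>0" by (simp_all add: X_def)
  have fin: "finite I" by (simp add: I_def)
  have \<alpha>_nz: "\<alpha> k \<noteq> 0" if "k \<in> {1..K}" for k
    using signed_pair_sum_unique(1)[OF generic that that, of 1 1] by auto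
  have \<omega>1: "\<omega> i \<noteq> 0" if "i \<in> I" for i
    using that \<alpha>_nz by (auto simp: I_def \<omega>_def)
  have \<omega>2: "\<omega> i \<noteq> 2 * \<kappa>" if "i \<in> I" for i
  proof
    assume eq: "\<omega> i = 2 * \<kappa>"
    obtain \<epsilon> k where i: "i = (\<epsilon>, k)" "\<epsilon> \<in> {1, -1}" "k \<in> {1..K}" using \<open>i \<in> I\<close> by (auto simp: I_def)
    have "(\<alpha> k)\<^sup>2 = (\<omega> i)\<^sup>2" using i(2) by (auto simp: i(1) \<omega>_def)
    also have "\<dots> = 4 * E" unfolding eq \<kappa>(2) by (simp add: power2_eq_square)
    finally show False using nonres[OF i(3)] by simp
  qed
  have W: "of_real (V x) = of_real (x powr - \<gamma>) * trig_sum I (\<lambda>i. of_real (\<mu> i / 2)) \<omega> x" if x: "x \<ge> X" for x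
  proof -
    have "V x = (\<Sum>k=1..K. x powr - \<gamma> * (lam k * cos (\<alpha> k * x)))"
      using V x X by (simp add: decaying_potential_def powr_minus divide_inverse mult_ac)
    also have "complex_of_real \<dots> = (\<Sum>k=1..K. of_real (x powr - \<gamma>) * (of_real (lam k / 2) * cis (\<alpha> k * x) + of_real (lam k / 2) * cis (- \<alpha> k * x)))"
      unfolding of_real_sum by (intro sum.cong) (auto simp: complex_eq_iff)
    also have "\<dots> = of_real (x powr - \<gamma>) * trig_sum I (\<lambda>i. of_real (\<mu> i / 2)) \<omega> x"
      unfolding trig_sum_def I_def signed_frequency_sum by (simp add: \<mu>_def \<omega>_def sum_distrib_left)
    finally show ?thesis .
  qed
  have drift_set: "{(i, j). i \<in> I \<and> j \<in> I \<and> \<omega> i + \<omega> j = 0} = (\<lambda>(\<epsilon>, k). ((\<epsilon>, k), (- \<epsilon>, k))) ` I"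
  proof (intro equalityI subsetI)
    fix p assume "p \<in> {(i, j). i \<in> I \<and> j \<in> I \<and> \<omega> i + \<omega> j = 0}"
    then obtain \<epsilon> k \<epsilon>' k' where p: "p = ((\<epsilon>, k), (\<epsilon>', k'))" "\<epsilon> \<in> {1, -1}" "\<epsilon>' \<in> {1, -1}"
      "k \<in> {1..K}" "k' \<in> {1..K}" "\<epsilon> * \<alpha> k + \<epsilon>' * \<alpha> k' = 0"
      by (auto simp: I_def \<omega>_def)
    then have "k = k' \<and> \<epsilon>' = - \<epsilon>"
      by (intro signed_pair_sum_unique(1)[OF generic]) auto
    then show "p \<in> (\<lambda>(\<epsilon>, k). ((\<epsilon>, k), (- \<epsilon>, k))) ` I"
      using p by (auto simp: I_def image_iff)
  qed (auto simp: I_def \<omega>_def)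
  have drift: "(\<Sum>(i, j)\<in>{(i, j). i \<in> I \<and> j \<in> I \<and> \<omega> i + \<omega> j = 0}.
                      \<mu> i * \<mu> j * (1 / \<omega> i - 1 / (\<omega> i - 2 * \<kappa>))) = 0"
  proof -
    have inj: "inj_on (\<lambda>(\<epsilon>, k). ((\<epsilon>, k), (- \<epsilon>, k))) I" by (auto simp: inj_on_def)
    have summand: "lam k * lam k * (1 / \<alpha> k - 1 / (\<alpha> k - 2 * \<kappa>)) + lam k * lam k * (- (1 / \<alpha> k) - 1 / (- \<alpha> k - 2 * \<kappa>))
       = 4 * \<kappa> * ((lam k)\<^sup>2 / (4 * E - (\<alpha> k)\<^sup>2))" if k: "k \<in> {1..K}" for k
    proof -
      have nz: "\<alpha> k - 2 * \<kappa> \<noteq> 0" "- \<alpha> k - 2 * \<kappa> \<noteq> 0"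
        using \<omega>2[of "(1, k)"] \<omega>2[of "(-1, k)"] k by (auto simp: I_def \<omega>_def)
      have den: "4 * E - (\<alpha> k)\<^sup>2 = (\<alpha> k - 2 * \<kappa>) * (- \<alpha> k - 2 * \<kappa>)"
        unfolding \<kappa>(2) by (simp add: power2_eq_square algebra_simps)
      have bracket: "1 / \<alpha> k - 1 / (\<alpha> k - 2 * \<kappa>) + (- (1 / \<alpha> k) - 1 / (- \<alpha> k - 2 * \<kappa>))
          = 4 * \<kappa> / ((\<alpha> k - 2 * \<kappa>) * (- \<alpha> k - 2 * \<kappa>))"
      proof -
        have "- 1 / (\<alpha> k - 2 * \<kappa>) - 1 / (- \<alpha> k - 2 * \<kappa>) = 4 * \<kappa> / ((\<alpha> k - 2 * \<kappa>) * (- \<alpha> k - 2 * \<kappa>))"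
          using nz by (subst diff_frac_eq) auto
        then show ?thesis by simp
      qed
      show ?thesis
        unfolding distrib_left[symmetric] bracket den by (simp add: power2_eq_square)
    qed
    have "(\<Sum>k=1..K. lam k * lam k * (1 / \<alpha> k - 1 / (\<alpha> k - 2 * \<kappa>)) + lam k * lam k * (- (1 / \<alpha> k) - 1 / (- \<alpha> k - 2 * \<kappa>)))
       = 4 * \<kappa> * (\<Sum>k=1..K. (lam k)\<^sup>2 / (4 * E - (\<alpha> k)\<^sup>2))"
      unfolding sum_distrib_left by (intro sum.cong refl summand)
    then have total: "(\<Sum>k=1..K. lam k * lam k * (1 / \<alpha> k - 1 / (\<alpha> k - 2 * \<kappa>)) + lam k * lam k * (- (1 / \<alpha> k) - 1 / (- \<alpha> k - 2 * \<kappa>))) = 0"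
      unfolding no_drift by simp
    show ?thesis
      unfolding drift_set sum.reindex[OF inj] o_def
      unfolding I_def signed_frequency_sum
      using total by (simp add: \<mu>_def \<omega>_def)
  qed
  have res_set: "{(i, j). i \<in> I \<and> j \<in> I \<and> \<omega> i + \<omega> j = 2 * \<kappa>}
      = {((\<epsilon>\<^sub>1, j\<^sub>1), (\<epsilon>\<^sub>2, j\<^sub>2)), ((\<epsilon>\<^sub>2, j\<^sub>2), (\<epsilon>\<^sub>1, j\<^sub>1))}" (is "?L = ?R")
  proof (intro equalityI subsetI)
    fix p assume "p \<in> ?L"
    then obtain \<epsilon>\<^sub>3 j\<^sub>3 \<epsilon>\<^sub>4 j\<^sub>4 where p: "p = ((\<epsilon>\<^sub>3, j\<^sub>3), (\<epsilon>\<^sub>4, j\<^sub>4))" "\<epsilon>\<^sub>3 \<in> {1, -1}" "\<epsilon>\<^sub>4 \<in> {1, -1}"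
      "j\<^sub>3 \<in> {1..K}" "j\<^sub>4 \<in> {1..K}" "\<epsilon>\<^sub>3 * \<alpha> j\<^sub>3 + \<epsilon>\<^sub>4 * \<alpha> j\<^sub>4 = 2 * \<kappa>"
      by (auto simp: I_def \<omega>_def)
    have "(\<epsilon>\<^sub>3, j\<^sub>3) = (\<epsilon>\<^sub>1, j\<^sub>1) \<and> (\<epsilon>\<^sub>4, j\<^sub>4) = (\<epsilon>\<^sub>2, j\<^sub>2) \<or> (\<epsilon>\<^sub>3, j\<^sub>3) = (\<epsilon>\<^sub>2, j\<^sub>2) \<and> (\<epsilon>\<^sub>4, j\<^sub>4) = (\<epsilon>\<^sub>1, j\<^sub>1)"
    proof (rule signed_pair_sum_unique(2)[OF generic j \<epsilon> p(4,5,2,3)])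
      show "\<epsilon>\<^sub>1 * \<alpha> j\<^sub>1 + \<epsilon>\<^sub>2 * \<alpha> j\<^sub>2 = \<epsilon>\<^sub>3 * \<alpha> j\<^sub>3 + \<epsilon>\<^sub>4 * \<alpha> j\<^sub>4"
        using p(6) res unfolding \<kappa>_def by simp
      show "\<epsilon>\<^sub>1 * \<alpha> j\<^sub>1 + \<epsilon>\<^sub>2 * \<alpha> j\<^sub>2 \<noteq> 0"
        unfolding res[symmetric] using E by simp
    qed
    then show "p \<in> ?R" by (auto simp: p(1))
  next
    fix p assume "p \<in> ?R"
    then show "p \<in> ?L" using j \<epsilon> res by (auto simp: I_def \<omega>_def \<kappa>_def)
  qed
  have rate: "C * (lam j\<^sub>1 * lam j\<^sub>2) = \<bar>\<Sum>(i, j)\<in>{(i, j). i \<in> I \<and> j \<in> I \<and> \<omega> i + \<omega> j = 2 * \<kappa>}.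
      \<mu> i * \<mu> j / (\<omega> i * \<omega> j)\<bar> / (8 * \<kappa>)"
  proof -
    have abs: "\<bar>lam j\<^sub>1 * lam j\<^sub>2 / (\<epsilon>\<^sub>1 * \<alpha> j\<^sub>1 * (\<epsilon>\<^sub>2 * \<alpha> j\<^sub>2))\<bar> = lam j\<^sub>1 * lam j\<^sub>2 / \<bar>\<alpha> j\<^sub>1 * \<alpha> j\<^sub>2\<bar>"
      using \<epsilon> lam[OF j(1)] lam[OF j(2)] by (auto simp: abs_mult)
    show ?thesis
    proof (cases "j\<^sub>1 = j\<^sub>2")
      case True
      then have "\<epsilon>\<^sub>1 = \<epsilon>\<^sub>2" using \<epsilon> res \<kappa>(1) by (auto simp: \<kappa>_def)
      with True have "(\<Sum>(i, j)\<in>{(i, j). i \<in> I \<and> j \<in> I \<and> \<omega> i + \<omega> j = 2 * \<kappa>}. \<mu> i * \<mu> j / (\<omega> i * \<omega> j))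
         = lam j\<^sub>1 * lam j\<^sub>2 / (\<epsilon>\<^sub>1 * \<alpha> j\<^sub>1 * (\<epsilon>\<^sub>2 * \<alpha> j\<^sub>2))"
        unfolding res_set by (simp add: \<mu>_def \<omega>_def)
      then have "\<bar>\<Sum>(i, j)\<in>{(i, j). i \<in> I \<and> j \<in> I \<and> \<omega> i + \<omega> j = 2 * \<kappa>}. \<mu> i * \<mu> j / (\<omega> i * \<omega> j)\<bar>
         = lam j\<^sub>1 * lam j\<^sub>2 / \<bar>\<alpha> j\<^sub>1 * \<alpha> j\<^sub>2\<bar>"
        by (simp only: abs)
      then show ?thesis using True by (simp add: C \<kappa>_def)
    next
      case False
      then have "(\<Sum>(i, j)\<in>{(i, j). i \<in> I \<and> j \<in> I \<and> \<omega> i + \<omega> j = 2 * \<kappa>}. \<mu> i * \<mu> j / (\<omega> i * \<omega> j))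
         = 2 * (lam j\<^sub>1 * lam j\<^sub>2 / (\<epsilon>\<^sub>1 * \<alpha> j\<^sub>1 * (\<epsilon>\<^sub>2 * \<alpha> j\<^sub>2)))"
        unfolding res_set by (simp add: \<mu>_def \<omega>_def mult_ac)
      then have "\<bar>\<Sum>(i, j)\<in>{(i, j). i \<in> I \<and> j \<in> I \<and> \<omega> i + \<omega> j = 2 * \<kappa>}. \<mu> i * \<mu> j / (\<omega> i * \<omega> j)\<bar>
         = 2 * (lam j\<^sub>1 * lam j\<^sub>2 / \<bar>\<alpha> j\<^sub>1 * \<alpha> j\<^sub>2\<bar>)"
        unfolding abs[symmetric] by (simp only: abs_mult abs_numeral)
      then show ?thesis using False by (simp add: C \<kappa>_def)
    qed
  qed
  obtain Y w \<phi> where Y: "Y \<ge> X"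
    and w: "\<And>x. x > Y \<Longrightarrow> (w has_vector_derivative \<i> * \<kappa> * w x + of_real (V x / \<kappa> * Im (w x))) (at x)"
    and w_lim: "((\<lambda>x. w x / (f x * cis (\<kappa> * x + \<phi>))) \<longlongrightarrow> 1) at_top"
  proof (rule resonant_decaying_solution[OF fin X(1) \<gamma> \<kappa>(1) \<omega>1 \<omega>2 W drift rate])
    fix x assume "x \<ge> X"
    then have "x > 0" using X by simp
    then show "f x > 0" "(f has_real_derivative - (C * (lam j\<^sub>1 * lam j\<^sub>2)) * x powr (- 2 * \<gamma>) * f x) (at x)"
      unfolding f_def by (rule decay_rate_pos, rule decay_rate_has_derivative[OF _ \<gamma>(2)])
  qed (assumption | rule that)+
  have "Y \<ge> 0" using Y X by simp
  obtain u where u: "schroedinger_solution V (\<kappa>\<^sup>2) u"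
    "AE x in lebesgue_on {0<..}. D_half u differentiable (at x within {0..})"
    "\<And>x. x > Y + 1 \<Longrightarrow> of_real (1 / \<kappa> * D_half u x) + \<i> * of_real (u x) = w x"
    by (rule half_line_solution_of_tail[OF decaying_potential_integrable[OF V x\<^sub>0] \<kappa>(1) \<open>Y \<ge> 0\<close> w])
       (assumption | rule that)+
  have "\<forall>\<^sub>F x in at_top. w x / (f x * cis (\<kappa> * x + \<phi>)) =
      (of_real (1 / \<kappa> * D_half u x) + \<i> * of_real (u x)) / (f x * cis (\<kappa> * x + \<phi>))"
    using eventually_gt_at_top[of "Y + 1"] by eventually_elim (simp add: u(3)[symmetric])
  from Lim_transform_eventually[OF w_lim this]
  show ?thesis using u(1,2) unfolding f_def \<kappa>_def
    by (intro that[of u \<phi>]) (use E in auto)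
qed

theorem theorem1p3:
  fixes K :: nat
  assumes "K \<ge> 1"
  shows "\<exists>P :: mpolynomial. P \<noteq> 0 \<and> mpoly_vars P \<subseteq> {1..K} \<and>
    (\<forall>(\<alpha> :: nat \<Rightarrow> real) (E :: real).
      mpoly_eval P \<alpha> \<noteq> 0 \<longrightarrow>
      E \<in> S_set (phase_set K \<alpha>) 3 - S_set (phase_set K \<alpha>) 2 \<longrightarrow>
      Min ((\<lambda>k. (\<alpha> k)\<^sup>2 / 4) ` {1..K}) < E \<longrightarrow>
      E < Max ((\<lambda>k. (\<alpha> k)\<^sup>2 / 4) ` {1..K}) \<longrightarrow>
      (\<exists>(C::real) > 0. \<exists>L :: real.
        \<forall>j\<^sub>1\<in>{1..K}. \<forall>j\<^sub>2\<in>{1..K}. \<forall>\<epsilon>\<^sub>1\<in>{1, -1 :: real}. \<forall>\<epsilon>\<^sub>2\<in>{1, -1 :: real}.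
          2 * sqrt E = \<epsilon>\<^sub>1 * \<alpha> j\<^sub>1 + \<epsilon>\<^sub>2 * \<alpha> j\<^sub>2 \<longrightarrow>
          (\<forall>\<gamma>\<in>{1/3<..1/2 :: real}. \<forall>lam :: nat \<Rightarrow> real.
            (\<forall>k\<in>{1..K}. lam k > 0) \<longrightarrow>
            (\<Sum>k=1..K. (lam k)\<^sup>2 / (4 * E - (\<alpha> k)\<^sup>2)) = 0 \<longrightarrow>
            (\<exists>\<xi> :: nat \<Rightarrow> real \<Rightarrow> real.
              (\<forall>k\<in>{1..K}. \<xi> k C1_differentiable_on {0<..} \<and>
                 deriv (\<xi> k) \<in> O[at_top](\<lambda>x. x powr (- 3 * \<gamma>))) \<and>
              (\<forall>x\<^sub>0>0. \<forall>V :: real \<Rightarrow> real. decaying_potential K \<alpha> lam \<gamma> \<xi> x\<^sub>0 V \<longrightarrow>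
                 (\<exists>u :: real \<Rightarrow> real. schroedinger_solution V E u \<and>
                    (\<exists>A>0. \<exists>\<phi> :: real.
                       (\<lambda>x. of_real (1 / sqrt E * D_half u x) + \<i> * of_real (u x)) \<sim>[at_top]
                       (\<lambda>x. of_real (A * decay_rate C \<gamma> (lam j\<^sub>1 * lam j\<^sub>2) x) *
                            exp (\<i> * of_real (sqrt E * x + \<phi>))))) \<and>
                 (\<gamma> < 1/2 \<or> L \<le> lam j\<^sub>1 * lam j\<^sub>2 \<longrightarrow>
                    (\<exists>\<theta>\<in>{0..<pi}. H_eigenvalue V \<theta> E)))))))"
proof -
  obtain P :: mpolynomial where P: "P \<noteq> 0" "mpoly_vars P \<subseteq> {1..K}"
    and generic: "\<And>\<alpha>. mpoly_eval P \<alpha> \<noteq> 0 \<Longrightarrow> no_small_relation K \<alpha>"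
    by (rule polynomial_excluding_linear_relations[of "{-4,-3,-2,-1,0,1,2,3,4}" K])
       (auto simp: no_small_relation_def)
  show ?thesis
  proof (rule exI[of _ P], intro conjI P allI impI)
    fix \<alpha> :: "nat \<Rightarrow> real" and E :: real
    assume \<alpha>: "mpoly_eval P \<alpha> \<noteq> 0" and E_S: "E \<in> S_set (phase_set K \<alpha>) 3 - S_set (phase_set K \<alpha>) 2"
    have rel: "no_small_relation K \<alpha>" by (rule generic[OF \<alpha>])
    have S2: "\<eta>\<^sup>2 / 4 \<in> S_set (phase_set K \<alpha>) 2" if "\<eta> \<in> phase_set K \<alpha>" for \<eta>
      using that by (auto simp: S_set_def)
    have "E \<ge> 0" using E_S by (auto simp: S_set_def)
    moreover have "E \<noteq> 0" using S2[of 0] E_S by (auto simp: phase_set_def)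
    ultimately have E: "E > 0" by simp
    have nonres: "(\<alpha> k)\<^sup>2 \<noteq> 4 * E" if "k \<in> {1..K}" for k
      using S2[of "\<alpha> k"] E_S that by (auto simp: phase_set_def)
    have \<alpha>_nz: "\<alpha> k \<noteq> 0" if "k \<in> {1..K}" for k
      using signed_pair_sum_unique(1)[OF rel that that, of 1 1] by auto
    \<comment> \<open>\<open>C\<close> has to be fixed before \<open>j\<^sub>1, j\<^sub>2\<close>; the formula for it gives the same value for all representations
      of \<open>2 sqrt E\<close>, since these differ only by the order of the two summands.\<close>
    define rep where "rep = (\<lambda>j\<^sub>1 j\<^sub>2. j\<^sub>1 \<in> {1..K} \<and> j\<^sub>2 \<in> {1..K} \<and>
      (\<exists>\<epsilon>\<^sub>1\<in>{1, -1 :: real}. \<exists>\<epsilon>\<^sub>2\<in>{1, -1 :: real}. 2 * sqrt E = \<epsilon>\<^sub>1 * \<alpha> j\<^sub>1 + \<epsilon>\<^sub>2 * \<alpha> j\<^sub>2))"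
    define c where "c = (\<lambda>j\<^sub>1 j\<^sub>2. (if j\<^sub>1 = j\<^sub>2 then 1 else 2) / (8 * sqrt E * \<bar>\<alpha> j\<^sub>1 * \<alpha> j\<^sub>2\<bar>))"
    have c_unique: "c j\<^sub>1 j\<^sub>2 = c j\<^sub>3 j\<^sub>4" if "rep j\<^sub>1 j\<^sub>2" "rep j\<^sub>3 j\<^sub>4" for j\<^sub>1 j\<^sub>2 j\<^sub>3 j\<^sub>4
    proof -
      obtain \<epsilon>\<^sub>1 \<epsilon>\<^sub>2 where 1: "j\<^sub>1 \<in> {1..K}" "j\<^sub>2 \<in> {1..K}" "\<epsilon>\<^sub>1 \<in> {1, -1}" "\<epsilon>\<^sub>2 \<in> {1, -1}"
        "2 * sqrt E = \<epsilon>\<^sub>1 * \<alpha> j\<^sub>1 + \<epsilon>\<^sub>2 * \<alpha> j\<^sub>2"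
        using \<open>rep j\<^sub>1 j\<^sub>2\<close> unfolding rep_def by blast
      obtain \<epsilon>\<^sub>3 \<epsilon>\<^sub>4 where 2: "j\<^sub>3 \<in> {1..K}" "j\<^sub>4 \<in> {1..K}" "\<epsilon>\<^sub>3 \<in> {1, -1}" "\<epsilon>\<^sub>4 \<in> {1, -1}"
        "2 * sqrt E = \<epsilon>\<^sub>3 * \<alpha> j\<^sub>3 + \<epsilon>\<^sub>4 * \<alpha> j\<^sub>4"
        using \<open>rep j\<^sub>3 j\<^sub>4\<close> unfolding rep_def by blast
      have nz: "\<epsilon>\<^sub>1 * \<alpha> j\<^sub>1 + \<epsilon>\<^sub>2 * \<alpha> j\<^sub>2 \<noteq> 0" unfolding 1(5)[symmetric] using E by simp
      have "j\<^sub>3 = j\<^sub>1 \<and> j\<^sub>4 = j\<^sub>2 \<or> j\<^sub>3 = j\<^sub>2 \<and> j\<^sub>4 = j\<^sub>1"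
        using signed_pair_sum_unique(2)[OF rel 1(1-4) 2(1-4) trans[OF 1(5)[symmetric] 2(5)] nz] by blast
      then show ?thesis by (auto simp: c_def mult.commute)
    qed
    have c_pos: "c j\<^sub>1 j\<^sub>2 > 0" if "rep j\<^sub>1 j\<^sub>2" for j\<^sub>1 j\<^sub>2
      using that E \<alpha>_nz by (auto simp: c_def rep_def)
    obtain C where C: "C > 0" "\<And>j\<^sub>1 j\<^sub>2. rep j\<^sub>1 j\<^sub>2 \<Longrightarrow> C = c j\<^sub>1 j\<^sub>2"
    proof (cases "\<exists>j\<^sub>1 j\<^sub>2. rep j\<^sub>1 j\<^sub>2")
      case True
      then obtain j\<^sub>1 j\<^sub>2 where "rep j\<^sub>1 j\<^sub>2" by blast
      then show ?thesis using that[of "c j\<^sub>1 j\<^sub>2"] c_pos c_unique by blast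
    next
      case False
      then show ?thesis using that[of 1] by simp
    qed
    show "\<exists>(C::real) > 0. \<exists>L :: real.
        \<forall>j\<^sub>1\<in>{1..K}. \<forall>j\<^sub>2\<in>{1..K}. \<forall>\<epsilon>\<^sub>1\<in>{1, -1 :: real}. \<forall>\<epsilon>\<^sub>2\<in>{1, -1 :: real}.
          2 * sqrt E = \<epsilon>\<^sub>1 * \<alpha> j\<^sub>1 + \<epsilon>\<^sub>2 * \<alpha> j\<^sub>2 \<longrightarrow>
          (\<forall>\<gamma>\<in>{1/3<..1/2 :: real}. \<forall>lam :: nat \<Rightarrow> real.
            (\<forall>k\<in>{1..K}. lam k > 0) \<longrightarrow>
            (\<Sum>k=1..K. (lam k)\<^sup>2 / (4 * E - (\<alpha> k)\<^sup>2)) = 0 \<longrightarrow>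
            (\<exists>\<xi> :: nat \<Rightarrow> real \<Rightarrow> real.
              (\<forall>k\<in>{1..K}. \<xi> k C1_differentiable_on {0<..} \<and>
                 deriv (\<xi> k) \<in> O[at_top](\<lambda>x. x powr (- 3 * \<gamma>))) \<and>
              (\<forall>x\<^sub>0>0. \<forall>V :: real \<Rightarrow> real. decaying_potential K \<alpha> lam \<gamma> \<xi> x\<^sub>0 V \<longrightarrow>
                 (\<exists>u :: real \<Rightarrow> real. schroedinger_solution V E u \<and>
                    (\<exists>A>0. \<exists>\<phi> :: real.
                       (\<lambda>x. of_real (1 / sqrt E * D_half u x) + \<i> * of_real (u x)) \<sim>[at_top]
                       (\<lambda>x. of_real (A * decay_rate C \<gamma> (lam j\<^sub>1 * lam j\<^sub>2) x) *
                            exp (\<i> * of_real (sqrt E * x + \<phi>))))) \<and>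
                 (\<gamma> < 1/2 \<or> L \<le> lam j\<^sub>1 * lam j\<^sub>2 \<longrightarrow>
                    (\<exists>\<theta>\<in>{0..<pi}. H_eigenvalue V \<theta> E)))))"
    \<comment> \<open>For \<open>\<lambda>\<^bsub>j\<^sub>1\<^esub> \<lambda>\<^bsub>j\<^sub>2\<^esub> \<ge> 1 / C\<close> the square of the decay rate is at most \<open>x\<^bsup>-2\<^esup>\<close>
      for \<open>\<gamma> = 1/2\<close> and \<open>x \<ge> 1\<close>, which is integrable at infinity.\<close>
    proof (rule exI[of _ C], rule conjI[OF C(1)], rule exI[of _ "1 / C"], intro ballI impI allI,
           rule exI[of _ "\<lambda>_ _. 0"], rule conjI)
      fix j\<^sub>1 j\<^sub>2 and \<epsilon>\<^sub>1 \<epsilon>\<^sub>2 \<gamma> :: real and lam :: "nat \<Rightarrow> real"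
      assume j: "j\<^sub>1 \<in> {1..K}" "j\<^sub>2 \<in> {1..K}" and \<epsilon>: "\<epsilon>\<^sub>1 \<in> {1, -1}" "\<epsilon>\<^sub>2 \<in> {1, -1}"
        and res: "2 * sqrt E = \<epsilon>\<^sub>1 * \<alpha> j\<^sub>1 + \<epsilon>\<^sub>2 * \<alpha> j\<^sub>2" and \<gamma>: "\<gamma> \<in> {1/3<..1/2}"
        and lam: "\<forall>k\<in>{1..K}. lam k > 0"
        and no_drift: "(\<Sum>k=1..K. (lam k)\<^sup>2 / (4 * E - (\<alpha> k)\<^sup>2)) = 0"
      show "\<forall>k\<in>{1..K}. (\<lambda>_. 0 :: real) C1_differentiable_on {0<..} \<and>
                 deriv (\<lambda>_. 0 :: real) \<in> O[at_top](\<lambda>x. x powr (- 3 * \<gamma>))"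
        by simp
      have "rep j\<^sub>1 j\<^sub>2" using j \<epsilon> res unfolding rep_def by blast
      from C(2)[OF this] have C_eq: "C = (if j\<^sub>1 = j\<^sub>2 then 1 else 2) / (8 * sqrt E * \<bar>\<alpha> j\<^sub>1 * \<alpha> j\<^sub>2\<bar>)"
        by (simp add: c_def)
      show "\<forall>x\<^sub>0>0. \<forall>V :: real \<Rightarrow> real. decaying_potential K \<alpha> lam \<gamma> (\<lambda>_ _. 0) x\<^sub>0 V \<longrightarrow>
                 (\<exists>u :: real \<Rightarrow> real. schroedinger_solution V E u \<and>
                    (\<exists>A>0. \<exists>\<phi> :: real.
                       (\<lambda>x. of_real (1 / sqrt E * D_half u x) + \<i> * of_real (u x)) \<sim>[at_top]
                       (\<lambda>x. of_real (A * decay_rate C \<gamma> (lam j\<^sub>1 * lam j\<^sub>2) x) *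
                            exp (\<i> * of_real (sqrt E * x + \<phi>))))) \<and>
                 (\<gamma> < 1/2 \<or> 1 / C \<le> lam j\<^sub>1 * lam j\<^sub>2 \<longrightarrow>
                    (\<exists>\<theta>\<in>{0..<pi}. H_eigenvalue V \<theta> E))"
      proof (intro allI impI)
        fix x\<^sub>0 :: real and V :: "real \<Rightarrow> real"
        assume x\<^sub>0: "x\<^sub>0 > 0" and V: "decaying_potential K \<alpha> lam \<gamma> (\<lambda>_ _. 0) x\<^sub>0 V"
        define f where "f = decay_rate C \<gamma> (lam j\<^sub>1 * lam j\<^sub>2)"
        obtain u \<phi> where sol: "schroedinger_solution V E u"
          and D2: "AE x in lebesgue_on {0<..}. D_half u differentiable (at x within {0..})"
          and lim: "((\<lambda>x. (of_real (1 / sqrt E * D_half u x) + \<i> * of_real (u x)) /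
            (f x * cis (sqrt E * x + \<phi>))) \<longlongrightarrow> 1) at_top"
        proof (rule oscillating_potential_decaying_solution[OF E _ _ rel nonres j \<epsilon> res _ no_drift C_eq x\<^sub>0 V])
          show "1/3 < \<gamma>" "\<gamma> \<le> 1/2" using \<gamma> by auto
          show "lam k > 0" if "k \<in> {1..K}" for k using lam that by blast
        qed (assumption | (rule that; unfold f_def; assumption))+
        have asymp: "(\<lambda>x. of_real (1 / sqrt E * D_half u x) + \<i> * of_real (u x)) \<sim>[at_top]
            (\<lambda>x. of_real (1 * f x) * exp (\<i> * of_real (sqrt E * x + \<phi>)))"
          by (rule asymp_equivI') (use lim in \<open>simp add: cis_conv_exp\<close>)
        have eigenvalue: "\<exists>\<theta>\<in>{0..<pi}. H_eigenvalue V \<theta> E" if large: "\<gamma> < 1/2 \<or> 1 / C \<le> lam j\<^sub>1 * lam j\<^sub>2"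
        proof (rule eigenvalue_of_decaying_solution[OF sol D2 lim])
          fix Z :: real assume Z: "Z > 0"
          have pos: "C * (lam j\<^sub>1 * lam j\<^sub>2) > 0" using C(1) lam j by simp
          have "1 \<le> C * (lam j\<^sub>1 * lam j\<^sub>2)" if "1 / C \<le> lam j\<^sub>1 * lam j\<^sub>2"
            using that C(1) by (simp add: divide_le_eq mult.commute)
          then have "\<gamma> < 1/2 \<or> \<gamma> = 1/2 \<and> 2 * (C * (lam j\<^sub>1 * lam j\<^sub>2)) > 1"
            using large \<gamma> by fastforce
          then show "(\<lambda>x. (f x)\<^sup>2) integrable_on {Z..}"
            unfolding f_def by (rule decay_rate_square_integrable[OF pos _ Z])
        qed
        show "(\<exists>u :: real \<Rightarrow> real. schroedinger_solution V E u \<and>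
                    (\<exists>A>0. \<exists>\<phi> :: real.
                       (\<lambda>x. of_real (1 / sqrt E * D_half u x) + \<i> * of_real (u x)) \<sim>[at_top]
                       (\<lambda>x. of_real (A * decay_rate C \<gamma> (lam j\<^sub>1 * lam j\<^sub>2) x) *
                            exp (\<i> * of_real (sqrt E * x + \<phi>))))) \<and>
                 (\<gamma> < 1/2 \<or> 1 / C \<le> lam j\<^sub>1 * lam j\<^sub>2 \<longrightarrow>
                    (\<exists>\<theta>\<in>{0..<pi}. H_eigenvalue V \<theta> E))"
          using sol asymp[unfolded f_def] zero_less_one eigenvalue by blast
      qed
    qed
  qed
qed

end
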